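(* Let $\sigma\ge0$, with $\sigma>0$ if $\mathcal{H}^{n-1}(\Gamma_D)=0$, and let $p\in\mathbb{R}$ satisfy $1<p<\infty$ and $p\ge\frac{2n}{n+2}$. For $i=1,2$, let $f_i\in L^p(\Omega)$ and $\psi_i\in V$ be such that $A\psi_i\in L^p(\Omega)$, and set $K_0^i:=\{v\in V: v\ge\psi_i\text{ a.e. in }\Omega\}$. Let $u_i\in V$ be the unique solution of the variational inequality $$u_i\in K_0^i,\qquad a(u_i,v-u_i)\ge\langle f_i,v-u_i\rangle_V\quad\text{for all }v\in K_0^i,$$ for $i=1,2$. If $f_1\le f_2$ and $\psi_1\le\psi_2$ a.e. in $\Omega$, then $u_1\le u_2$ a.e. in $\Omega$.
   Context: $\Omega\subset\mathbb{R}^n$ ($n\in\mathbb{N}$) is a bounded Lipschitz domain whose boundary $\Gamma$ is the disjoint union of $\Gamma_D$ (relatively open in $\Gamma$) and $\Gamma_N$ (one may be empty). $\gamma_0$ is the trace operator, $\mathcal{H}^{n-1}$ is the $(n-1)$-dimensional Hausdorff measure, and $V:=\{v\in H^1(\Omega):\gamma_0v=0\ \mathcal{H}^{n-1}\text{-a.e. on }\Gamma_D\}$ with the $H^1(\Omega)$ norm. $\langle\cdot,\cdot\rangle_V$ is the duality pairing between $V'$ and $V$; $L^p(\Omega)$ is embedded in $V'$ via $\langle g,v\rangle_V=\int_\Omega gv\,dx$. $A=A_\sigma:V\to V'$ and $a$ are given by $a(u,v)=\langle Au,v\rangle_V=\int_\Omega(\nabla u\cdot\nabla v+\sigma uv)\,dx$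 for $u,v\in V$. *)

theory Defs
  imports "HOL-Analysis.Analysis"
begin

text \<open>
  Euclidean space \<open>R^n\<close> is a type \<open>'a\<close> of class \<open>euclidean_space\<close> with \<open>n = DIM('a)\<close>.
  Elements of Lebesgue and Sobolev spaces are represented by functions on all of \<open>'a\<close>; only their
  restriction to the set in question, up to null sets, matters.
\<close>

subsection \<open>Domains\<close>

text \<open>
  Near each boundary point, \<open>\<Omega>\<close> is the subgraph of a Lipschitz function in a rotated coordinate system
  with vertical direction \<open>e\<close>; \<open>y - (y \<bullet> e) *\<^sub>R e\<close> is the orthogonal projection of \<open>y\<close> onto the
  hyperplane orthogonal to \<open>e\<close>, so only the values of \<open>h\<close> on that hyperplane are used.
\<close>

definition bounded_lipschitz_domain :: "'a::euclidean_space set \<Rightarrow> bool" where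
  "bounded_lipschitz_domain \<Omega> \<longleftrightarrow>
     open \<Omega> \<and> connected \<Omega> \<and> \<Omega> \<noteq> {} \<and> bounded \<Omega> \<and>
     (\<forall>x\<in>frontier \<Omega>. \<exists>r>0. \<exists>e. \<exists>L. \<exists>h. norm e = 1 \<and> L-lipschitz_on UNIV (h :: 'a \<Rightarrow> real) \<and>
        \<Omega> \<inter> ball x r = {y \<in> ball x r. y \<bullet> e < h (y - (y \<bullet> e) *\<^sub>R e)})"

subsection \<open>Hausdorff measure\<close>

text \<open>
  The weight of the empty set is 0 and, since \<open>0 ^ 0 = 1\<close>, the 0-dimensional weight of a singleton
  is 1, so the 0-dimensional Hausdorff measure is counting measure.  The normalising factor is the
  volume of the \<open>s\<close>-dimensional unit ball.
\<close>

definition hausdorff_weight :: "nat \<Rightarrow> 'a::metric_space set \<Rightarrow> real" where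
  "hausdorff_weight s U =
     (if U = {} then 0 else unit_ball_vol (real s) * (diameter U / 2) ^ s)"

definition hausdorff_content :: "nat \<Rightarrow> real \<Rightarrow> 'a::metric_space set \<Rightarrow> ennreal" where
  "hausdorff_content s \<delta> A =
     (INF U \<in> {U :: nat \<Rightarrow> 'a set. A \<subseteq> (\<Union>i. U i) \<and> (\<forall>i. bounded (U i) \<and> diameter (U i) \<le> \<delta>)}.
        (\<Sum>i. ennreal (hausdorff_weight s (U i))))"

definition hausdorff_outer_measure :: "nat \<Rightarrow> 'a::metric_space set \<Rightarrow> ennreal" where
  "hausdorff_outer_measure s A = (SUP \<delta>\<in>{0<..}. hausdorff_content s \<delta> A)"

text \<open>
  The outer measure is a metric outer measure, hence countably additive on the Borel sets by
  Caratheodory's criterion, so that \<open>measure_of\<close> does not degenerate to the null measure here.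
\<close>

definition hausdorff_measure :: "nat \<Rightarrow> 'a::metric_space measure" where
  "hausdorff_measure s = measure_of UNIV (sets borel) (hausdorff_outer_measure s)"

definition boundary_measure :: "'a::euclidean_space set \<Rightarrow> 'a measure" where
  "boundary_measure \<Omega> = restrict_space (hausdorff_measure (DIM('a) - 1)) (frontier \<Omega>)"

subsection \<open>Lebesgue and Sobolev spaces\<close>

definition Lp :: "real \<Rightarrow> 'a measure \<Rightarrow> ('a \<Rightarrow> real) set" where
  "Lp p M = {f \<in> borel_measurable M. integrable M (\<lambda>x. \<bar>f x\<bar> powr p)}"

abbreviation partial_deriv :: "'a::euclidean_space \<Rightarrow> ('a \<Rightarrow> real) \<Rightarrow> 'a \<Rightarrow> real" where
  "partial_deriv b f \<equiv> (\<lambda>x. frechet_derivative f (at x) b)"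

primrec k_times_cont_diff :: "nat \<Rightarrow> ('a::euclidean_space \<Rightarrow> real) \<Rightarrow> bool" where
  "k_times_cont_diff 0 f \<longleftrightarrow> continuous_on UNIV f"
| "k_times_cont_diff (Suc k) f \<longleftrightarrow>
     (\<forall>x. f differentiable (at x)) \<and> (\<forall>b\<in>Basis. k_times_cont_diff k (partial_deriv b f))"

definition test_functions :: "'a::euclidean_space set \<Rightarrow> ('a \<Rightarrow> real) set" where
  "test_functions \<Omega> =
     {\<phi>. (\<forall>k. k_times_cont_diff k \<phi>) \<and> compact (closure {x. \<phi> x \<noteq> 0}) \<and> closure {x. \<phi> x \<noteq> 0} \<subseteq> \<Omega>}"

definition has_L2_weak_gradient ::
    "'a::euclidean_space set \<Rightarrow> ('a \<Rightarrow> real) \<Rightarrow> ('a \<Rightarrow> 'a) \<Rightarrow> bool" where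
  "has_L2_weak_gradient \<Omega> u g \<longleftrightarrow>
     (\<forall>b\<in>Basis. (\<lambda>x. g x \<bullet> b) \<in> Lp 2 (lebesgue_on \<Omega>) \<and>
        (\<forall>\<phi>\<in>test_functions \<Omega>.
           (LINT x|lebesgue_on \<Omega>. u x * partial_deriv b \<phi> x) =
             - (LINT x|lebesgue_on \<Omega>. (g x \<bullet> b) * \<phi> x)))"

definition H1 :: "'a::euclidean_space set \<Rightarrow> ('a \<Rightarrow> real) set" where
  "H1 \<Omega> = {u \<in> Lp 2 (lebesgue_on \<Omega>). \<exists>g. has_L2_weak_gradient \<Omega> u g}"

text \<open>The weak gradient is determined up to a null set.\<close>

definition weak_grad :: "'a::euclidean_space set \<Rightarrow> ('a \<Rightarrow> real) \<Rightarrow> 'a \<Rightarrow> 'a" where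
  "weak_grad \<Omega> u = (SOME g. has_L2_weak_gradient \<Omega> u g)"

definition L2_norm :: "'a measure \<Rightarrow> ('a \<Rightarrow> real) \<Rightarrow> real" where
  "L2_norm M u = sqrt (LINT x|M. (u x)\<^sup>2)"

definition H1_norm :: "'a::euclidean_space set \<Rightarrow> ('a \<Rightarrow> real) \<Rightarrow> real" where
  "H1_norm \<Omega> u =
     sqrt (LINT x|lebesgue_on \<Omega>. (u x)\<^sup>2 + weak_grad \<Omega> u x \<bullet> weak_grad \<Omega> u x)"

subsection \<open>Traces\<close>

text \<open>
  The trace operator is the bounded linear operator from \<open>H\<^sup>1(\<Omega>)\<close> to \<open>L\<^sup>2\<close> of the boundary that
  restricts every function continuous up to the boundary.  On a bounded Lipschitz domain it exists
  and is unique up to null sets.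
\<close>

definition trace_operator ::
    "'a::euclidean_space set \<Rightarrow> (('a \<Rightarrow> real) \<Rightarrow> ('a \<Rightarrow> real)) \<Rightarrow> bool" where
  "trace_operator \<Omega> T \<longleftrightarrow>
     (\<forall>u\<in>H1 \<Omega>. T u \<in> Lp 2 (boundary_measure \<Omega>)) \<and>
     (\<forall>u\<in>H1 \<Omega>. \<forall>v\<in>H1 \<Omega>. AE x in boundary_measure \<Omega>. T (\<lambda>y. u y + v y) x = T u x + T v x) \<and>
     (\<forall>c. \<forall>u\<in>H1 \<Omega>. AE x in boundary_measure \<Omega>. T (\<lambda>y. c * u y) x = c * T u x) \<and>
     (\<exists>C. \<forall>u\<in>H1 \<Omega>. L2_norm (boundary_measure \<Omega>) (T u) \<le> C * H1_norm \<Omega> u) \<and>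
     (\<forall>u\<in>H1 \<Omega>. continuous_on (closure \<Omega>) u \<longrightarrow> (AE x in boundary_measure \<Omega>. T u x = u x))"

definition V_space ::
    "'a::euclidean_space set \<Rightarrow> 'a set \<Rightarrow> (('a \<Rightarrow> real) \<Rightarrow> ('a \<Rightarrow> real)) \<Rightarrow> ('a \<Rightarrow> real) set" where
  "V_space \<Omega> \<Gamma>\<^sub>D \<gamma>\<^sub>0 = {v \<in> H1 \<Omega>. AE x in boundary_measure \<Omega>. x \<in> \<Gamma>\<^sub>D \<longrightarrow> \<gamma>\<^sub>0 v x = 0}"

subsection \<open>The variational inequality\<close>

text \<open>
  Elements of the dual of \<open>V\<close> are functionals on functions, and the duality pairing is application.
  \<open>A_op \<Omega> \<sigma> u v\<close> is thus the bilinear form \<open>a(u, v)\<close>.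
\<close>

definition A_op ::
    "'a::euclidean_space set \<Rightarrow> real \<Rightarrow> ('a \<Rightarrow> real) \<Rightarrow> ('a \<Rightarrow> real) \<Rightarrow> real" where
  "A_op \<Omega> \<sigma> u v =
     (LINT x|lebesgue_on \<Omega>. weak_grad \<Omega> u x \<bullet> weak_grad \<Omega> v x + \<sigma> * u x * v x)"

definition Lp_functional :: "'a::euclidean_space set \<Rightarrow> ('a \<Rightarrow> real) \<Rightarrow> ('a \<Rightarrow> real) \<Rightarrow> real" where
  "Lp_functional \<Omega> g v = (LINT x|lebesgue_on \<Omega>. g x * v x)"

text \<open>Membership of a functional on \<open>V\<close> in the embedded copy of \<open>L\<^sup>p(\<Omega>)\<close>.\<close>

definition functional_in_Lp ::
    "real \<Rightarrow> 'a::euclidean_space set \<Rightarrow> ('a \<Rightarrow> real) set \<Rightarrow> (('a \<Rightarrow> real) \<Rightarrow> real) \<Rightarrow> bool" where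
  "functional_in_Lp p \<Omega> V F \<longleftrightarrow>
     (\<exists>g\<in>Lp p (lebesgue_on \<Omega>). \<forall>v\<in>V. F v = Lp_functional \<Omega> g v)"

definition K0 ::
    "'a::euclidean_space set \<Rightarrow> ('a \<Rightarrow> real) set \<Rightarrow> ('a \<Rightarrow> real) \<Rightarrow> ('a \<Rightarrow> real) set" where
  "K0 \<Omega> V \<psi> = {v \<in> V. AE x in lebesgue_on \<Omega>. \<psi> x \<le> v x}"

definition solves_VI ::
    "'a::euclidean_space set \<Rightarrow> real \<Rightarrow> ('a \<Rightarrow> real) set \<Rightarrow> ('a \<Rightarrow> real) \<Rightarrow> ('a \<Rightarrow> real) \<Rightarrow> bool" where
  "solves_VI \<Omega> \<sigma> K f u \<longleftrightarrow>
     u \<in> K \<and> (\<forall>v\<in>K. A_op \<Omega> \<sigma> u (\<lambda>x. v x - u x) \<ge> Lp_functional \<Omega> f (\<lambda>x. v x - u x))"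

end

theory Submission
  imports Defs "HOL-Probability.Probability_Measure"
begin

text \<open>
  With \<open>w = \<Phi>(u\<^sub>1 - u\<^sub>2)\<close>, where \<open>\<Phi>\<close> is a bounded \<open>C\<^sup>1\<close> function that vanishes on the negative half-line and
  satisfies \<open>0 < \<Phi>(t) \<le> t\<close> for \<open>t > 0\<close>, the functions \<open>u\<^sub>1 - w\<close> and \<open>u\<^sub>2 + w\<close> are admissible in the two
  variational inequalities. Adding them gives, with \<open>u = u\<^sub>1 - u\<^sub>2\<close>, that the integral of
  \<open>\<Phi>'(u) |\<nabla>u|\<^sup>2 + \<sigma> u \<Phi>(u)\<close> is at most 0. If \<open>\<sigma> > 0\<close> this forces \<open>u \<le> 0\<close>; otherwise \<open>w\<close> has zero gradient,
  so it is constant, and its trace vanishes on a boundary part of positive measure.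

  The trace operator is known only on functions continuous up to the boundary, so that \<open>w\<close> has zero trace where
  \<open>u\<close> does rests on the density of these functions in \<open>H\<^sup>1(\<Omega>)\<close>: localise with smooth cutoffs, translate into
  the domain and average over small balls. Continuity of translations in \<open>L\<^sup>2\<close> gives the convergence, and
  averaging also yields the fundamental lemma of the calculus of variations and the chain rule.
\<close>

subsection \<open>Square-integrable functions\<close>

text \<open>Since \<open>0 \<le> w \<le> max 0 (u1 - u2)\<close>, both competitors respect their
  obstacles, and the sum of the two inequalities is bounded above by the integral of
  \<open>(f1 - f2) * w\<close>, which is where \<open>f1 \<le> f2\<close> enters. The delicate point
  is \<open>w \<in> V\<close>. A trace operator is specified by linearity, boundedness and its
  values on continuous functions, so its action on a composition \<Phi>(u) has to be recovered from
  approximants \<open>U\<close> of \<open>u\<close>. Where the trace of \<open>u\<close> vanishes,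
  the trace of \<Phi>(u) differs from \<Phi>(U) by the trace of \<Phi>(U) - \<Phi>(u), while
  |\<Phi>(U)| is at most a multiple of |U|, that is, of the trace of \<open>U - u\<close>. Both
  errors are controlled by H^1 distances, so \<Phi>(U) must converge to \<Phi>(u) together with its
  gradients. The role of \<open>U\<close> asks for continuity up to the boundary, which averages
  over balls provide. The same averaging, along a segment instead of over a ball, turns a
  directional derivative into an increment; hence averages against a general probability measure are
  the common tool.\<close>

definition square_integrable :: "'a measure \<Rightarrow> ('a \<Rightarrow> real) \<Rightarrow> bool" where
  "square_integrable M f \<longleftrightarrow> f \<in> borel_measurable M \<and> integrable M (\<lambda>x. (f x)\<^sup>2)"

definition sq_integral :: "'a measure \<Rightarrow> ('a \<Rightarrow> real) \<Rightarrow> real" where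
  "sq_integral M f = (LINT x|M. (f x)\<^sup>2)"

lemma square_integrable_measurable [measurable_dest]:
  "square_integrable M f \<Longrightarrow> f \<in> borel_measurable M"
  by (simp add: square_integrable_def)

lemma square_integrable_integrable:
  "square_integrable M f \<Longrightarrow> integrable M (\<lambda>x. (f x)\<^sup>2)"
  by (simp add: square_integrable_def)

lemma square_integrable_bound:
  assumes "integrable M h" "f \<in> borel_measurable M" "AE x in M. (f x)\<^sup>2 \<le> h x"
  shows "square_integrable M f"
proof -
  have "AE x in M. norm ((f x)\<^sup>2) \<le> norm (h x)"
    using assms(3) by (auto elim!: eventually_mono)
  then show ?thesis
    using assms(2) Bochner_Integration.integrable_bound[OF assms(1), of "\<lambda>x. (f x)\<^sup>2"]
    by (auto simp: square_integrable_def)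
qed

lemma square_integrable_mult_integrable:
  assumes "square_integrable M f" "square_integrable M g"
  shows "integrable M (\<lambda>x. f x * g x)"
proof (rule Bochner_Integration.integrable_bound)
  show "integrable M (\<lambda>x. (f x)\<^sup>2 + (g x)\<^sup>2)"
    using assms by (auto simp: square_integrable_def)
  have "\<bar>f x * g x\<bar> \<le> (f x)\<^sup>2 + (g x)\<^sup>2" for x
    using sum_squares_bound[of "\<bar>f x\<bar>" "\<bar>g x\<bar>"] by (simp add: abs_mult mult.assoc)
      (smt (verit) zero_le_power2 zero_le_mult_iff)
  then show "AE x in M. norm (f x * g x) \<le> norm ((f x)\<^sup>2 + (g x)\<^sup>2)"
    by auto
qed (use assms in \<open>auto dest!: square_integrable_measurable\<close>)

lemma square_integrable_add [intro]:
  assumes "square_integrable M f" "square_integrable M g"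
  shows "square_integrable M (\<lambda>x. f x + g x)"
  using assms square_integrable_mult_integrable[OF assms]
  by (auto simp: square_integrable_def power2_sum mult.assoc)

lemma square_integrable_cmult [intro]:
  assumes "square_integrable M f"
  shows "square_integrable M (\<lambda>x. c * f x)"
  using assms by (auto simp: square_integrable_def power_mult_distrib)

lemma square_integrable_minus [intro]:
  assumes "square_integrable M f"
  shows "square_integrable M (\<lambda>x. - f x)"
  using assms by (auto simp: square_integrable_def)

lemma square_integrable_diff [intro]:
  assumes "square_integrable M f" "square_integrable M g"
  shows "square_integrable M (\<lambda>x. f x - g x)"
  using square_integrable_add[OF assms(1) square_integrable_minus[OF assms(2)]] by simp

lemma square_integrable_abs:
  assumes f: "square_integrable M f"
  shows "square_integrable M (\<lambda>x. \<bar>f x\<bar>)"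
  using square_integrable_integrable[OF f] borel_measurable_abs[OF square_integrable_measurable[OF f]]
  by (simp add: square_integrable_def)

lemma square_integrable_zero [intro, simp]: "square_integrable M (\<lambda>x. 0)"
  by (auto simp: square_integrable_def)

lemma square_integrable_sum [intro]:
  "(\<And>i. i \<in> I \<Longrightarrow> square_integrable M (f i)) \<Longrightarrow> square_integrable M (\<lambda>x. \<Sum>i\<in>I. f i x)"
  by (induction I rule: infinite_finite_induct) auto

lemma square_integrable_bounded_mult:
  assumes "square_integrable M f" "g \<in> borel_measurable M" "AE x in M. \<bar>g x\<bar> \<le> B"
  shows "square_integrable M (\<lambda>x. g x * f x)"
proof (rule square_integrable_bound)
  show "integrable M (\<lambda>x. B\<^sup>2 * (f x)\<^sup>2)"
    using assms by (auto simp: square_integrable_def)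
  show "AE x in M. (g x * f x)\<^sup>2 \<le> B\<^sup>2 * (f x)\<^sup>2"
    using assms(3)
  proof eventually_elim
    case (elim x)
    then have "(g x)\<^sup>2 \<le> B\<^sup>2"
      by (meson abs_ge_zero abs_le_square_iff order_trans abs_le_iff abs_le_self_iff power2_abs)
    then show ?case by (auto simp: power_mult_distrib intro!: mult_right_mono)
  qed
qed (use assms in \<open>auto dest!: square_integrable_measurable\<close>)

lemma sq_integral_nonneg [simp]: "0 \<le> sq_integral M f"
  by (auto simp: sq_integral_def)

lemma sq_integral_cmult: "sq_integral M (\<lambda>x. c * f x) = c\<^sup>2 * sq_integral M f"
  by (simp add: sq_integral_def power_mult_distrib)

lemma sq_integral_minus [simp]: "sq_integral M (\<lambda>x. - f x) = sq_integral M f"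
  by (simp add: sq_integral_def)

lemma sq_integral_mono:
  assumes "square_integrable M g" "f \<in> borel_measurable M" "AE x in M. \<bar>f x\<bar> \<le> \<bar>g x\<bar>"
  shows "sq_integral M f \<le> sq_integral M g"
proof -
  have *: "AE x in M. (f x)\<^sup>2 \<le> (g x)\<^sup>2"
    using assms(3) by (auto simp: abs_le_square_iff)
  have "square_integrable M f"
    using square_integrable_bound[OF square_integrable_integrable[OF assms(1)] assms(2) *] .
  then show ?thesis
    unfolding sq_integral_def using * assms
    by (intro integral_mono_AE) (auto simp: square_integrable_def)
qed

lemma sq_integral_add_le:
  assumes "square_integrable M f" "square_integrable M g"
  shows "sq_integral M (\<lambda>x. f x + g x) \<le> 2 * sq_integral M f + 2 * sq_integral M g"
proof -
  have "(LINT x|M. (f x + g x)\<^sup>2) \<le> (LINT x|M. 2 * (f x)\<^sup>2 + 2 * (g x)\<^sup>2)"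
  proof (rule integral_mono)
    show "integrable M (\<lambda>x. (f x + g x)\<^sup>2)"
      using square_integrable_add[OF assms] by (simp add: square_integrable_def)
    show "(f x + g x)\<^sup>2 \<le> 2 * (f x)\<^sup>2 + 2 * (g x)\<^sup>2" for x
      using zero_le_power2[of "f x - g x"] by (simp add: power2_sum power2_diff)
  qed (use assms in \<open>auto simp: square_integrable_def\<close>)
  also have "\<dots> = 2 * sq_integral M f + 2 * sq_integral M g"
    using assms by (simp add: square_integrable_def sq_integral_def)
  finally show ?thesis by (simp add: sq_integral_def)
qed

lemma sq_integral_diff_le:
  assumes "square_integrable M f" "square_integrable M g"
  shows "sq_integral M (\<lambda>x. f x - g x) \<le> 2 * sq_integral M f + 2 * sq_integral M g"
  using sq_integral_add_le[OF assms(1) square_integrable_minus[OF assms(2)]] by simp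

lemma sq_integral_zero_iff:
  assumes "square_integrable M f"
  shows "sq_integral M f = 0 \<longleftrightarrow> (AE x in M. f x = 0)"
  using integral_nonneg_eq_0_iff_AE[OF square_integrable_integrable[OF assms]]
  by (simp add: sq_integral_def)

lemma Cauchy_Schwarz_integral:
  assumes f: "square_integrable M f" and g: "square_integrable M g"
  shows "(LINT x|M. f x * g x)\<^sup>2 \<le> sq_integral M f * sq_integral M g"
proof (cases "sq_integral M g = 0")
  case True
  then have "AE x in M. g x = 0" using sq_integral_zero_iff[OF g] by simp
  then have "(LINT x|M. f x * g x) = (LINT x|M. 0)"
    using f g by (intro integral_cong_AE) (auto dest!: square_integrable_measurable)
  then show ?thesis using True by simp
next
  case False
  then have pos: "sq_integral M g > 0" using sq_integral_nonneg[of M g] by linarith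
  define I where "I = (LINT x|M. f x * g x)"
  \<comment> \<open>The coefficient of the orthogonal projection of \<open>f\<close> onto
    \<open>g\<close>: it minimises the norm of \<open>f - l * g\<close>, and nonnegativity of that
    minimum is the claim.\<close>
  define l where "l = I / sq_integral M g"
  note [simp] = square_integrable_integrable[OF f] square_integrable_integrable[OF g]
    square_integrable_mult_integrable[OF f g]
  have "0 \<le> (LINT x|M. (f x - l * g x)\<^sup>2)" by simp
  also have "\<dots> = (LINT x|M. (f x)\<^sup>2 + l\<^sup>2 * (g x)\<^sup>2 - 2 * l * (f x * g x))"
    by (rule Bochner_Integration.integral_cong) (auto simp: power2_diff power_mult_distrib)
  also have "\<dots> = sq_integral M f + l\<^sup>2 * sq_integral M g - 2 * l * I"
    by (simp add: sq_integral_def I_def)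
  also have "\<dots> = sq_integral M f - I\<^sup>2 / sq_integral M g"
    using pos by (simp add: l_def field_simps power2_eq_square)
  finally show ?thesis using pos by (simp add: field_simps I_def)
qed

text \<open>By Cauchy-Schwarz the pairing with a fixed \<open>h\<close> is continuous in L^2. This
  passes to the limit in weak identities.\<close>

lemma tendsto_integral_mult_L2:
  assumes f: "\<And>k. square_integrable M (F k)" "square_integrable M f"
    and lim: "(\<lambda>k. sq_integral M (\<lambda>x. F k x - f x)) \<longlonglongrightarrow> 0"
    and h: "square_integrable M h"
  shows "(\<lambda>k. LINT x|M. F k x * h x) \<longlonglongrightarrow> (LINT x|M. f x * h x)"
proof -
  have "(\<lambda>k. LINT x|M. (F k x - f x) * h x) \<longlonglongrightarrow> 0"
  proof (rule Lim_null_comparison)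
    show "\<forall>\<^sub>F k in sequentially. norm (LINT x|M. (F k x - f x) * h x)
        \<le> sqrt (sq_integral M (\<lambda>x. F k x - f x) * sq_integral M h)"
      using Cauchy_Schwarz_integral[OF square_integrable_diff[OF f] h]
      by (intro always_eventually allI) (metis real_norm_def real_sqrt_abs real_sqrt_le_mono)
    show "(\<lambda>k. sqrt (sq_integral M (\<lambda>x. F k x - f x) * sq_integral M h)) \<longlonglongrightarrow> 0"
      using tendsto_real_sqrt[OF tendsto_mult_left_zero[OF lim, of "sq_integral M h"]] by simp
  qed
  moreover have "(LINT x|M. (F k x - f x) * h x) = (LINT x|M. F k x * h x) - (LINT x|M. f x * h x)" for k
    using square_integrable_mult_integrable[OF f(1) h] square_integrable_mult_integrable[OF f(2) h]
    by (simp add: left_diff_distrib)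
  ultimately show ?thesis by (simp add: LIM_zero_iff)
qed

text \<open>Convergence in L^2 says that the squared differences tend to 0 in L^1, where an almost
  everywhere convergent subsequence is available.\<close>

lemma L2_tendsto_AE_subseq:
  assumes "\<And>k. square_integrable M (F k)" "square_integrable M f"
    and "(\<lambda>k. sq_integral M (\<lambda>x. F k x - f x)) \<longlonglongrightarrow> 0"
  shows "\<exists>r::nat \<Rightarrow> nat. strict_mono r \<and> (AE x in M. (\<lambda>k. F (r k) x) \<longlonglongrightarrow> f x)"
proof -
  have "\<exists>r::nat\<Rightarrow>nat. strict_mono r \<and> (AE x in M. (\<lambda>n. (F (r n) x - f x)\<^sup>2) \<longlonglongrightarrow> 0)"
    using assms by (intro tendsto_L1_AE_subseq)
      (auto simp: sq_integral_def intro!: square_integrable_integrable)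
  then obtain r :: "nat \<Rightarrow> nat" where r: "strict_mono r"
    "AE x in M. (\<lambda>n. (F (r n) x - f x)\<^sup>2) \<longlonglongrightarrow> 0" by blast
  from r(2) have "AE x in M. (\<lambda>k. F (r k) x) \<longlonglongrightarrow> f x"
  proof eventually_elim
    case (elim x)
    have "(\<lambda>n. \<bar>F (r n) x - f x\<bar>) \<longlonglongrightarrow> 0"
      using tendsto_real_sqrt[OF elim] by simp
    then show ?case
      by (simp add: tendsto_rabs_zero_iff LIM_zero_iff)
  qed
  with r(1) show ?thesis by blast
qed

lemma sq_integral_tendsto_dominated:
  assumes f: "square_integrable M g" "\<And>k. F k \<in> borel_measurable M" "f \<in> borel_measurable M"
    and lim: "AE x in M. (\<lambda>k. F k x) \<longlonglongrightarrow> f x"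
    and bd: "\<And>k. AE x in M. \<bar>F k x - f x\<bar> \<le> \<bar>g x\<bar>"
  shows "(\<lambda>k. sq_integral M (\<lambda>x. F k x - f x)) \<longlonglongrightarrow> 0"
proof -
  have "(\<lambda>k. LINT x|M. (F k x - f x)\<^sup>2) \<longlonglongrightarrow> (LINT x|M. 0)"
  proof (rule integral_dominated_convergence)
    show "integrable M (\<lambda>x. (g x)\<^sup>2)" using f by (simp add: square_integrable_def)
    show "AE x in M. (\<lambda>k. (F k x - f x)\<^sup>2) \<longlonglongrightarrow> 0"
      using lim
    proof eventually_elim
      case (elim x)
      show ?case using tendsto_power[OF LIM_zero[OF elim], of 2] by simp
    qed
    show "AE x in M. norm ((F k x - f x)\<^sup>2) \<le> (g x)\<^sup>2" for k
      using bd[of k] by (auto simp: abs_le_square_iff)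
  qed (use f in auto)
  then show ?thesis by (simp add: sq_integral_def)
qed

subsection \<open>Translations and averages\<close>

lemma lborel_translate:
  fixes z :: "'a::euclidean_space"
  shows "distr lborel borel (\<lambda>x. x + z) = lborel"
proof -
  have "(\<lambda>x. x + z) = (+) z" by (auto simp: add.commute)
  then show ?thesis by (simp only: lborel_distr_plus)
qed

lemma integral_translate:
  fixes f :: "'a::euclidean_space \<Rightarrow> real"
  assumes [measurable]: "f \<in> borel_measurable borel"
  shows "(LINT x|lborel. f (x + z)) = (LINT x|lborel. f x)"
proof -
  have "(LINT x|lborel. f x) = (LINT x|distr lborel borel (\<lambda>x. x + z). f x)"
    by (simp add: lborel_translate)
  also have "\<dots> = (LINT x|lborel. f (x + z))"
    by (rule integral_distr) auto
  finally show ?thesis by simp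
qed

lemma integrable_translate:
  fixes f :: "'a::euclidean_space \<Rightarrow> real"
  assumes [measurable]: "f \<in> borel_measurable borel"
  shows "integrable lborel (\<lambda>x. f (x + z)) \<longleftrightarrow> integrable lborel f"
proof -
  have "integrable lborel f \<longleftrightarrow> integrable (distr lborel borel (\<lambda>x. x + z)) f"
    by (simp add: lborel_translate)
  also have "\<dots> \<longleftrightarrow> integrable lborel (\<lambda>x. f (x + z))"
    by (rule integrable_distr_eq) auto
  finally show ?thesis by simp
qed

lemma square_integrable_translate [intro]:
  fixes f :: "'a::euclidean_space \<Rightarrow> real"
  assumes f: "square_integrable lborel f"
  shows "square_integrable lborel (\<lambda>x. f (x + z))"
proof -
  have [measurable]: "f \<in> borel_measurable borel"
    using square_integrable_measurable[OF f] by simp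
  show ?thesis
    using f integrable_translate[of "\<lambda>x. (f x)\<^sup>2" z] by (simp add: square_integrable_def)
qed

lemma sq_integral_translate:
  fixes f :: "'a::euclidean_space \<Rightarrow> real"
  assumes "f \<in> borel_measurable borel"
  shows "sq_integral lborel (\<lambda>x. f (x + z)) = sq_integral lborel f"
  using integral_translate[of "\<lambda>x. (f x)\<^sup>2" z] assms by (simp add: sq_integral_def)

section \<open>Continuity of translations in L^2\<close>

definition L2_translation_continuous :: "('a::euclidean_space \<Rightarrow> real) \<Rightarrow> bool" where
  "L2_translation_continuous f \<longleftrightarrow>
     (\<forall>e>0. \<exists>d>0. \<forall>z. norm z \<le> d \<longrightarrow> sq_integral lborel (\<lambda>x. f (x + z) - f x) \<le> e)"

text \<open>Translation is an isometry of L^2, so replacing \<open>f\<close> by a nearby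
  \<open>h\<close> costs the same error before and after the shift, uniformly in \<open>z\<close>.
  The property is therefore closed under L^2 limits and can be lifted from compact sets to general
  functions.\<close>

lemma L2_translation_continuous_approx:
  fixes f :: "'a::euclidean_space \<Rightarrow> real"
  assumes f: "square_integrable lborel f"
    and ap: "\<And>e. e > 0 \<Longrightarrow> \<exists>h. square_integrable lborel h \<and> L2_translation_continuous h \<and>
        sq_integral lborel (\<lambda>x. h x - f x) \<le> e"
  shows "L2_translation_continuous f"
  unfolding L2_translation_continuous_def
proof (intro allI impI)
  fix e :: real assume e: "e > 0"
  \<comment> \<open>With \<open>(a + b)^2 \<le> 2 * a^2 + 2 * b^2\<close> used twice below, these
    constants add up to \<open>2 * e/24 + 2 * (2 * e/12 + 2 * e/24) = 7 * e/12\<close>.\<close>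
  obtain h where h: "square_integrable lborel h" "L2_translation_continuous h"
    "sq_integral lborel (\<lambda>x. h x - f x) \<le> e / 24" using ap[of "e/24"] e by auto
  obtain d where d: "d > 0" "\<And>z. norm z \<le> d \<Longrightarrow> sq_integral lborel (\<lambda>x. h (x + z) - h x) \<le> e/12"
    using h(2) e unfolding L2_translation_continuous_def by (meson divide_pos_pos zero_less_numeral)
  have hf: "square_integrable lborel (\<lambda>x. h x - f x)" using h f by auto
  have "sq_integral lborel (\<lambda>x. f (x + z) - f x) \<le> e" if z: "norm z \<le> d" for z
  proof -
    have eq: "(\<lambda>x. f (x + z) - f x) = (\<lambda>x. (h x - f x) + ((h (x+z) - h x) - (h (x + z) - f (x + z))))"
      by auto
    have si: "square_integrable lborel (\<lambda>x. h (x+z) - h x)"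
      "square_integrable lborel (\<lambda>x. h (x + z) - f (x + z))"
      using h f square_integrable_translate by (auto intro!: square_integrable_diff)
    have "sq_integral lborel (\<lambda>x. h (x + z) - f (x + z)) = sq_integral lborel (\<lambda>x. h x - f x)"
      using sq_integral_translate[of "\<lambda>x. h x - f x" z] hf[THEN square_integrable_measurable] by simp
    then have "sq_integral lborel (\<lambda>x. (h (x+z) - h x) - (h (x + z) - f (x + z))) \<le> 2 * (e/12) + 2 * (e/24)"
      using sq_integral_diff_le[OF si] d(2)[OF z] h(3) by simp
    then show ?thesis
      unfolding eq using sq_integral_add_le[OF hf square_integrable_diff[OF si]] h(3) e by linarith
  qed
  then show "\<exists>d>0. \<forall>z. norm z \<le> d \<longrightarrow> sq_integral lborel (\<lambda>x. f (x + z) - f x) \<le> e"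
    using d(1) by blast
qed

lemma L2_translation_continuous_add:
  fixes f :: "'a::euclidean_space \<Rightarrow> real"
  assumes si: "square_integrable lborel f" "square_integrable lborel g"
    and tc: "L2_translation_continuous f" "L2_translation_continuous g"
  shows "L2_translation_continuous (\<lambda>x. f x + g x)"
  unfolding L2_translation_continuous_def
proof (intro allI impI)
  fix e :: real assume e: "e > 0"
  then have "e / 4 > 0" by simp
  obtain d1 where d1: "d1 > 0" "\<And>z. norm z \<le> d1 \<Longrightarrow> sq_integral lborel (\<lambda>x. f (x + z) - f x) \<le> e/4"
    using tc(1) \<open>e / 4 > 0\<close> unfolding L2_translation_continuous_def by blast
  obtain d2 where d2: "d2 > 0" "\<And>z. norm z \<le> d2 \<Longrightarrow> sq_integral lborel (\<lambda>x. g (x + z) - g x) \<le> e/4"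
    using tc(2) \<open>e / 4 > 0\<close> unfolding L2_translation_continuous_def by blast
  have "sq_integral lborel (\<lambda>x. f (x + z) + g (x + z) - (f x + g x)) \<le> e" if "norm z \<le> min d1 d2" for z
  proof -
    have "(\<lambda>x. f (x + z) + g (x + z) - (f x + g x)) = (\<lambda>x. (f (x + z) - f x) + (g (x + z) - g x))"
      by auto
    then show ?thesis
      using sq_integral_add_le[of lborel "\<lambda>x. f (x + z) - f x" "\<lambda>x. g (x + z) - g x"]
        d1(2)[of z] d2(2)[of z] that si
      by (simp add: square_integrable_diff square_integrable_translate)
  qed
  then show "\<exists>d>0. \<forall>z. norm z \<le> d \<longrightarrow> sq_integral lborel (\<lambda>x. f (x + z) + g (x + z) - (f x + g x)) \<le> e"
    using d1(1) d2(1) by (intro exI[of _ "min d1 d2"]) auto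
qed

lemma L2_translation_continuous_cmult:
  fixes f :: "'a::euclidean_space \<Rightarrow> real"
  assumes tc: "L2_translation_continuous f"
  shows "L2_translation_continuous (\<lambda>x. c * f x)"
  unfolding L2_translation_continuous_def
proof (intro allI impI)
  fix e :: real assume e: "e > 0"
  then have "e / (1 + c\<^sup>2) > 0" by (simp add: add_pos_nonneg)
  then obtain d where d: "d > 0"
    "\<And>z. norm z \<le> d \<Longrightarrow> sq_integral lborel (\<lambda>x. f (x + z) - f x) \<le> e / (1 + c\<^sup>2)"
    using tc unfolding L2_translation_continuous_def by blast
  have "sq_integral lborel (\<lambda>x. c * f (x + z) - c * f x) \<le> e" if "norm z \<le> d" for z
  proof -
    have "sq_integral lborel (\<lambda>x. c * f (x + z) - c * f x) \<le> c\<^sup>2 * (e / (1 + c\<^sup>2))"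
      using sq_integral_cmult[of lborel c "\<lambda>x. f (x + z) - f x"] d(2)[OF that]
      by (simp add: right_diff_distrib mult_left_mono del: times_divide_eq_right)
    also have "\<dots> \<le> e" using e by (simp add: divide_simps add_pos_nonneg) 
    finally show ?thesis .
  qed
  then show "\<exists>d>0. \<forall>z. norm z \<le> d \<longrightarrow> sq_integral lborel (\<lambda>x. c * f (x + z) - c * f x) \<le> e"
    using d(1) by blast
qed

lemma square_integrable_indicator:
  assumes "A \<in> sets M" "emeasure M A < \<infinity>"
  shows "square_integrable M (indicator A :: _ \<Rightarrow> real)"
proof -
  have "(\<lambda>x. (indicator A x :: real)\<^sup>2) = indicator A" by (auto simp: indicator_def)
  then show ?thesis using assms by (auto simp: square_integrable_def)
qed

text \<open>Outer regularity puts \<open>K\<close> into an open \<open>U\<close> with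
  \<open>U - K\<close> small. A shift shorter than the distance from \<open>K\<close> to the
  complement of \<open>U\<close> cannot move a point of \<open>K\<close> out of \<open>U\<close>, so
  the indicator changes only where \<open>x\<close> or \<open>x + z\<close> lies in
  \<open>U - K\<close>.\<close>

lemma L2_translation_continuous_compact:
  fixes K :: "'a::euclidean_space set"
  assumes K: "compact K"
  shows "L2_translation_continuous (indicator K)"
  unfolding L2_translation_continuous_def
proof (intro allI impI)
  fix e :: real assume e: "e > 0"
  have [measurable]: "K \<in> sets borel" using K by (simp add: borel_compact)
  obtain U where U: "open U" "K \<subseteq> U" "emeasure lborel (U - K) < ennreal (e/2)"
    using outer_regular_lborel[of K "e/2"] e by auto
  have [measurable]: "U \<in> sets borel" using U by simp
  obtain r where r: "r > 0" "(\<Union>x\<in>K. ball x r) \<subseteq> U"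
    using compact_subset_open_imp_ball_epsilon_subset[OF K U(1,2)] .
  define w where "w = (indicator (U - K) :: 'a \<Rightarrow> real)"
  have fin: "emeasure lborel (U - K) < \<infinity>" using U(3) by (auto intro: less_trans)
  have wint: "integrable lborel w"
    unfolding w_def using fin by (intro integrable_real_indicator) auto
  have wm[measurable]: "w \<in> borel_measurable borel" by (simp add: w_def)
  have wI: "(LINT x|lborel. w x) \<le> e / 2"
  proof -
    have "(LINT x|lborel. w x) = measure lborel (U - K)" by (simp add: w_def)
    also have "\<dots> \<le> e / 2"
      unfolding measure_def using U(3) e by (intro enn2real_leI) auto
    finally show ?thesis .
  qed
  have "sq_integral lborel (\<lambda>x. indicator K (x + z) - indicator K x) \<le> e" if z: "norm z \<le> r / 2" for z
  proof -
    have close: "y \<in> U" if "x \<in> K" "dist x y < r" for x y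
      using r(2) that by (auto simp: subset_eq)
    have pt: "(indicator K (x + z) - indicator K x :: real)\<^sup>2 \<le> w x + w (x + z)" for x
      using close[of x "x + z"] close[of "x + z" x] z r(1)
      by (auto simp: w_def indicator_def dist_norm)
    have wz: "integrable lborel (\<lambda>x. w (x + z))"
      using integrable_translate[of w z] wint by simp
    have "sq_integral lborel (\<lambda>x. indicator K (x + z) - indicator K x) \<le> (LINT x|lborel. w x + w (x + z))"
      unfolding sq_integral_def
    proof (rule integral_mono)
      show i: "integrable lborel (\<lambda>x. w x + w (x + z))" using wint wz by simp
      show "integrable lborel (\<lambda>x. (indicator K (x + z) - indicator K x :: real)\<^sup>2)"
        by (rule Bochner_Integration.integrable_bound[OF i]) (use order_trans[OF pt abs_ge_self] in auto)
    qed (use pt in auto)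
    also have "\<dots> = (LINT x|lborel. w x) + (LINT x|lborel. w x)"
      using wint wz integral_translate[of w z] by simp
    finally show ?thesis using wI by simp
  qed
  then show "\<exists>d>0. \<forall>z. norm z \<le> d \<longrightarrow>
      sq_integral lborel (\<lambda>x. indicator K (x + z) - indicator K x) \<le> e"
    using r(1) by (intro exI[of _ "r/2"]) auto
qed

text \<open>Inner regularity: up to a null set, \<open>A\<close> is an increasing union of compact
  sets, whose indicators converge in L^2 because they are dominated by the indicator of
  \<open>A\<close>.\<close>

lemma L2_translation_continuous_indicator:
  fixes A :: "'a::euclidean_space set"
  assumes A: "A \<in> sets borel" "emeasure lborel A < \<infinity>"
  shows "L2_translation_continuous (indicator A)"
proof (rule L2_translation_continuous_approx)
  show siA: "square_integrable lborel (indicator A :: _ \<Rightarrow> real)"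
    using A by (intro square_integrable_indicator) auto
  fix e :: real assume e: "e > 0"
  obtain N C where C: "negligible N" "\<And>n::nat. compact (C n)" "A = (\<Union>n. C n) \<union> N"
    using lebesgue_regular_inner[of A] A by auto
  define D where "D n = (\<Union>i\<le>n. C i)" for n
  have D: "compact (D n)" for n unfolding D_def using C(2) by (intro compact_UN) auto
  have DA: "D n \<subseteq> A" for n using C(3) by (auto simp: D_def)
  have [measurable]: "D n \<in> sets borel" for n using D by (simp add: borel_compact)
  have siD: "square_integrable lborel (indicator (D n) :: _ \<Rightarrow> real)" for n
    using D[of n] by (intro square_integrable_indicator) (use emeasure_bounded_finite[OF compact_imp_bounded[OF D[of n]]] in auto)
  have Nn: "AE x in lebesgue. x \<notin> N" using C(1) by (simp add: negligible_iff_null_sets AE_not_in)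
  then have Nl: "AE x in lborel. x \<notin> N" by (simp add: AE_completion_iff) 
  have "(\<lambda>n. sq_integral lborel (\<lambda>x. indicator (D n) x - indicator A x)) \<longlonglongrightarrow> 0"
  proof (rule sq_integral_tendsto_dominated[OF siA])
    show "AE x in lborel. (\<lambda>n. indicator (D n) x :: real) \<longlonglongrightarrow> indicator A x"
      using Nl
    proof eventually_elim
      case (elim x)
      have "\<forall>\<^sub>F n in sequentially. (indicator (D n) x :: real) = indicator A x"
      proof (cases "x \<in> A")
        case True
        then obtain m where "x \<in> C m" using C(3) elim by auto
        then show ?thesis
          using True by (intro eventually_sequentiallyI[of m]) (auto simp: D_def indicator_def)
      next
        case False
        then show ?thesis using DA by (intro always_eventually) (auto simp: indicator_def)
      qed
      then show ?case by (rule tendsto_eventually)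
    qed
    show "AE x in lborel. \<bar>indicator (D n) x - indicator A x :: real\<bar> \<le> \<bar>indicator A x\<bar>" for n
      using DA[of n] by (auto simp: indicator_def)
  qed (use A in auto)
  then obtain n where "sq_integral lborel (\<lambda>x. indicator (D n) x - indicator A x) < e"
    using order_tendstoD(2)[of _ 0 sequentially e] e by (auto simp: eventually_sequentially)
  then show "\<exists>h. square_integrable lborel h \<and> L2_translation_continuous h \<and>
      sq_integral lborel (\<lambda>x. h x - indicator A x) \<le> e"
    using siD[of n] L2_translation_continuous_compact[OF D[of n]] by (meson less_imp_le)
qed

text \<open>Square integrability sits inside the induction statement because it has to be handed
  down: in each case the simpler nonnegative functions are dominated by the one being built and so
  inherit it.\<close>

lemma L2_translation_continuous_nonneg:
  fixes f :: "'a::euclidean_space \<Rightarrow> real"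
  assumes "f \<in> borel_measurable lborel" "\<And>x. 0 \<le> f x"
  shows "square_integrable lborel f \<longrightarrow> L2_translation_continuous f"
  using assms
proof (induction f rule: borel_measurable_induct_real)
  case (set A)
  then have [measurable]: "A \<in> sets borel" by simp
  show ?case
  proof
    assume "square_integrable lborel (indicator A :: _ \<Rightarrow> real)"
    then have "integrable lborel (\<lambda>x. (indicator A x :: real)\<^sup>2)" by (simp add: square_integrable_def)
    moreover have "(\<lambda>x. (indicator A x :: real)\<^sup>2) = indicator A" by (auto simp: indicator_def)
    ultimately have "emeasure lborel A < \<infinity>" by (simp add: integrable_indicator_iff)
    then show "L2_translation_continuous (indicator A)"
      by (intro L2_translation_continuous_indicator) auto
  qed
next
  case (mult u c)
  show ?case
  proof
    assume si: "square_integrable lborel (\<lambda>x. c * u x)"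
    show "L2_translation_continuous (\<lambda>x. c * u x)"
    \<comment> \<open>For \<open>c = 0\<close> the product says nothing about the integrability of
      \<open>u\<close>, so the induction hypothesis cannot be applied.\<close>
    proof (cases "c = 0")
      case True
      then show ?thesis by (auto simp: L2_translation_continuous_def sq_integral_def intro!: exI[of _ 1])
    next
      case False
      have "square_integrable lborel u"
        using square_integrable_cmult[OF si, of "1/c"] False by simp
      then show ?thesis using mult L2_translation_continuous_cmult by blast
    qed
  qed
next
  case (add u v)
  show ?case
  proof
    assume si: "square_integrable lborel (\<lambda>x. v x + u x)"
    have "square_integrable lborel v" "square_integrable lborel u"
      using add.hyps add.prems
      by (auto intro!: square_integrable_bound[OF square_integrable_integrable[OF si]] power_mono)
    then show "L2_translation_continuous (\<lambda>x. v x + u x)"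
      using add L2_translation_continuous_add by blast
  qed
next
  case (seq U)
  show ?case
  proof
    assume si: "square_integrable lborel f"
    have le: "U i x \<le> f x" for i x
      using incseq_le[of "\<lambda>i. U i x" "f x" i] seq by (auto simp: incseq_def le_fun_def)
    have siU: "square_integrable lborel (U i)" for i
      using seq(1,2) le
      by (auto intro!: square_integrable_bound[OF square_integrable_integrable[OF si]] power_mono)
    show "L2_translation_continuous f"
    proof (rule L2_translation_continuous_approx[OF si])
      fix e :: real assume e: "e > 0"
      have "(\<lambda>n. sq_integral lborel (\<lambda>x. U n x - f x)) \<longlonglongrightarrow> 0"
      proof (rule sq_integral_tendsto_dominated[OF si])
        show "AE x in lborel. (\<lambda>k. U k x) \<longlonglongrightarrow> f x" using seq by auto
        show "AE x in lborel. \<bar>U k x - f x\<bar> \<le> \<bar>f x\<bar>" for k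
          using le[of k] seq(2)[of k] by (auto intro!: always_eventually simp: abs_if) (smt (verit))+
      qed (use seq si in \<open>auto dest: square_integrable_measurable\<close>)
      then obtain n where "sq_integral lborel (\<lambda>x. U n x - f x) < e"
        using order_tendstoD(2)[of _ 0 sequentially e] e by (auto simp: eventually_sequentially)
      then show "\<exists>h. square_integrable lborel h \<and> L2_translation_continuous h \<and>
          sq_integral lborel (\<lambda>x. h x - f x) \<le> e"
        using siU[of n] seq.IH by (meson less_imp_le)
    qed
  qed
qed

lemma L2_translation_continuous:
  fixes f :: "'a::euclidean_space \<Rightarrow> real"
  assumes f: "square_integrable lborel f"
  shows "L2_translation_continuous f"
proof -
  have [measurable]: "f \<in> borel_measurable borel" using square_integrable_measurable[OF f] by simp
  have si: "square_integrable lborel (\<lambda>x. max (f x) 0)" "square_integrable lborel (\<lambda>x. max (- f x) 0)"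
    by (auto intro!: square_integrable_bound[OF square_integrable_integrable[OF f]] always_eventually
        simp: max_def)
  have "L2_translation_continuous (\<lambda>x. max (f x) 0 + (-1) * max (- f x) 0)"
    using si by (intro L2_translation_continuous_add L2_translation_continuous_cmult square_integrable_cmult
        L2_translation_continuous_nonneg[THEN mp]) auto
  moreover have "(\<lambda>x. max (f x) 0 + (-1) * max (- f x) 0) = f" by (auto simp: max_def)
  ultimately show ?thesis by simp
qed

section \<open>Averages of translates against a probability measure\<close>

locale prob_shift = prob_space \<mu> for \<mu> :: "'a::euclidean_space measure" +
  assumes sets_eq_borel [measurable_cong]: "sets \<mu> = sets borel"
begin

sublocale pair_sigma_finite \<mu> lborel
  by unfold_locales

text \<open>Cauchy-Schwarz against the constant 1 is Jensen's inequality for the square on a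
  probability space. Integrating it over \<open>x\<close> and exchanging the integrals bounds the
  mean in L^2 by the individual bounds on \<open>k z\<close>.\<close>

lemma parametric_integral_L2:
  fixes k :: "'a \<Rightarrow> 'a \<Rightarrow> real"
  assumes [measurable]: "case_prod k \<in> borel_measurable (\<mu> \<Otimes>\<^sub>M lborel)"
    and si: "\<And>z. square_integrable lborel (k z)"
    and bd: "AE z in \<mu>. sq_integral lborel (k z) \<le> e"
  shows "square_integrable lborel (\<lambda>x. LINT z|\<mu>. k z x)"
    and "sq_integral lborel (\<lambda>x. LINT z|\<mu>. k z x) \<le> e"
    and "AE x in lborel. integrable \<mu> (\<lambda>z. k z x)"
proof -
  have int: "integrable (\<mu> \<Otimes>\<^sub>M lborel) (\<lambda>(z, x). (k z x)\<^sup>2)"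
  proof (rule Fubini_integrable)
    have [measurable]: "(\<lambda>z. sq_integral lborel (k z)) \<in> borel_measurable \<mu>"
      unfolding sq_integral_def by measurable
    have "integrable \<mu> (\<lambda>z. sq_integral lborel (k z))"
      using bd by (intro integrable_const_bound[of _ e]) auto
    then show "integrable \<mu> (\<lambda>z. LINT x|lborel. norm (case (z, x) of (z, x) \<Rightarrow> (k z x)\<^sup>2))"
      by (simp add: sq_integral_def)
    show "AE z in \<mu>. integrable lborel (\<lambda>x. case (z, x) of (z, x) \<Rightarrow> (k z x)\<^sup>2)"
      using si by (auto simp: square_integrable_def)
  qed measurable
  have jensen: "integrable \<mu> (\<lambda>z. k z x) \<and> (LINT z|\<mu>. k z x)\<^sup>2 \<le> (LINT z|\<mu>. (k z x)\<^sup>2)"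
    if "integrable \<mu> (\<lambda>z. (k z x)\<^sup>2)" for x
  proof -
    have kx[measurable]: "(\<lambda>z. k z x) \<in> borel_measurable \<mu>" by measurable
    have si1: "square_integrable \<mu> (\<lambda>z. k z x)" using that by (simp add: square_integrable_def)
    have si2: "square_integrable \<mu> (\<lambda>z. 1)" by (simp add: square_integrable_def)
    show ?thesis
      using square_integrable_mult_integrable[OF si1 si2] Cauchy_Schwarz_integral[OF si1 si2]
      by (simp add: sq_integral_def prob_space)
  qed
  have AEi: "AE x in lborel. integrable \<mu> (\<lambda>z. (k z x)\<^sup>2)"
    using AE_integrable_snd[of "\<lambda>z x. (k z x)\<^sup>2"] int by simp
  then show "AE x in lborel. integrable \<mu> (\<lambda>z. k z x)"
    by eventually_elim (use jensen in auto)
  have le: "AE x in lborel. (LINT z|\<mu>. k z x)\<^sup>2 \<le> (LINT z|\<mu>. (k z x)\<^sup>2)"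
    using AEi by eventually_elim (use jensen in auto)
  have m: "(\<lambda>x. LINT z|\<mu>. k z x) \<in> borel_measurable lborel"
    by measurable
  have int2: "integrable lborel (\<lambda>x. LINT z|\<mu>. (k z x)\<^sup>2)"
    using integrable_snd[of "\<lambda>z x. (k z x)\<^sup>2"] int by simp
  show si': "square_integrable lborel (\<lambda>x. LINT z|\<mu>. k z x)"
    by (rule square_integrable_bound[OF int2 m le])
  have "sq_integral lborel (\<lambda>x. LINT z|\<mu>. k z x) \<le> (LINT x|lborel. LINT z|\<mu>. (k z x)\<^sup>2)"
    unfolding sq_integral_def using le int2 si' by (intro integral_mono_AE) (auto simp: square_integrable_def)
  also have "\<dots> = (LINT z|\<mu>. sq_integral lborel (k z))"
    unfolding sq_integral_def by (rule Fubini_integral[OF int])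
  also have "\<dots> \<le> (LINT z|\<mu>. e)"
  proof (rule integral_mono_AE)
    show "integrable \<mu> (\<lambda>z. sq_integral lborel (k z))"
      using integrable_fst'[OF int] by (simp add: sq_integral_def)
  qed (use bd in auto)
  also have "\<dots> = e" by (simp add: prob_space)
  finally show "sq_integral lborel (\<lambda>x. LINT z|\<mu>. k z x) \<le> e" .
qed

text \<open>The convolution of \<open>f\<close> with the image of the measure under reflection at
  0.\<close>

definition average :: "('a \<Rightarrow> real) \<Rightarrow> 'a \<Rightarrow> real" where
  "average f x = (LINT z|\<mu>. f (x + z))"

lemma average_measurable [measurable]:
  assumes [measurable]: "f \<in> borel_measurable borel"
  shows "average f \<in> borel_measurable borel"
  unfolding average_def by measurable

lemma shift_square_integrable:
  assumes f: "square_integrable lborel f"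
  shows "case_prod (\<lambda>z x. f (x + z)) \<in> borel_measurable (\<mu> \<Otimes>\<^sub>M lborel)"
    "square_integrable lborel (\<lambda>x. f (x + z))"
    "sq_integral lborel (\<lambda>x. f (x + z)) = sq_integral lborel f"
proof -
  have [measurable]: "f \<in> borel_measurable borel" using square_integrable_measurable[OF f] by simp
  show "case_prod (\<lambda>z x. f (x + z)) \<in> borel_measurable (\<mu> \<Otimes>\<^sub>M lborel)" by measurable
  show "square_integrable lborel (\<lambda>x. f (x + z))"
    using f by (rule square_integrable_translate)
  show "sq_integral lborel (\<lambda>x. f (x + z)) = sq_integral lborel f"
    by (rule sq_integral_translate) measurable
qed

lemma average_L2:
  assumes f: "square_integrable lborel f"
  shows "square_integrable lborel (average f)"
    and "sq_integral lborel (average f) \<le> sq_integral lborel f"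
    and "AE x in lborel. integrable \<mu> (\<lambda>z. f (x + z))"
  using parametric_integral_L2[OF shift_square_integrable(1,2)[OF f], of "sq_integral lborel f"]
    shift_square_integrable(3)[OF f] by (auto simp: average_def[abs_def])

text \<open>The error is itself a mean, namely of \<open>f (x + z) - f x\<close>, because the
  measure has mass 1. A bound for the individual translates thus passes to the average.\<close>

lemma average_error:
  assumes f: "square_integrable lborel f"
    and bd: "AE z in \<mu>. sq_integral lborel (\<lambda>x. f (x + z) - f x) \<le> e"
  shows "sq_integral lborel (\<lambda>x. average f x - f x) \<le> e"
proof -
  have [measurable]: "f \<in> borel_measurable borel" using square_integrable_measurable[OF f] by simp
  have "sq_integral lborel (\<lambda>x. LINT z|\<mu>. f (x + z) - f x) \<le> e"
    using f bd by (intro parametric_integral_L2) (auto intro!: square_integrable_diff)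
  moreover have "sq_integral lborel (\<lambda>x. LINT z|\<mu>. f (x + z) - f x) = sq_integral lborel (\<lambda>x. average f x - f x)"
    unfolding sq_integral_def
  proof (rule integral_cong_AE)
    show "AE x in lborel. (LINT z|\<mu>. f (x + z) - f x)\<^sup>2 = (average f x - f x)\<^sup>2"
      using average_L2(3)[OF f] by eventually_elim (simp add: average_def prob_space)
  qed measurable
  ultimately show ?thesis by simp
qed

text \<open>Reduces an integral identity for an average to the same identity for every single shift.
  Cauchy-Schwarz bounds the inner integrals uniformly in \<open>z\<close>, which is what Fubini's
  theorem needs on the product space.\<close>

lemma integral_average_mult:
  assumes f: "square_integrable lborel f" and h: "square_integrable lborel h"
  shows "(LINT x|lborel. average f x * h x) = (LINT z|\<mu>. LINT x|lborel. f (x + z) * h x)"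
proof -
  have [measurable]: "f \<in> borel_measurable borel" "h \<in> borel_measurable borel"
    using f h by (auto dest!: square_integrable_measurable)
  have int1: "integrable lborel (\<lambda>x. f (x + z) * h x)" for z
    using f h by (intro square_integrable_mult_integrable) auto
  have int: "integrable (\<mu> \<Otimes>\<^sub>M lborel) (\<lambda>(z, x). f (x + z) * h x)"
  proof (rule Fubini_integrable)
    have "norm (LINT x|lborel. norm (f (x + z) * h x)) \<le> sqrt (sq_integral lborel f * sq_integral lborel h)" for z
    proof -
      have "square_integrable lborel (\<lambda>x. \<bar>f (x + z)\<bar>)" "square_integrable lborel (\<lambda>x. \<bar>h x\<bar>)"
        using f h square_integrable_translate[OF f, of z] by (auto simp: square_integrable_def)
      from Cauchy_Schwarz_integral[OF this]
      have "(LINT x|lborel. norm (f (x + z) * h x))\<^sup>2 \<le> sq_integral lborel f * sq_integral lborel h"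
        using sq_integral_translate[of f z] by (simp add: sq_integral_def abs_mult)
      then have "sqrt ((LINT x|lborel. norm (f (x + z) * h x))\<^sup>2) \<le> sqrt (sq_integral lborel f * sq_integral lborel h)"
        by (rule real_sqrt_le_mono)
      then show ?thesis by simp
    qed
    then show "integrable \<mu> (\<lambda>z. LINT x|lborel. norm (case (z, x) of (z, x) \<Rightarrow> f (x + z) * h x))"
      by (intro integrable_const_bound[of _ "sqrt (sq_integral lborel f * sq_integral lborel h)"]) auto
  qed (use int1 in auto)
  have "(LINT x|lborel. average f x * h x) = (LINT x|lborel. LINT z|\<mu>. f (x + z) * h x)"
    by (simp add: average_def)
  also have "\<dots> = (LINT z|\<mu>. LINT x|lborel. f (x + z) * h x)"
    by (rule Fubini_integral[OF int])
  finally show ?thesis .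
qed

end

text \<open>Only the radius \<open>\<delta> k\<close> of the support enters, so segments starting at
  0 and balls with a centre off the origin are covered alike.\<close>

lemma averages_tendsto:
  fixes f :: "'a::euclidean_space \<Rightarrow> real"
  assumes f: "square_integrable lborel f"
    and \<mu>: "\<And>k::nat. prob_shift (\<mu> k)"
    and small: "\<And>k. AE z in \<mu> k. norm z \<le> \<delta> k" "\<delta> \<longlonglongrightarrow> 0"
  shows "(\<lambda>k. sq_integral lborel (\<lambda>x. prob_shift.average (\<mu> k) f x - f x)) \<longlonglongrightarrow> 0"
proof (rule order_tendstoI)
  fix e :: real assume "0 < e"
  then have e2: "e / 2 > 0" by simp
  obtain d where d: "d > 0" "\<And>z. norm z \<le> d \<Longrightarrow> sq_integral lborel (\<lambda>x. f (x + z) - f x) \<le> e / 2"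
    using L2_translation_continuous[OF f] e2 unfolding L2_translation_continuous_def by blast
  have "\<forall>\<^sub>F k in sequentially. \<delta> k < d" using order_tendstoD(2)[OF small(2) d(1)] .
  then show "\<forall>\<^sub>F k in sequentially. sq_integral lborel (\<lambda>x. prob_shift.average (\<mu> k) f x - f x) < e"
  proof eventually_elim
    case (elim k)
    interpret prob_shift "\<mu> k" by (rule \<mu>)
    have "AE z in \<mu> k. sq_integral lborel (\<lambda>x. f (x + z) - f x) \<le> e / 2"
      using small(1)[of k] by eventually_elim (use d elim in auto)
    from average_error[OF f this] show ?case using \<open>0 < e\<close> by simp
  qed
qed (auto intro!: always_eventually less_le_trans[OF _ sq_integral_nonneg])

subsection \<open>Smooth functions\<close>

abbreviation smooth :: "('a::euclidean_space \<Rightarrow> real) \<Rightarrow> bool" where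
  "smooth f \<equiv> \<forall>k. k_times_cont_diff k f"

lemma partial_deriv_eq:
  assumes "\<And>x. (f has_derivative f' x) (at x)"
  shows "partial_deriv b f = (\<lambda>x. f' x b)"
  using frechet_derivative_at[OF assms] by auto

lemma k_times_cont_diff_imp_has_derivative:
  "k_times_cont_diff (Suc k) f \<Longrightarrow> (f has_derivative frechet_derivative f (at x)) (at x)"
  by (simp add: frechet_derivative_works[symmetric])

lemma k_times_cont_diff_SucI:
  assumes "\<And>x. (f has_derivative f' x) (at x)" "\<And>b. b \<in> Basis \<Longrightarrow> k_times_cont_diff k (\<lambda>x. f' x b)"
  shows "k_times_cont_diff (Suc k) f"
  using assms(2) by (auto simp: partial_deriv_eq[OF assms(1)] intro: differentiableI[OF assms(1)])

lemma k_times_cont_diff_SucD: "k_times_cont_diff (Suc k) f \<Longrightarrow> k_times_cont_diff k f"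
proof (induction k arbitrary: f)
  case 0
  then show ?case
    by (auto intro!: differentiable_imp_continuous_on simp: differentiable_on_def differentiable_at_withinI)
qed auto

lemma k_times_cont_diff_const [simp]: "k_times_cont_diff k (\<lambda>x. c)"
  by (induction k arbitrary: c) (auto intro!: k_times_cont_diff_SucI[where f' = "\<lambda>_ _. 0"] simp del: k_times_cont_diff.simps(2))

lemma k_times_cont_diff_inner: "k_times_cont_diff k (\<lambda>x. x \<bullet> a)"
proof (cases k)
  case (Suc n)
  show ?thesis unfolding Suc
    by (rule k_times_cont_diff_SucI[where f' = "\<lambda>_ h. h \<bullet> a"]) (auto intro!: derivative_eq_intros)
qed (auto intro!: continuous_intros)

lemma k_times_cont_diff_add:
  "k_times_cont_diff k f \<Longrightarrow> k_times_cont_diff k g \<Longrightarrow> k_times_cont_diff k (\<lambda>x. f x + g x)"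
proof (induction k arbitrary: f g)
  case (Suc k)
  show ?case
    by (rule k_times_cont_diff_SucI[OF has_derivative_add[OF
          k_times_cont_diff_imp_has_derivative[OF Suc.prems(1)] k_times_cont_diff_imp_has_derivative[OF Suc.prems(2)]]])
      (use Suc in auto)
qed (auto intro!: continuous_intros)

lemma k_times_cont_diff_mult:
  "k_times_cont_diff k f \<Longrightarrow> k_times_cont_diff k g \<Longrightarrow> k_times_cont_diff k (\<lambda>x. f x * g x)"
proof (induction k arbitrary: f g)
  case (Suc k)
  note fg = k_times_cont_diff_SucD[OF Suc.prems(1)] k_times_cont_diff_SucD[OF Suc.prems(2)]
  show ?case
    by (rule k_times_cont_diff_SucI[OF has_derivative_mult[OF
          k_times_cont_diff_imp_has_derivative[OF Suc.prems(1)] k_times_cont_diff_imp_has_derivative[OF Suc.prems(2)]]])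
      (use Suc fg in \<open>auto intro!: k_times_cont_diff_add\<close>)
qed (auto intro!: continuous_intros)

lemma k_times_cont_diff_sum:
  "(\<And>i. i \<in> I \<Longrightarrow> k_times_cont_diff k (f i)) \<Longrightarrow> k_times_cont_diff k (\<lambda>x. \<Sum>i\<in>I. f i x)"
  by (induction I rule: infinite_finite_induct) (auto intro: k_times_cont_diff_add)

lemma k_times_cont_diff_diff:
  assumes "k_times_cont_diff k f" "k_times_cont_diff k g"
  shows "k_times_cont_diff k (\<lambda>x. f x - g x)"
  using k_times_cont_diff_add[OF assms(1) k_times_cont_diff_mult[OF k_times_cont_diff_const[of _ "-1"] assms(2)]]
  by simp

lemma k_times_cont_diff_inverse:
  "k_times_cont_diff k f \<Longrightarrow> (\<And>x. f x \<noteq> 0) \<Longrightarrow> k_times_cont_diff k (\<lambda>x. inverse (f x))"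
proof (induction k arbitrary: f)
  case (Suc k)
  note f = k_times_cont_diff_SucD[OF Suc.prems(1)]
  have *: "k_times_cont_diff k (\<lambda>x. - (inverse (f x) * frechet_derivative f (at x) b * inverse (f x)))"
    if "b \<in> Basis" for b
  proof -
    have "k_times_cont_diff k (\<lambda>x. (-1) * (inverse (f x) * frechet_derivative f (at x) b * inverse (f x)))"
      by (intro k_times_cont_diff_mult k_times_cont_diff_const Suc.IH f Suc.prems)
        (use Suc.prems(1) that in auto)
    then show ?thesis by simp
  qed
  show ?case
    by (rule k_times_cont_diff_SucI[OF Deriv.has_derivative_inverse[OF Suc.prems(2)
          k_times_cont_diff_imp_has_derivative[OF Suc.prems(1)]]]) (use * in auto)
qed (auto intro!: continuous_intros)

lemma k_times_cont_diff_translate: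
  "k_times_cont_diff k f \<Longrightarrow> k_times_cont_diff k (\<lambda>x. f (x + z))"
proof (induction k arbitrary: f)
  case 0
  then show ?case by (auto intro!: continuous_on_compose2[of UNIV f] continuous_intros)
next
  case (Suc k)
  have "((\<lambda>x. x + z) has_derivative (\<lambda>h. h)) (at x)" for x
    by (auto intro!: derivative_eq_intros)
  from has_derivative_compose[OF this k_times_cont_diff_imp_has_derivative[OF Suc.prems]]
  have "((\<lambda>x. f (x + z)) has_derivative frechet_derivative f (at (x + z))) (at x)" for x
    by simp
  then show ?case
    by (rule k_times_cont_diff_SucI) (use Suc in auto)
qed

section \<open>Flat functions and smooth cutoffs\<close>

definition flat :: "nat \<Rightarrow> real \<Rightarrow> real" where
  "flat k t = (if t > 0 then exp (- 1 / t) / t ^ k else 0)"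

lemma flat_tendsto_0: "(flat k \<longlongrightarrow> 0) (at 0)"
proof -
  have "((\<lambda>t. (inverse t) ^ k / exp (inverse t)) \<longlongrightarrow> (0::real)) (at_right 0)"
    by (rule filterlim_compose[OF tendsto_power_div_exp_0 filterlim_inverse_at_top_right])
  then have "(flat k \<longlongrightarrow> 0) (at_right 0)"
  proof (rule Lim_transform_eventually)
    show "\<forall>\<^sub>F t in at_right 0. inverse t ^ k / exp (inverse t) = flat k t"
      unfolding eventually_at_right_field
      by (intro exI[of _ 1]) (auto simp: flat_def exp_minus field_simps power_inverse)
  qed
  moreover have "(flat k \<longlongrightarrow> 0) (at_left 0)"
    by (rule tendsto_eventually) (auto simp: flat_def eventually_at_left_field intro!: exI[of _ "-1"])
  ultimately show ?thesis by (simp add: filterlim_split_at)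
qed

text \<open>Dividing by \<open>t ^ k\<close> makes the family closed, up to linear combinations,
  under differentiation. Smoothness of \<open>flat 0\<close> to all orders then follows by
  induction, without an explicit formula for higher derivatives.\<close>

lemma flat_has_derivative:
  "(flat k has_real_derivative (flat (k + 2) t - real k * flat (k + 1) t)) (at t)"
proof -
  consider "t > 0" | "t = 0" | "t < 0" by linarith
  then show ?thesis
  proof cases
    case 1
    \<comment> \<open>The exponent \<open>k - Suc 0\<close> is truncated at \<open>k = 0\<close>;
      the form with a division by \<open>t\<close> treats that case together with the
      others.\<close>
    have k: "real k * t ^ (k - Suc 0) = real k * t ^ k / t"
      using 1 by (cases k) auto
    have "((\<lambda>t. exp (- 1 / t)) has_real_derivative exp (- 1 / t) * (1 / t\<^sup>2)) (at t)"
      using 1 by (auto intro!: derivative_eq_intros simp: power2_eq_square)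
    moreover have "((\<lambda>t. t ^ k) has_real_derivative real k * t ^ (k - Suc 0)) (at t)"
      by (auto intro!: derivative_eq_intros)
    ultimately have "((\<lambda>t. exp (- 1 / t) / t ^ k) has_real_derivative
        (exp (- 1 / t) * (1 / t\<^sup>2) * t ^ k - exp (- 1 / t) * (real k * t ^ k / t)) / (t ^ k * t ^ k)) (at t)"
      unfolding k using 1 by (intro DERIV_divide) auto
    moreover have "(exp (- 1 / t) * (1 / t\<^sup>2) * t ^ k - exp (- 1 / t) * (real k * t ^ k / t)) / (t ^ k * t ^ k)
        = flat (k + 2) t - real k * flat (k + 1) t"
      using 1 by (simp add: flat_def field_simps power2_eq_square power_add)
    ultimately have "((\<lambda>t. exp (- 1 / t) / t ^ k) has_real_derivative (flat (k + 2) t - real k * flat (k + 1) t)) (at t)"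
      by simp
    then show ?thesis
    proof (rule has_field_derivative_transform_within_open)
      show "open {0::real<..}" "t \<in> {0<..}" using 1 by auto
    qed (auto simp: flat_def)
  next
    case 2
    \<comment> \<open>At 0 the difference quotient of \<open>flat k\<close> is
      \<open>flat (k + 1)\<close>, which tends to 0.\<close>
    have "((\<lambda>h. (flat k (0 + h) - flat k 0) / h) \<longlongrightarrow> 0) (at 0)"
      by (rule Lim_transform_eventually[OF flat_tendsto_0[of "k + 1"]])
        (auto simp: flat_def eventually_at intro!: exI[of _ 1])
    then show ?thesis using 2 by (simp add: DERIV_def flat_def)
  next
    case 3
    have "((\<lambda>t. 0) has_real_derivative 0) (at t)" by simp
    then have "(flat k has_real_derivative 0) (at t)"
    proof (rule has_field_derivative_transform_within_open)
      show "open {..<0::real}" "t \<in> {..<0}" using 3 by auto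
    qed (auto simp: flat_def)
    then show ?thesis using 3 by (simp add: flat_def)
  qed
qed

text \<open>The induction runs over all \<open>j\<close> at once because the derivative of the
  composition involves \<open>flat (j + 1)\<close> and \<open>flat (j + 2)\<close>.\<close>

lemma k_times_cont_diff_flat:
  "k_times_cont_diff k f \<Longrightarrow> k_times_cont_diff k (\<lambda>x. flat j (f x))"
proof (induction k arbitrary: f j)
  case 0
  have "continuous_on UNIV (flat j)"
    using flat_has_derivative[THEN DERIV_isCont] by (simp add: continuous_at_imp_continuous_on)
  then show ?case using 0 by (auto intro: continuous_on_compose2)
next
  case (Suc k)
  have d: "((\<lambda>x. flat j (f x)) has_derivative
      (\<lambda>h. (flat (j + 2) (f x) - real j * flat (j + 1) (f x)) * frechet_derivative f (at x) h)) (at x)" for x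
    using has_derivative_compose[OF k_times_cont_diff_imp_has_derivative[OF Suc.prems]
        flat_has_derivative[unfolded has_field_derivative_def]] .
  show ?case
    by (rule k_times_cont_diff_SucI[OF d])
      (use Suc k_times_cont_diff_SucD[OF Suc.prems] in
        \<open>auto intro!: k_times_cont_diff_mult k_times_cont_diff_diff simp del: add_2_eq_Suc'\<close>)
qed

text \<open>The squared distance from \<open>a\<close>, expanded into sums and products of
  translated coordinates so that the closure properties of smooth functions apply to it.\<close>

definition dist_sq :: "'a::euclidean_space \<Rightarrow> 'a \<Rightarrow> real" where
  "dist_sq a x = (\<Sum>b\<in>Basis. ((x + - a) \<bullet> b) * ((x + - a) \<bullet> b))"

lemma dist_sq: "dist_sq a x = (dist x a)\<^sup>2"
proof -
  have "(x - a) \<bullet> (x - a) = dist_sq a x"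
    unfolding dist_sq_def by (subst euclidean_inner) simp
  then show ?thesis by (simp add: dist_norm power2_norm_eq_inner)
qed

lemma smooth_dist_sq: "smooth (dist_sq a)"
proof
  fix k
  show "k_times_cont_diff k (dist_sq a)"
    unfolding dist_sq_def
    by (intro k_times_cont_diff_sum k_times_cont_diff_mult)
      (rule k_times_cont_diff_translate[OF k_times_cont_diff_inner])+
qed

lemma flat_pos: "t > 0 \<Longrightarrow> flat k t > 0" and flat_nonpos: "t \<le> 0 \<Longrightarrow> flat k t = 0"
  and flat_nonneg: "flat k t \<ge> 0"
  by (auto simp: flat_def)

text \<open>The quotient \<open>p / (p + q)\<close>, where \<open>p\<close> is positive exactly
  inside the ball of radius \<open>R\<close> and \<open>q\<close> exactly outside the closed ball of
  radius \<open>r\<close>. As \<open>r < R\<close>, the denominator never vanishes.\<close>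

lemma smooth_cutoff_exists:
  fixes a :: "'a::euclidean_space"
  assumes "0 < r" "r < R"
  obtains \<psi> where "smooth \<psi>" "\<And>x. 0 \<le> \<psi> x" "\<And>x. \<psi> x \<le> 1" "\<And>x. x \<in> cball a r \<Longrightarrow> \<psi> x = 1"
    "\<And>x. x \<notin> ball a R \<Longrightarrow> \<psi> x = 0"
proof -
  define p q where "p x = flat 0 (R\<^sup>2 - dist_sq a x)" and "q x = flat 0 (dist_sq a x - r\<^sup>2)" for x :: 'a
  have nn: "p x \<ge> 0" "q x \<ge> 0" for x by (auto simp: p_def q_def flat_nonneg)
  have rR: "r\<^sup>2 < R\<^sup>2" using assms by (intro power_strict_mono) auto
  have pos: "p x + q x > 0" for x
  proof (cases "dist_sq a x < R\<^sup>2")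
    case True
    then have "p x > 0" by (simp add: p_def flat_pos)
    then show ?thesis using nn(2)[of x] by linarith
  next
    case False
    then have "q x > 0" using rR by (simp add: q_def flat_pos)
    then show ?thesis using nn(1)[of x] by linarith
  qed
  define \<psi> where "\<psi> x = p x * inverse (p x + q x)" for x
  show ?thesis
  proof (rule that[of \<psi>])
    show "smooth \<psi>"
      unfolding \<psi>_def
    proof (intro allI k_times_cont_diff_mult k_times_cont_diff_inverse k_times_cont_diff_add)
      fix k
      show "k_times_cont_diff k p" "k_times_cont_diff k p" "k_times_cont_diff k q" 
        unfolding p_def q_def using smooth_dist_sq[of a]
        by (auto intro!: k_times_cont_diff_flat k_times_cont_diff_diff)
    qed (use pos in \<open>metis less_irrefl\<close>)
    show "0 \<le> \<psi> x" "\<psi> x \<le> 1" for x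
      using nn[of x] pos[of x] by (auto simp: \<psi>_def field_simps)
    show "\<psi> x = 1" if "x \<in> cball a r" for x
    proof -
      have "dist_sq a x \<le> r\<^sup>2" using that by (auto simp: dist_sq dist_commute intro!: power_mono)
      then have "q x = 0" by (simp add: q_def flat_nonpos)
      then show ?thesis using pos[of x] by (simp add: \<psi>_def)
    qed
    show "\<psi> x = 0" if "x \<notin> ball a R" for x
    proof -
      have "R\<^sup>2 \<le> dist_sq a x" using that assms by (auto simp: dist_sq dist_commute intro!: power_mono)
      then show ?thesis by (simp add: \<psi>_def p_def flat_nonpos)
    qed
  qed
qed

text \<open>With \<open>p\<close> smooth, positive in the ball and zero outside,
  \<open>p / (p + 1 / (k + 1))\<close> tends to 1 where \<open>p\<close> is positive and is 0
  elsewhere.\<close>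

lemma smooth_indicator_ball_approx:
  fixes a :: "'a::euclidean_space"
  assumes "0 < r"
  obtains \<phi> where "\<And>k::nat. smooth (\<phi> k)" "\<And>k x. \<bar>\<phi> k x\<bar> \<le> indicator (ball a r) x"
    "\<And>x. (\<lambda>k. \<phi> k x) \<longlonglongrightarrow> indicator (ball a r) x"
proof -
  define p where "p x = flat 0 (r\<^sup>2 - dist_sq a x)" for x
  have nn: "p x \<ge> 0" for x by (auto simp: p_def flat_nonneg)
  define \<phi> where "\<phi> k x = p x * inverse (p x + inverse (real (Suc k)))" for k x
  have pos: "p x + inverse (real (Suc k)) > 0" for x k using nn by (simp add: add_nonneg_pos)
  have ne: "p x + inverse (real (Suc k)) \<noteq> 0" for x k using pos[of x k] by (metis less_irrefl)
  have out: "p x = 0" if "x \<notin> ball a r" for x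
  proof -
    have "r\<^sup>2 \<le> dist_sq a x" using that assms by (auto simp: dist_sq dist_commute intro!: power_mono)
    then show ?thesis by (simp add: p_def flat_nonpos)
  qed
  have inn: "p x > 0" if "x \<in> ball a r" for x
  proof -
    have "dist_sq a x < r\<^sup>2" using that assms by (auto simp: dist_sq dist_commute intro!: power_strict_mono)
    then show ?thesis by (simp add: p_def flat_pos)
  qed
  show ?thesis
  proof (rule that[of \<phi>])
    show "smooth (\<phi> k)" for k
      unfolding \<phi>_def
    proof (intro allI k_times_cont_diff_mult k_times_cont_diff_inverse k_times_cont_diff_add k_times_cont_diff_const)
      fix j
      show "k_times_cont_diff j p" "k_times_cont_diff j p"
        unfolding p_def using smooth_dist_sq[of a]
        by (auto intro!: k_times_cont_diff_flat k_times_cont_diff_diff)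
    qed (use ne in auto)
    show "\<bar>\<phi> k x\<bar> \<le> indicator (ball a r) x" for k x
      using out[of x] nn[of x] pos[of x k]
      by (cases "x \<in> ball a r") (simp_all add: \<phi>_def field_simps)
    show "(\<lambda>k. \<phi> k x) \<longlonglongrightarrow> indicator (ball a r) x" for x
    proof (cases "x \<in> ball a r")
      case True
      have "(\<lambda>k. p x * inverse (p x + inverse (real (Suc k)))) \<longlonglongrightarrow> p x * inverse (p x + 0)"
        using inn[OF True] by (intro tendsto_intros LIMSEQ_inverse_real_of_nat) auto
      then show ?thesis using inn[OF True] True by (simp add: \<phi>_def)
    next
      case False
      then show ?thesis using out by (simp add: \<phi>_def)
    qed
  qed
qed

subsection \<open>Test functions\<close>

lemma smooth_has_derivative:
  "smooth f \<Longrightarrow> (f has_derivative frechet_derivative f (at x)) (at x)"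
  using k_times_cont_diff_imp_has_derivative by blast

lemma smooth_continuous: "smooth f \<Longrightarrow> continuous_on A f"
  using k_times_cont_diff.simps(1) continuous_on_subset by blast

lemma frechet_derivative_euclidean:
  fixes f :: "'a::euclidean_space \<Rightarrow> real"
  assumes "smooth f"
  shows "frechet_derivative f (at x) z = (\<Sum>b\<in>Basis. (z \<bullet> b) * frechet_derivative f (at x) b)"
proof -
  interpret bounded_linear "frechet_derivative f (at x)"
    using smooth_has_derivative[OF assms] has_derivative_bounded_linear by blast
  have "frechet_derivative f (at x) z = frechet_derivative f (at x) (\<Sum>b\<in>Basis. (z \<bullet> b) *\<^sub>R b)"
    by (simp add: euclidean_representation)
  then show ?thesis by (simp add: sum scaleR)
qed

lemma continuous_frechet_derivative:
  fixes f :: "'a::euclidean_space \<Rightarrow> real"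
  assumes "smooth f"
  shows "continuous_on A (\<lambda>x. frechet_derivative f (at x) z)"
proof -
  have "continuous_on A (\<lambda>x. frechet_derivative f (at x) b)" if "b \<in> Basis" for b
    using assms[rule_format, of "Suc 0"] that by (auto intro: continuous_on_subset)
  then show ?thesis
    unfolding frechet_derivative_euclidean[OF assms, of _ z] by (intro continuous_intros) auto
qed

lemma frechet_derivative_scaleR:
  fixes f :: "'a::euclidean_space \<Rightarrow> real"
  assumes "smooth f"
  shows "frechet_derivative f (at x) (c *\<^sub>R z) = c * frechet_derivative f (at x) z"
  using linear_scale[OF has_derivative_linear[OF smooth_has_derivative[OF assms]]] by simp

lemma frechet_derivative_smooth_mult:
  assumes "smooth f" "smooth g"
  shows "frechet_derivative (\<lambda>x. f x * g x) (at x) z =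
    f x * frechet_derivative g (at x) z + frechet_derivative f (at x) z * g x"
  using frechet_derivative_at[OF has_derivative_mult[OF smooth_has_derivative[OF assms(1)] smooth_has_derivative[OF assms(2)]]]
  by metis

lemma frechet_derivative_translate:
  assumes "smooth f"
  shows "frechet_derivative (\<lambda>x. f (x + c)) (at x) z = frechet_derivative f (at (x + c)) z"
proof -
  have "((\<lambda>x. x + c) has_derivative (\<lambda>h. h)) (at x)"
    by (auto intro!: derivative_eq_intros)
  from has_derivative_compose[OF this smooth_has_derivative[OF assms]]
  have "((\<lambda>x. f (x + c)) has_derivative frechet_derivative f (at (x + c))) (at x)"
    by simp
  from frechet_derivative_at[OF this] show ?thesis by simp
qed

text \<open>Meant for cutoffs with values between 0 and 1: their gradient vanishes wherever the
  value is 0 or 1, including the edges of these regions.\<close>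

lemma smooth_derivative_zero_maxmin:
  assumes f: "smooth f" and x: "(\<forall>y. f y \<le> f x) \<or> (\<forall>y. f x \<le> f y)"
  shows "frechet_derivative f (at x) z = 0"
proof -
  have "frechet_derivative f (at x) = (\<lambda>v. 0)"
    by (rule differential_zero_maxmin[OF UNIV_I open_UNIV smooth_has_derivative[OF f]]) (use x in auto)
  then show ?thesis by simp
qed

lemma test_functionsI:
  assumes "smooth \<phi>" "compact K" "K \<subseteq> \<Omega>" "\<And>x. x \<notin> K \<Longrightarrow> \<phi> x = 0"
  shows "\<phi> \<in> test_functions \<Omega>"
proof -
  have sub: "closure {x. \<phi> x \<noteq> 0} \<subseteq> K"
    using assms(4) compact_imp_closed[OF assms(2)] by (intro closure_minimal) auto
  have "bounded {x. \<phi> x \<noteq> 0}"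
    using bounded_subset[OF compact_imp_bounded[OF assms(2)]] order_trans[OF closure_subset sub] .
  then have "compact (closure {x. \<phi> x \<noteq> 0})" by (simp add: compact_closure)
  then show ?thesis using order_trans[OF sub assms(3)] assms(1) by (simp add: test_functions_def)
qed

text \<open>Outside the closed support the function vanishes on a neighbourhood, so the same compact
  set serves for the derivative.\<close>

lemma test_functionsE:
  assumes "\<phi> \<in> test_functions \<Omega>"
  obtains K where "smooth \<phi>" "compact K" "K \<subseteq> \<Omega>" "\<And>x. x \<notin> K \<Longrightarrow> \<phi> x = 0"
    "\<And>x z. x \<notin> K \<Longrightarrow> frechet_derivative \<phi> (at x) z = 0"
proof (rule that[of "closure {x. \<phi> x \<noteq> 0}"])
  show z: "\<phi> x = 0" if "x \<notin> closure {x. \<phi> x \<noteq> 0}" for x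
    using that subsetD[OF closure_subset, of x "{x. \<phi> x \<noteq> 0}"] by blast
  show "frechet_derivative \<phi> (at x) z = 0" if x: "x \<notin> closure {x. \<phi> x \<noteq> 0}" for x z
  proof -
    have "((\<lambda>x. 0::real) has_derivative (\<lambda>h. 0)) (at x)" by simp
    then have "(\<phi> has_derivative (\<lambda>h. 0)) (at x)"
    proof (rule has_derivative_transform_within_open)
      show "open (- closure {x. \<phi> x \<noteq> 0})" by (rule open_Compl[OF closed_closure])
      show "x \<in> - closure {x. \<phi> x \<noteq> 0}" using x by simp
    qed (metis ComplD z)
    from fun_cong[OF frechet_derivative_at[OF this], of z] show ?thesis by simp
  qed
  show "smooth \<phi>" "compact (closure {x. \<phi> x \<noteq> 0})" "closure {x. \<phi> x \<noteq> 0} \<subseteq> \<Omega>"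
    using assms by (simp_all add: test_functions_def)
qed

lemma test_functions_smooth: "\<phi> \<in> test_functions \<Omega> \<Longrightarrow> smooth \<phi>"
  by (simp add: test_functions_def)

lemma test_functions_mult:
  assumes "smooth \<psi>" "\<phi> \<in> test_functions \<Omega>"
  shows "(\<lambda>x. \<psi> x * \<phi> x) \<in> test_functions \<Omega>"
proof -
  obtain K where "smooth \<phi>" "compact K" "K \<subseteq> \<Omega>" "\<And>x. x \<notin> K \<Longrightarrow> \<phi> x = 0"
    "\<And>x z. x \<notin> K \<Longrightarrow> frechet_derivative \<phi> (at x) z = 0"
    using test_functionsE[OF assms(2)] by blast
  then show ?thesis using assms(1)
    by (intro test_functionsI[of _ K]) (simp_all add: k_times_cont_diff_mult)
qed

lemma continuous_compact_support_square_integrable: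
  fixes h :: "'a::euclidean_space \<Rightarrow> real"
  assumes "continuous_on UNIV h" "compact K" "\<And>x. x \<notin> K \<Longrightarrow> h x = 0"
  shows "square_integrable lborel h"
proof -
  have [measurable]: "h \<in> borel_measurable borel"
    using assms(1) by (rule borel_measurable_continuous_onI)
  have "integrable lborel (\<lambda>x. indicator K x *\<^sub>R (h x)\<^sup>2)"
    by (rule borel_integrable_compact[OF assms(2)]) (intro continuous_intros continuous_on_subset[OF assms(1)], simp)
  moreover have "(\<lambda>x. indicator K x *\<^sub>R (h x)\<^sup>2) = (\<lambda>x. (h x)\<^sup>2)"
    using assms(3) by (intro ext) (auto simp: indicator_def)
  ultimately show ?thesis by (simp add: square_integrable_def)
qed

lemma test_functions_square_integrable:
  assumes "\<phi> \<in> test_functions \<Omega>"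
  shows "square_integrable lborel \<phi>" "square_integrable lborel (\<lambda>x. frechet_derivative \<phi> (at x) z)"
proof -
  obtain K where "smooth \<phi>" "compact K" "K \<subseteq> \<Omega>" "\<And>x. x \<notin> K \<Longrightarrow> \<phi> x = 0"
    "\<And>x z. x \<notin> K \<Longrightarrow> frechet_derivative \<phi> (at x) z = 0"
    using test_functionsE[OF assms] by blast
  then show "square_integrable lborel \<phi>" "square_integrable lborel (\<lambda>x. frechet_derivative \<phi> (at x) z)"
    by (auto intro!: continuous_compact_support_square_integrable[of _ K] smooth_continuous
        continuous_frechet_derivative)
qed

lemma continuous_compact_support_bounded:
  fixes h :: "'a::euclidean_space \<Rightarrow> real"
  assumes "continuous_on UNIV h" "compact K" "\<And>x. x \<notin> K \<Longrightarrow> h x = 0"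
  obtains B where "B > 0" "\<And>x. \<bar>h x\<bar> \<le> B"
proof -
  have "bounded (h ` K)"
    using assms by (intro compact_imp_bounded compact_continuous_image continuous_on_subset[OF assms(1)]) auto
  then obtain B where "B > 0" "\<And>x. x \<in> K \<Longrightarrow> \<bar>h x\<bar> \<le> B"
    unfolding bounded_pos by auto
  then have "\<bar>h x\<bar> \<le> B" for x using assms(3)[of x] by (cases "x \<in> K") auto
  with \<open>B > 0\<close> show ?thesis using that by blast
qed

lemma test_functions_bounded:
  assumes "\<phi> \<in> test_functions \<Omega>"
  obtains B where "B > 0" "\<And>x. \<bar>\<phi> x\<bar> \<le> B" "\<And>x. \<bar>frechet_derivative \<phi> (at x) z\<bar> \<le> B"
proof -
  obtain K where K: "smooth \<phi>" "compact K" "K \<subseteq> \<Omega>" "\<And>x. x \<notin> K \<Longrightarrow> \<phi> x = 0"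
    "\<And>x z. x \<notin> K \<Longrightarrow> frechet_derivative \<phi> (at x) z = 0"
    using test_functionsE[OF assms] by blast
  obtain B1 where B1: "B1 > 0" "\<And>x. \<bar>\<phi> x\<bar> \<le> B1"
    using continuous_compact_support_bounded[OF smooth_continuous[OF K(1)] K(2,4)] by blast
  obtain B2 where B2: "B2 > 0" "\<And>x. \<bar>frechet_derivative \<phi> (at x) z\<bar> \<le> B2"
    using continuous_compact_support_bounded[OF continuous_frechet_derivative[OF K(1)] K(2,5)] by blast
  have "\<bar>\<phi> x\<bar> \<le> max B1 B2" "\<bar>frechet_derivative \<phi> (at x) z\<bar> \<le> max B1 B2" for x
    using B1(2)[of x] B2(2)[of x] by auto
  then show ?thesis using that[of "max B1 B2"] B1(1) by auto
qed

subsection \<open>Averages along segments and over balls\<close>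

definition segment_measure :: "'a::euclidean_space \<Rightarrow> 'a measure" where
  "segment_measure z = distr (restrict_space lborel {0..1::real}) borel (\<lambda>s. s *\<^sub>R z)"

definition ball_measure :: "'a::euclidean_space \<Rightarrow> real \<Rightarrow> 'a measure" where
  "ball_measure c r = uniform_measure lborel (ball c r)"

lemma prob_shift_segment: "prob_shift (segment_measure z)"
proof -
  have [measurable]: "(\<lambda>s. s *\<^sub>R z) \<in> restrict_space lborel {0..1::real} \<rightarrow>\<^sub>M borel"
    by (intro measurable_restrict_space1) auto
  have "prob_space (restrict_space lborel {0..1::real})"
    by (rule prob_spaceI) (simp add: emeasure_restrict_space space_restrict_space)
  then have "prob_space (segment_measure z)"
    unfolding segment_measure_def by (rule prob_space.prob_space_distr) measurable
  then show ?thesis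
    by (auto simp: prob_shift_def prob_shift_axioms_def segment_measure_def)
qed

lemma AE_segment_measure: "AE y in segment_measure z. \<exists>s\<in>{0..1}. y = s *\<^sub>R z"
proof -
  have "compact ((\<lambda>s. s *\<^sub>R z) ` {0..1::real})"
    by (intro compact_continuous_image continuous_intros) auto
  then have [measurable]: "(\<lambda>s. s *\<^sub>R z) ` {0..1::real} \<in> sets borel" by (rule borel_compact)
  have [measurable]: "(\<lambda>s. s *\<^sub>R z) \<in> restrict_space lborel {0..1::real} \<rightarrow>\<^sub>M borel"
    by (intro measurable_restrict_space1) auto
  have "AE y in segment_measure z. y \<in> (\<lambda>s. s *\<^sub>R z) ` {0..1::real}"
    unfolding segment_measure_def
    by (subst AE_distr_iff) (auto intro!: AE_I2 simp: space_restrict_space)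
  then show ?thesis by eventually_elim auto
qed

lemma norm_AE_segment_measure: "AE y in segment_measure z. norm y \<le> norm z"
  using AE_segment_measure[of z] by eventually_elim (auto simp: mult_left_le_one_le)

lemma prob_shift_ball: "r > 0 \<Longrightarrow> prob_shift (ball_measure c r)"
proof -
  assume r: "r > 0"
  have "prob_space (ball_measure c r)"
    unfolding ball_measure_def
  proof (rule prob_space_uniform_measure)
    show "emeasure lborel (ball c r) \<noteq> 0"
      using content_ball_pos[OF r, of c] by (auto simp: measure_def)
    show "emeasure lborel (ball c r) \<noteq> \<infinity>"
      using emeasure_bounded_finite[of "ball c r"] by simp
  qed
  then show ?thesis
    by (simp add: prob_shift_def prob_shift_axioms_def ball_measure_def)
qed

lemma AE_ball_measure: "AE y in ball_measure c r. y \<in> ball c r"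
  unfolding ball_measure_def by (rule AE_uniform_measureI) auto

lemma norm_AE_ball_measure: "AE y in ball_measure c r. norm y \<le> norm c + r"
  using AE_ball_measure[of c r]
proof eventually_elim
  case (elim y)
  then have "norm (y - c) < r" by (simp add: dist_norm norm_minus_commute)
  then show ?case using norm_triangle_sub[of y c] by linarith
qed

lemma integral_ball_measure:
  fixes f :: "'a::euclidean_space \<Rightarrow> real"
  assumes [measurable]: "f \<in> borel_measurable borel" and r: "r > 0"
  shows "(LINT y|ball_measure c r. f y) = (LINT y|lborel. indicator (ball c r) y * f y) / measure lborel (ball c r)"
proof -
  let ?m = "measure lborel (ball c r)"
  have em: "emeasure lborel (ball c r) = ennreal ?m"
    using emeasure_bounded_finite[of "ball c r"] by (intro emeasure_eq_ennreal_measure) auto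
  have pos: "?m > 0"
    using r by (simp add: content_ball_pos)
  have d: "ball_measure c r = density lborel (\<lambda>x. ennreal (indicator (ball c r) x / ?m))"
    unfolding ball_measure_def uniform_measure_def em
    by (intro density_cong) (auto simp: indicator_def divide_ennreal[OF _ pos] pos
        simp flip: ennreal_1 intro!: AE_I2)
  have "(LINT y|ball_measure c r. f y) = (LINT y|lborel. (indicator (ball c r) y / ?m) *\<^sub>R f y)"
    unfolding d
  proof (rule integral_density)
    show "(\<lambda>x. indicator (ball c r) x / ?m) \<in> borel_measurable lborel"
      by (intro borel_measurable_divide borel_measurable_indicator borel_measurable_const) simp
  qed auto
  also have "\<dots> = (LINT y|lborel. (indicator (ball c r) y * f y) / ?m)" by simp
  finally show ?thesis by simp
qed

text \<open>The fundamental theorem of calculus on the segment from \<open>x\<close> to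
  \<open>x + z\<close>: \<open>segment_measure z\<close> is the law of \<open>s *\<^sub>R z\<close>
  for \<open>s\<close> uniform on the unit interval. Increments thereby inherit the L^2 estimates
  for averages.\<close>

lemma smooth_difference_eq_average:
  fixes f :: "'a::euclidean_space \<Rightarrow> real"
  assumes f: "smooth f"
  shows "f (x + z) - f x = prob_shift.average (segment_measure z) (\<lambda>y. frechet_derivative f (at y) z) x"
proof -
  interpret prob_shift "segment_measure z" by (rule prob_shift_segment)
  let ?g = "\<lambda>y. frechet_derivative f (at y) z"
  have cg: "continuous_on UNIV ?g" by (rule continuous_frechet_derivative[OF f])
  have gm[measurable]: "?g \<in> borel_measurable borel" using cg by (rule borel_measurable_continuous_onI)
  have [measurable]: "(\<lambda>s. s *\<^sub>R z) \<in> restrict_space lborel {0..1::real} \<rightarrow>\<^sub>M borel"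
    by (intro measurable_restrict_space1) auto
  have cgs: "continuous_on UNIV (\<lambda>s::real. ?g (x + s *\<^sub>R z))"
    by (rule continuous_on_compose2[OF cg]) (auto intro!: continuous_intros)
  have "(LBINT s. ?g (x + s *\<^sub>R z) * indicator {0..1} s) = f (x + 1 *\<^sub>R z) - f (x + 0 *\<^sub>R z)"
  proof (rule integral_FTC_Icc_real)
    fix s :: real
    have "((\<lambda>s. f (x + s *\<^sub>R z)) has_derivative (\<lambda>h. frechet_derivative f (at (x + s *\<^sub>R z)) (h *\<^sub>R z))) (at s)"
    proof (rule has_derivative_compose[OF _ smooth_has_derivative[OF f]])
      show "((\<lambda>s. x + s *\<^sub>R z) has_derivative (\<lambda>h. h *\<^sub>R z)) (at s)"
        by (auto intro!: derivative_eq_intros)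
    qed
    then show "((\<lambda>s. f (x + s *\<^sub>R z)) has_real_derivative ?g (x + s *\<^sub>R z)) (at s)"
      by (simp add: has_field_derivative_def frechet_derivative_scaleR[OF f] mult_commute_abs)
    show "isCont (\<lambda>s. ?g (x + s *\<^sub>R z)) s"
      using cgs by (simp add: continuous_on_eq_continuous_at)
  qed simp
  moreover have "average ?g x = (LBINT s. ?g (x + s *\<^sub>R z) * indicator {0..1} s)"
    unfolding average_def unfolding segment_measure_def
    by (subst integral_distr) (auto simp: integral_restrict_space mult.commute)
  ultimately show ?thesis by simp
qed

subsection \<open>Weak gradients of Borel representatives\<close>

text \<open>
  Borel functions on the whole space that vanish off \<open>\<Omega>\<close> can be translated freely, and Fubini's theorem
  applies to them, neither of which is convenient for \<open>lebesgue_on \<Omega>\<close>.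
\<close>

definition sobolev :: "'a::euclidean_space set \<Rightarrow> ('a \<Rightarrow> real) \<Rightarrow> ('a \<Rightarrow> 'a) \<Rightarrow> bool" where
  "sobolev \<Omega> u g \<longleftrightarrow>
     square_integrable lborel u \<and> (\<forall>b\<in>Basis. square_integrable lborel (\<lambda>x. g x \<bullet> b)) \<and>
     (\<forall>x. x \<notin> \<Omega> \<longrightarrow> u x = 0 \<and> g x = 0) \<and>
     (\<forall>\<phi>\<in>test_functions \<Omega>. \<forall>b\<in>Basis.
        (LINT x|lborel. u x * frechet_derivative \<phi> (at x) b) = - (LINT x|lborel. (g x \<bullet> b) * \<phi> x))"

lemma sobolevD:
  assumes "sobolev \<Omega> u g"
  shows "square_integrable lborel u" "x \<notin> \<Omega> \<Longrightarrow> u x = 0" "x \<notin> \<Omega> \<Longrightarrow> g x = 0"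
    "u \<in> borel_measurable borel"
  using assms by (auto simp: sobolev_def dest!: square_integrable_measurable)

lemma inner_euclidean: "g \<bullet> z = (\<Sum>b\<in>Basis. (z \<bullet> b) * (g \<bullet> b))" for g z :: "'a::euclidean_space"
  by (subst euclidean_inner) (simp add: mult.commute)

lemma sobolev_gradient_square_integrable:
  assumes "sobolev \<Omega> u g"
  shows "square_integrable lborel (\<lambda>x. g x \<bullet> z)"
  using assms unfolding sobolev_def inner_euclidean[of _ z]
  by (intro square_integrable_sum square_integrable_cmult) auto

lemma sobolev_gradient_measurable:
  assumes "sobolev \<Omega> u g"
  shows "g \<in> borel_measurable borel"
  using sobolev_gradient_square_integrable[OF assms, THEN square_integrable_measurable]
  by (subst borel_measurable_euclidean_space) auto

text \<open>Both sides are linear in the direction, so the identity for basis vectors extends to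
  every \<open>z\<close>, which the difference quotients along segments require.\<close>

lemma sobolev_integration_by_parts:
  assumes s: "sobolev \<Omega> u g" and \<phi>: "\<phi> \<in> test_functions \<Omega>"
  shows "(LINT x|lborel. u x * frechet_derivative \<phi> (at x) z) = - (LINT x|lborel. (g x \<bullet> z) * \<phi> x)"
proof -
  have i1: "integrable lborel (\<lambda>x. u x * frechet_derivative \<phi> (at x) b)" for b
    using sobolevD(1)[OF s] test_functions_square_integrable(2)[OF \<phi>] square_integrable_mult_integrable by blast
  have i2: "integrable lborel (\<lambda>x. (g x \<bullet> b) * \<phi> x)" for b
    using sobolev_gradient_square_integrable[OF s] test_functions_square_integrable(1)[OF \<phi>]
      square_integrable_mult_integrable by blast
  have "(LINT x|lborel. u x * frechet_derivative \<phi> (at x) z) =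
      (LINT x|lborel. (\<Sum>b\<in>Basis. (z \<bullet> b) * (u x * frechet_derivative \<phi> (at x) b)))"
    unfolding frechet_derivative_euclidean[OF test_functions_smooth[OF \<phi>], of _ z]
    by (simp add: sum_distrib_left mult_ac)
  also have "\<dots> = (\<Sum>b\<in>Basis. (z \<bullet> b) * (LINT x|lborel. u x * frechet_derivative \<phi> (at x) b))"
    using i1 by (subst Bochner_Integration.integral_sum) auto
  also have "\<dots> = (\<Sum>b\<in>Basis. (z \<bullet> b) * (- (LINT x|lborel. (g x \<bullet> b) * \<phi> x)))"
    using s \<phi> by (intro sum.cong) (auto simp: sobolev_def)
  also have "\<dots> = - (\<Sum>b\<in>Basis. (z \<bullet> b) * (LINT x|lborel. (g x \<bullet> b) * \<phi> x))"
    by (simp add: sum_negf)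
  also have "(\<Sum>b\<in>Basis. (z \<bullet> b) * (LINT x|lborel. (g x \<bullet> b) * \<phi> x)) =
      (LINT x|lborel. (\<Sum>b\<in>Basis. (z \<bullet> b) * ((g x \<bullet> b) * \<phi> x)))"
    using i2 by (subst Bochner_Integration.integral_sum) auto
  also have "\<dots> = (LINT x|lborel. (g x \<bullet> z) * \<phi> x)"
    unfolding inner_euclidean[of _ z] by (simp add: sum_distrib_right sum_distrib_left mult_ac)
  finally show ?thesis .
qed

lemma sobolev_add:
  assumes 1: "sobolev \<Omega> u g" and 2: "sobolev \<Omega> v h"
  shows "sobolev \<Omega> (\<lambda>x. u x + v x) (\<lambda>x. g x + h x)"
  unfolding sobolev_def
proof (intro conjI ballI)
  fix \<phi> b assume \<phi>: "\<phi> \<in> test_functions \<Omega>"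
  note si = sobolevD(1)[OF 1] sobolevD(1)[OF 2] sobolev_gradient_square_integrable[OF 1]
    sobolev_gradient_square_integrable[OF 2] test_functions_square_integrable[OF \<phi>]
  show "(LINT x|lborel. (u x + v x) * frechet_derivative \<phi> (at x) b) =
      - (LINT x|lborel. (g x + h x) \<bullet> b * \<phi> x)"
    using sobolev_integration_by_parts[OF 1 \<phi>, of b] sobolev_integration_by_parts[OF 2 \<phi>, of b]
    by (simp add: distrib_right inner_add_left si square_integrable_mult_integrable)
qed (use 1 2 in \<open>auto simp: inner_add_left sobolev_def\<close>)

lemma sobolev_cmult:
  assumes 1: "sobolev \<Omega> u g"
  shows "sobolev \<Omega> (\<lambda>x. c * u x) (\<lambda>x. c *\<^sub>R g x)"
  using assms unfolding sobolev_def by (auto simp: mult.assoc)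

lemma sobolev_diff:
  assumes "sobolev \<Omega> u g" "sobolev \<Omega> v h"
  shows "sobolev \<Omega> (\<lambda>x. u x - v x) (\<lambda>x. g x - h x)"
  using sobolev_add[OF assms(1) sobolev_cmult[OF assms(2), of "-1"]] by simp

text \<open>Test functions converge boundedly to the indicator of any ball whose closure lies in
  \<open>U\<close>, so the means of \<open>v\<close> over such balls vanish. Means over shrinking
  balls converge to \<open>v\<close> in L^2, hence almost everywhere along a subsequence.\<close>

lemma fundamental_lemma:
  fixes v :: "'a::euclidean_space \<Rightarrow> real"
  assumes v: "square_integrable lborel v" and U: "open U"
    and zero: "\<And>\<phi>. \<phi> \<in> test_functions U \<Longrightarrow> (LINT x|lborel. v x * \<phi> x) = 0"
  shows "AE x in lborel. x \<in> U \<longrightarrow> v x = 0"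
proof -
  have [measurable]: "v \<in> borel_measurable borel" using square_integrable_measurable[OF v] by simp
  have [measurable]: "ball a r \<in> sets borel" for a :: 'a and r by simp
  have ball0: "(LINT x|lborel. indicator (ball a r) x * v x) = 0" if r: "r > 0" and sub: "cball a r \<subseteq> U" for a r
  proof -
    obtain \<phi> where \<phi>: "\<And>k::nat. smooth (\<phi> k)" "\<And>k x. \<bar>\<phi> k x\<bar> \<le> indicator (ball a r) x"
      "\<And>x. (\<lambda>k. \<phi> k x) \<longlonglongrightarrow> indicator (ball a r) x"
      using smooth_indicator_ball_approx[OF r, of a] by blast
    have z: "\<phi> k x = 0" if "x \<notin> cball a r" for k x
      using \<phi>(2)[of k x] that by (auto simp: indicator_def)
    have "\<phi> k \<in> test_functions U" for k
      using \<phi>(1) sub z by (intro test_functionsI[of _ "cball a r"]) auto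
    then have 0: "(LINT x|lborel. v x * \<phi> k x) = 0" for k by (rule zero)
    have [measurable]: "\<phi> k \<in> borel_measurable borel" for k
      using smooth_continuous[OF \<phi>(1)] by (rule borel_measurable_continuous_onI)
    have ind: "square_integrable lborel (indicator (ball a r) :: 'a \<Rightarrow> real)"
      using emeasure_bounded_finite[of "ball a r"] by (intro square_integrable_indicator) auto
    have "(\<lambda>k. LINT x|lborel. v x * \<phi> k x) \<longlonglongrightarrow> (LINT x|lborel. v x * indicator (ball a r) x)"
    proof (rule integral_dominated_convergence)
      show "integrable lborel (\<lambda>x. \<bar>v x * indicator (ball a r) x\<bar>)"
        using square_integrable_mult_integrable[OF v ind] by (rule integrable_abs)
      show "AE x in lborel. norm (v x * \<phi> k x) \<le> \<bar>v x * indicator (ball a r) x\<bar>" for k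
        using \<phi>(2) by (auto simp: abs_mult intro!: mult_left_mono)
      show "AE x in lborel. (\<lambda>k. v x * \<phi> k x) \<longlonglongrightarrow> v x * indicator (ball a r) x"
        using \<phi>(3) by (intro always_eventually allI tendsto_intros) 
    qed simp_all
    then show ?thesis by (simp add: 0 mult.commute LIMSEQ_const_iff)
  qed
  have avg0: "prob_shift.average (ball_measure 0 r) v a = 0" if r: "r > 0" and sub: "cball a r \<subseteq> U" for a r
  proof -
    interpret prob_shift "ball_measure 0 r" using r by (rule prob_shift_ball)
    have "average v a = (LINT y|lborel. indicator (ball 0 r) y * v (a + y)) / measure lborel (ball (0::'a) r)"
      unfolding average_def by (rule integral_ball_measure[OF _ r]) measurable
    also have "(LINT y|lborel. indicator (ball 0 r) y * v (a + y)) =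
        (LINT y|lborel. indicator (ball a r) (y + a) * v (y + a))"
      by (rule Bochner_Integration.integral_cong) (auto simp: indicator_def dist_norm add.commute)
    also have "\<dots> = (LINT y|lborel. indicator (ball a r) y * v y)"
      by (rule integral_translate) measurable
    finally show ?thesis using ball0[OF that] by simp
  qed
  let ?\<mu> = "\<lambda>k::nat. ball_measure (0::'a) (inverse (real (Suc k)))"
  have ps: "prob_shift (?\<mu> k)" for k by (rule prob_shift_ball) simp
  have "(\<lambda>k. sq_integral lborel (\<lambda>x. prob_shift.average (?\<mu> k) v x - v x)) \<longlonglongrightarrow> 0"
    by (rule averages_tendsto[OF v ps, where \<delta> = "\<lambda>k. inverse (real (Suc k))"])
      (use norm_AE_ball_measure[of "0::'a"] in \<open>auto simp del: of_nat_Suc intro: LIMSEQ_inverse_real_of_nat\<close>)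
  from L2_tendsto_AE_subseq[OF prob_shift.average_L2(1)[OF ps v] v this]
  obtain s :: "nat \<Rightarrow> nat" where s: "strict_mono s"
    "AE x in lborel. (\<lambda>k. prob_shift.average (?\<mu> (s k)) v x) \<longlonglongrightarrow> v x" by blast
  from s(2) show ?thesis
  proof eventually_elim
    case (elim x)
    show ?case
    proof
      assume "x \<in> U"
      \<comment> \<open>Once the radius is below \<open>e\<close>, the means at \<open>x\<close> are
        0; their limit is \<open>v x\<close>.\<close>
      then obtain e where e: "e > 0" "cball x e \<subseteq> U" using U open_contains_cball by blast
      have "\<forall>\<^sub>F k in sequentially. inverse (real (Suc k)) < e"
        using order_tendstoD(2)[OF LIMSEQ_inverse_real_of_nat e(1)] .
      then have "\<forall>\<^sub>F k in sequentially. inverse (real (Suc (s k))) < e"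
        by (rule eventually_subseq[OF s(1)])
      then have "\<forall>\<^sub>F k in sequentially. prob_shift.average (?\<mu> (s k)) v x = 0"
      proof eventually_elim
        case (elim k)
        show ?case
        proof (rule avg0)
          show "cball x (inverse (real (Suc (s k)))) \<subseteq> U"
            using elim e(2) subset_cball[of "inverse (real (Suc (s k)))" e x] by auto
        qed simp
      qed
      then have "(\<lambda>k. prob_shift.average (?\<mu> (s k)) v x) \<longlonglongrightarrow> 0" by (rule tendsto_eventually)
      with elim show "v x = 0" using LIMSEQ_unique by blast
    qed
  qed
qed

text \<open>Each component of the difference is orthogonal to all test functions. Off \<Omega> both
  gradients are 0 by convention, so the equality holds almost everywhere in the whole space.\<close>

lemma sobolev_gradient_unique:
  assumes O: "open \<Omega>" and 1: "sobolev \<Omega> u g" and 2: "sobolev \<Omega> v h" and eq: "AE x in lborel. u x = v x"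
  shows "AE x in lborel. g x = h x"
proof -
  have "AE x in lborel. g x \<bullet> b - h x \<bullet> b = 0" for b
  proof -
    have "AE x in lborel. x \<in> \<Omega> \<longrightarrow> g x \<bullet> b - h x \<bullet> b = 0"
    proof (rule fundamental_lemma[OF _ O])
      show "square_integrable lborel (\<lambda>x. g x \<bullet> b - h x \<bullet> b)"
        using sobolev_gradient_square_integrable[OF 1] sobolev_gradient_square_integrable[OF 2]
        by (rule square_integrable_diff)
      fix \<phi> assume \<phi>: "\<phi> \<in> test_functions \<Omega>"
      note si = sobolev_gradient_square_integrable[OF 1] sobolev_gradient_square_integrable[OF 2]
        test_functions_square_integrable[OF \<phi>]
      note m = si(4)[THEN square_integrable_measurable] sobolevD(4)[OF 1] sobolevD(4)[OF 2]
      have "(LINT x|lborel. u x * frechet_derivative \<phi> (at x) b) = (LINT x|lborel. v x * frechet_derivative \<phi> (at x) b)"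
      proof (rule integral_cong_AE)
        show "AE x in lborel. u x * frechet_derivative \<phi> (at x) b = v x * frechet_derivative \<phi> (at x) b"
          using eq by eventually_elim simp
      qed (intro borel_measurable_times; use m in simp)+
      moreover have "(LINT x|lborel. (g x \<bullet> b - h x \<bullet> b) * \<phi> x) =
          (LINT x|lborel. (g x \<bullet> b) * \<phi> x) - (LINT x|lborel. (h x \<bullet> b) * \<phi> x)"
        unfolding left_diff_distrib
        by (rule Bochner_Integration.integral_diff) (intro square_integrable_mult_integrable si)+
      ultimately show "(LINT x|lborel. (g x \<bullet> b - h x \<bullet> b) * \<phi> x) = 0"
        using sobolev_integration_by_parts[OF 1 \<phi>, of b] sobolev_integration_by_parts[OF 2 \<phi>, of b]
        by linarith
    qed
    then show ?thesis
    proof eventually_elim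
      case (elim x)
      then show ?case
        using sobolevD(3)[OF 1, of x] sobolevD(3)[OF 2, of x] by (cases "x \<in> \<Omega>") simp_all
    qed
  qed
  then have "AE x in lborel. \<forall>b\<in>Basis. g x \<bullet> b - h x \<bullet> b = 0"
    by (subst AE_ball_countable) (auto intro: countable_finite)
  then show ?thesis
  proof eventually_elim
    case (elim x)
    show ?case by (rule euclidean_eqI) (use elim in simp)
  qed
qed

lemma test_functions_translate:
  assumes \<phi>: "\<phi> \<in> test_functions U" and sub: "\<And>x. x \<in> U \<Longrightarrow> x - y \<in> \<Omega>"
  shows "(\<lambda>x. \<phi> (x + y)) \<in> test_functions \<Omega>"
proof -
  obtain K where K: "smooth \<phi>" "compact K" "K \<subseteq> U" "\<And>x. x \<notin> K \<Longrightarrow> \<phi> x = 0"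
    "\<And>x z. x \<notin> K \<Longrightarrow> frechet_derivative \<phi> (at x) z = 0"
    using test_functionsE[OF \<phi>] by blast
  show ?thesis
  proof (rule test_functionsI)
    show "smooth (\<lambda>x. \<phi> (x + y))" using K(1) k_times_cont_diff_translate by blast
    show "compact ((\<lambda>x. x - y) ` K)"
      using compact_translation[OF K(2), of "- y"] by (simp add: add.commute[of "-y"])
    show "(\<lambda>x. x - y) ` K \<subseteq> \<Omega>" using K(3) sub by auto
    fix x assume "x \<notin> (\<lambda>x. x - y) ` K"
    then have "x + y \<notin> K" by (metis add_diff_cancel_right' image_eqI)
    then show "\<phi> (x + y) = 0" by (rule K(4))
  qed
qed

lemma integral_segment_measure:
  fixes F :: "'a::euclidean_space \<Rightarrow> real"
  assumes [measurable]: "F \<in> borel_measurable borel"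
  shows "(LINT y|segment_measure z. F y) = (LINT s|restrict_space lborel {0..1}. F (s *\<^sub>R z))"
proof -
  have [measurable]: "(\<lambda>s. s *\<^sub>R z) \<in> restrict_space lborel {0..1::real} \<rightarrow>\<^sub>M borel"
    by (intro measurable_restrict_space1) auto
  show ?thesis unfolding segment_measure_def by (rule integral_distr) auto
qed

text \<open>A weak fundamental theorem of calculus. The increment is moved onto the test function,
  where the smooth version applies; the resulting derivative is moved back by integration by parts
  under the average. The hypothesis on \<open>U\<close> keeps all the shifted test functions
  supported in \<Omega>.\<close>

lemma sobolev_difference:
  assumes s: "sobolev \<Omega> u g" and U: "open U"
    and sub: "\<And>x t. x \<in> U \<Longrightarrow> t \<in> {0..1} \<Longrightarrow> x + t *\<^sub>R z \<in> \<Omega>"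
  shows "AE x in lborel. x \<in> U \<longrightarrow>
    u (x + z) - u x = prob_shift.average (segment_measure z) (\<lambda>y. g y \<bullet> z) x"
proof -
  interpret P: prob_shift "segment_measure z" by (rule prob_shift_segment)
  interpret N: prob_shift "segment_measure (- z)" by (rule prob_shift_segment)
  note um[measurable] = sobolevD(4)[OF s] and gm[measurable] = sobolev_gradient_measurable[OF s]
  note su = sobolevD(1)[OF s] and sg = sobolev_gradient_square_integrable[OF s, of z]
  have "AE x in lborel. x \<in> U \<longrightarrow> (u (x + z) - u x) - P.average (\<lambda>y. g y \<bullet> z) x = 0"
  proof (rule fundamental_lemma[OF _ U])
    show si: "square_integrable lborel (\<lambda>x. (u (x + z) - u x) - P.average (\<lambda>y. g y \<bullet> z) x)"
      using su P.average_L2(1)[OF sg] by (auto intro!: square_integrable_diff)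
    fix \<phi> assume \<phi>: "\<phi> \<in> test_functions U"
    note s\<phi> = test_functions_square_integrable[OF \<phi>]
    have [measurable]: "\<phi> \<in> borel_measurable borel"
      using s\<phi>(1) by (auto dest: square_integrable_measurable)
    note sm = test_functions_smooth[OF \<phi>]
    let ?F = "\<lambda>y. LINT x|lborel. g (x + y) \<bullet> z * \<phi> x"
    have Fm: "?F \<in> borel_measurable borel" by measurable
    have "(LINT x|lborel. (u (x + z) - u x) * \<phi> x) = (LINT x|lborel. u (x + z) * \<phi> x) - (LINT x|lborel. u x * \<phi> x)"
      using su s\<phi> square_integrable_translate[OF su, of z] by (simp add: left_diff_distrib square_integrable_mult_integrable)
    also have "(LINT x|lborel. u (x + z) * \<phi> x) = (LINT x|lborel. u (x + z) * \<phi> ((x + z) - z))" by simp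
    also have "\<dots> = (LINT x|lborel. u x * \<phi> (x - z))"
      by (rule integral_translate) measurable
    also have "\<dots> - (LINT x|lborel. u x * \<phi> x) = (LINT x|lborel. u x * (\<phi> (x + - z) - \<phi> x))"
      using su s\<phi> square_integrable_translate[OF s\<phi>(1), of "- z"] by (simp add: right_diff_distrib square_integrable_mult_integrable)
    also have "\<dots> = (LINT x|lborel. N.average (\<lambda>y. frechet_derivative \<phi> (at y) (- z)) x * u x)"
      unfolding smooth_difference_eq_average[OF sm] by (simp add: mult.commute)
    also have "\<dots> = (LINT y|segment_measure (- z). LINT x|lborel. frechet_derivative \<phi> (at (x + y)) (- z) * u x)"
      by (rule N.integral_average_mult[OF s\<phi>(2) su])
    also have "\<dots> = (LINT y|segment_measure (- z). ?F (- y))"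
    proof (rule integral_cong_AE)
      have [measurable]: "(\<lambda>x. frechet_derivative \<phi> (at x) (- z)) \<in> borel_measurable borel"
        using s\<phi>(2)[of "-z"] by (auto dest: square_integrable_measurable)
      show "(\<lambda>y. LINT x|lborel. frechet_derivative \<phi> (at (x + y)) (- z) * u x) \<in> borel_measurable (segment_measure (- z))"
        by measurable
      show "(\<lambda>y. ?F (- y)) \<in> borel_measurable (segment_measure (- z))"
        by measurable
      show "AE y in segment_measure (- z). (LINT x|lborel. frechet_derivative \<phi> (at (x + y)) (- z) * u x) = ?F (- y)"
        using AE_segment_measure[of "- z"]
      proof eventually_elim
        case (elim y)
        then obtain t where t: "t \<in> {0..1}" "y = - (t *\<^sub>R z)" by auto
        \<comment> \<open>Composing with the shift by \<open>y = - (t *\<^sub>R z)\<close> moves the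
          support of \<phi> by \<open>t *\<^sub>R z\<close>, which stays in \<Omega> by the
          hypothesis on \<open>U\<close>.\<close>
        have \<phi>y: "(\<lambda>x. \<phi> (x + y)) \<in> test_functions \<Omega>"
          using sub[OF _ t(1)] t(2) by (intro test_functions_translate[OF \<phi>]) auto
        have "(LINT x|lborel. frechet_derivative \<phi> (at (x + y)) (- z) * u x) =
            (LINT x|lborel. u x * frechet_derivative (\<lambda>x. \<phi> (x + y)) (at x) (- z))"
          by (simp add: frechet_derivative_translate[OF sm] mult.commute)
        also have "\<dots> = (LINT x|lborel. (g x \<bullet> z) * \<phi> (x + y))"
          using sobolev_integration_by_parts[OF s \<phi>y, of "- z"] by simp
        also have "\<dots> = (LINT x|lborel. (g (x + - y) \<bullet> z) * \<phi> (x + - y + y))"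
          using integral_translate[of "\<lambda>x. (g x \<bullet> z) * \<phi> (x + y)" "- y"] by simp
        finally show ?case by simp
      qed
    qed
    \<comment> \<open>Reflection carries the segment towards \<open>- z\<close> to the one towards
      \<open>z\<close>; passing through the parameter \<open>t\<close> makes this visible.\<close>
    also have "\<dots> = (LINT t|restrict_space lborel {0..1}. ?F (- (t *\<^sub>R (- z))))"
      by (rule integral_segment_measure[of "\<lambda>y. ?F (- y)"]) measurable
    also have "\<dots> = (LINT t|restrict_space lborel {0..1}. ?F (t *\<^sub>R z))" by simp
    also have "\<dots> = (LINT y|segment_measure z. ?F y)"
      by (rule integral_segment_measure[OF Fm, symmetric])
    also have "\<dots> = (LINT x|lborel. P.average (\<lambda>y. g y \<bullet> z) x * \<phi> x)"
      by (rule P.integral_average_mult[OF sg s\<phi>(1), symmetric])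
    finally show "(LINT x|lborel. (u (x + z) - u x - P.average (\<lambda>y. g y \<bullet> z) x) * \<phi> x) = 0"
      using su s\<phi> P.average_L2(1)[OF sg] square_integrable_translate[OF su, of z]
      by (subst left_diff_distrib) (simp add: square_integrable_mult_integrable square_integrable_diff)
  qed
  then show ?thesis by eventually_elim auto
qed

subsection \<open>Chain rule and product rule\<close>

text \<open>A difference quotient argument. The increment of \<open>u\<close> over a step
  \<open>h\<close> is \<open>h\<close> times a segment average \<open>a\<close> of the directional
  derivative. Since \<Phi>' is Lipschitz, the increment of \<Phi>(u) equals \<Phi>'(u) times that of
  \<open>u\<close> up to \<open>L * (h * a)^2\<close>. Divided by \<open>h\<close>, this error is of
  order \<open>h\<close> in L^1, because the averages are bounded in L^2.\<close>

lemma sobolev_chain_rule: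
  fixes \<Phi> \<Phi>' :: "real \<Rightarrow> real"
  assumes s: "sobolev \<Omega> u g" and O: "open \<Omega>" and \<Phi>0: "\<Phi> 0 = 0"
    and der: "\<And>t. (\<Phi> has_real_derivative \<Phi>' t) (at t)"
    and M: "\<And>t. \<bar>\<Phi>' t\<bar> \<le> M" and L: "\<And>s t. \<bar>\<Phi>' s - \<Phi>' t\<bar> \<le> L * \<bar>s - t\<bar>"
  shows "sobolev \<Omega> (\<lambda>x. \<Phi> (u x)) (\<lambda>x. \<Phi>' (u x) *\<^sub>R g x)"
proof -
  note um[measurable] = sobolevD(4)[OF s] and gm[measurable] = sobolev_gradient_measurable[OF s]
  note su = sobolevD(1)[OF s] and sg = sobolev_gradient_square_integrable[OF s]
  have Lnn: "L \<ge> 0" using L[of 1 0] abs_ge_zero[of "\<Phi>' 1 - \<Phi>' 0"] by simp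
  have "continuous_on UNIV \<Phi>" using der by (meson DERIV_isCont continuous_at_imp_continuous_on)
  then have [measurable]: "\<Phi> \<in> borel_measurable borel" by (rule borel_measurable_continuous_onI)
  have "L-lipschitz_on UNIV \<Phi>'"
    using L Lnn by (intro lipschitz_onI) (auto simp: dist_real_def)
  then have "continuous_on UNIV \<Phi>'" by (rule lipschitz_on_continuous_on)
  then have [measurable]: "\<Phi>' \<in> borel_measurable borel" by (rule borel_measurable_continuous_onI)
  have bd: "\<bar>\<Phi> t\<bar> \<le> \<bar>M * t\<bar>" for t
  proof -
    have "norm (\<Phi> t - \<Phi> 0) \<le> M * norm (t - 0)"
      by (rule field_differentiable_bound[of UNIV \<Phi> \<Phi>']) (simp_all add: der M)
    also have "\<dots> \<le> \<bar>M\<bar> * \<bar>t\<bar>" by (simp add: mult_right_mono)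
    finally show ?thesis by (simp add: \<Phi>0 abs_mult)
  qed
  \<comment> \<open>The mean value inequality for \<open>\<Phi> t - \<Phi>' c * t\<close>, whose
    derivative is at most \<open>L * \<bar>a - c\<bar>\<close> on the ball around \<open>c\<close>
    that reaches \<open>a\<close>.\<close>
  have taylor: "\<bar>\<Phi> a - \<Phi> c - \<Phi>' c * (a - c)\<bar> \<le> L * (a - c)\<^sup>2" for a c
  proof -
    have "norm ((\<Phi> a - \<Phi>' c * a) - (\<Phi> c - \<Phi>' c * c)) \<le> (L * \<bar>a - c\<bar>) * norm (a - c)"
    proof (rule field_differentiable_bound[of "cball c \<bar>a - c\<bar>" _ "\<lambda>t. \<Phi>' t - \<Phi>' c"])
      fix t assume t: "t \<in> cball c \<bar>a - c\<bar>"
      show "((\<lambda>t. \<Phi> t - \<Phi>' c * t) has_field_derivative \<Phi>' t - \<Phi>' c) (at t within cball c \<bar>a - c\<bar>)"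
        by (rule has_field_derivative_at_within) (intro DERIV_diff der DERIV_cmult_Id)
      have "L * \<bar>t - c\<bar> \<le> L * \<bar>a - c\<bar>"
        using t Lnn by (intro mult_left_mono) (auto simp: dist_real_def)
      then show "norm (\<Phi>' t - \<Phi>' c) \<le> L * \<bar>a - c\<bar>" using L[of t c] unfolding real_norm_def by linarith
    qed (auto simp: dist_real_def)
    also have "(\<Phi> a - \<Phi>' c * a) - (\<Phi> c - \<Phi>' c * c) = \<Phi> a - \<Phi> c - \<Phi>' c * (a - c)"
      by (simp add: right_diff_distrib)
    also have "L * \<bar>a - c\<bar> * norm (a - c) = L * (a - c)\<^sup>2"
      by (simp add: power2_eq_square)
    finally show ?thesis by simp
  qed
  have s\<Phi>: "square_integrable lborel (\<lambda>x. \<Phi> (u x))"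
  proof (rule square_integrable_bound[OF square_integrable_integrable[OF square_integrable_cmult[OF su, of M]]])
    show "(\<lambda>x. \<Phi> (u x)) \<in> borel_measurable lborel" by measurable
    show "AE x in lborel. (\<Phi> (u x))\<^sup>2 \<le> (M * u x)\<^sup>2"
      using bd by (intro always_eventually allI) (simp only: abs_le_square_iff)
  qed
  have s\<Phi>g: "square_integrable lborel (\<lambda>x. \<Phi>' (u x) * (g x \<bullet> b))" for b
    by (rule square_integrable_bounded_mult[OF sg]) (use M in auto)
  show ?thesis
    unfolding sobolev_def
  proof (intro conjI ballI allI)
    fix \<phi> b assume \<phi>: "\<phi> \<in> test_functions \<Omega>" and b: "b \<in> (Basis :: 'a set)"
    note s\<phi> = test_functions_square_integrable[OF \<phi>]
    note sm = test_functions_smooth[OF \<phi>]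
    have [measurable]: "\<phi> \<in> borel_measurable borel"
      using s\<phi>(1) by (auto dest: square_integrable_measurable)
    obtain K where K: "smooth \<phi>" "compact K" "K \<subseteq> \<Omega>" "\<And>x. x \<notin> K \<Longrightarrow> \<phi> x = 0"
      "\<And>x z. x \<notin> K \<Longrightarrow> frechet_derivative \<phi> (at x) z = 0"
      using test_functionsE[OF \<phi>] by blast
    obtain B where B: "B > 0" "\<And>x. \<bar>\<phi> x\<bar> \<le> B"
      using test_functions_bounded[OF \<phi>] by blast
    obtain e where e: "e > 0" "(\<Union>x\<in>K. ball x e) \<subseteq> \<Omega>"
      using compact_subset_open_imp_ball_epsilon_subset[OF K(2) O K(3)] .
    \<comment> \<open>A step of length at most \<open>e / 2\<close> from the
      \<open>e / 2\<close>-neighbourhood of the support stays in the \<open>e\<close>-neighbourhood,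
      hence in \<Omega>. This explains the factor \<open>e / 2\<close> in \<open>h\<close>.\<close>
    define U where "U = (\<Union>x\<in>K. ball x (e / 2))"
    have U: "open U" "K \<subseteq> U" using e(1) by (auto simp: U_def)
    define h where "h n = e / 2 * inverse (real (Suc n))" for n
    have h0: "h n > 0" for n using e(1) by (simp add: h_def)
    have hle: "h n \<le> e / 2" for n
      using mult_left_mono[of "inverse (real (Suc n))" 1 "e/2"] e(1) by (simp add: h_def inverse_le_1_iff)
    have hlim: "h \<longlonglongrightarrow> 0"
      unfolding h_def by (rule tendsto_mult_right_zero[OF LIMSEQ_inverse_real_of_nat])
    \<comment> \<open>On \<open>U\<close> this is the difference quotient of \<open>u\<close> in
      direction \<open>b\<close>; unlike the quotient, it is controlled in L^2 on the whole
      space.\<close>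
    define a where "a n = prob_shift.average (segment_measure (h n *\<^sub>R b)) (\<lambda>y. g y \<bullet> b)" for n
    have sa: "square_integrable lborel (a n)" and sqa: "sq_integral lborel (a n) \<le> sq_integral lborel (\<lambda>x. g x \<bullet> b)" for n
      unfolding a_def using prob_shift.average_L2[OF prob_shift_segment sg] by auto
    have am[measurable]: "a n \<in> borel_measurable borel" for n
      using sa[of n] by (auto dest: square_integrable_measurable)
    have normh: "AE z in segment_measure (h n *\<^sub>R c). norm z \<le> h n" if "norm c = 1" for n c
      using norm_AE_segment_measure[of "h n *\<^sub>R c"] h0[of n] that by simp
    have a_lim: "(\<lambda>n. sq_integral lborel (\<lambda>x. a n x - g x \<bullet> b)) \<longlonglongrightarrow> 0"
      unfolding a_def using normh[of b] b hlim by (intro averages_tendsto[OF sg prob_shift_segment]) auto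
    have diff_eq: "AE x in lborel. x \<in> U \<longrightarrow> u (x + h n *\<^sub>R b) - u x = h n * a n x" for n
    proof -
      have "AE x in lborel. x \<in> U \<longrightarrow> u (x + h n *\<^sub>R b) - u x =
          prob_shift.average (segment_measure (h n *\<^sub>R b)) (\<lambda>y. g y \<bullet> (h n *\<^sub>R b)) x"
      proof (rule sobolev_difference[OF s U(1)])
        fix x and t :: real assume x: "x \<in> U" and t: "t \<in> {0..1}"
        then obtain y where y: "y \<in> K" "dist y x < e / 2" by (auto simp: U_def)
        have "norm (t *\<^sub>R h n *\<^sub>R b) \<le> h n"
          using t b h0[of n] by (simp add: mult_left_le_one_le)
        then have "dist y (x + t *\<^sub>R h n *\<^sub>R b) < e"
          using y(2) hle[of n] norm_triangle_ineq4[of "y - x" "t *\<^sub>R h n *\<^sub>R b"]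
          by (simp add: dist_norm diff_diff_eq)
        then show "x + t *\<^sub>R h n *\<^sub>R b \<in> \<Omega>" using e(2) y(1) by (meson UN_I mem_ball subsetD)
      qed
      moreover have "prob_shift.average (segment_measure (h n *\<^sub>R b)) (\<lambda>y. g y \<bullet> (h n *\<^sub>R b)) x = h n * a n x" for x
        by (simp add: a_def prob_shift.average_def[OF prob_shift_segment])
      ultimately show ?thesis by simp
    qed
    \<comment> \<open>This quantity is evaluated twice: its direct limit is the pairing of \<Phi>(u)
      with the derivative of \<phi>, while a translation of the variable turns it into a pairing of
      the difference quotient of \<Phi>(u) with \<phi>.\<close>
    define A where "A n = (LINT x|lborel. (\<phi> (x - h n *\<^sub>R b) - \<phi> x) / h n * \<Phi> (u x))" for n
    have lim1: "A \<longlonglongrightarrow> (LINT x|lborel. frechet_derivative \<phi> (at x) (- b) * \<Phi> (u x))"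
    proof -
      have q: "(\<phi> (x - h n *\<^sub>R b) - \<phi> x) / h n =
          prob_shift.average (segment_measure (h n *\<^sub>R (- b))) (\<lambda>y. frechet_derivative \<phi> (at y) (- b)) x" for n x
        using smooth_difference_eq_average[OF sm, of x "h n *\<^sub>R (- b)"] h0[of n]
        by (simp add: prob_shift.average_def[OF prob_shift_segment] frechet_derivative_scaleR[OF sm] field_simps del: scaleR_minus_right)
          simp
      show ?thesis
        unfolding A_def q
      proof (rule tendsto_integral_mult_L2[OF _ s\<phi>(2) _ s\<Phi>])
        show "square_integrable lborel (prob_shift.average (segment_measure (h n *\<^sub>R - b)) (\<lambda>y. frechet_derivative \<phi> (at y) (- b)))" for n
          by (rule prob_shift.average_L2(1)[OF prob_shift_segment s\<phi>(2)])
        show "(\<lambda>n. sq_integral lborel (\<lambda>x. prob_shift.average (segment_measure (h n *\<^sub>R - b)) (\<lambda>y. frechet_derivative \<phi> (at y) (- b)) x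
            - frechet_derivative \<phi> (at x) (- b))) \<longlonglongrightarrow> 0"
          using normh[of "- b"] b hlim by (intro averages_tendsto[OF s\<phi>(2) prob_shift_segment]) auto
      qed
    qed
    have lim2: "(\<lambda>n. LINT x|lborel. a n x * (\<Phi>' (u x) * \<phi> x)) \<longlonglongrightarrow> (LINT x|lborel. (g x \<bullet> b) * (\<Phi>' (u x) * \<phi> x))"
      using M by (intro tendsto_integral_mult_L2[OF sa sg a_lim] square_integrable_bounded_mult[OF s\<phi>(1)]) auto
    have close: "\<bar>A n - (LINT x|lborel. a n x * (\<Phi>' (u x) * \<phi> x))\<bar> \<le> L * B * sq_integral lborel (\<lambda>x. g x \<bullet> b) * h n" for n
    proof -
      have s1: "square_integrable lborel (\<lambda>x. \<Phi> (u (x + h n *\<^sub>R b)))"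
        by (rule square_integrable_translate[OF s\<Phi>])
      have s2: "square_integrable lborel (\<lambda>x. \<Phi>' (u x) * \<phi> x)"
        using M by (intro square_integrable_bounded_mult[OF s\<phi>(1)]) auto
      have i1: "integrable lborel (\<lambda>x. (\<Phi> (u (x + h n *\<^sub>R b)) - \<Phi> (u x)) / h n * \<phi> x)"
        using square_integrable_mult_integrable[OF square_integrable_diff[OF s1 s\<Phi>] s\<phi>(1)] by simp
      have i2: "integrable lborel (\<lambda>x. a n x * (\<Phi>' (u x) * \<phi> x))"
        by (rule square_integrable_mult_integrable[OF sa s2])
      have "A n = (LINT x|lborel. \<phi> (x - h n *\<^sub>R b) * \<Phi> (u x) / h n - \<phi> x * \<Phi> (u x) / h n)"
        unfolding A_def by (simp add: diff_divide_distrib left_diff_distrib)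
      also have "\<dots> = (LINT x|lborel. \<phi> (x - h n *\<^sub>R b) * \<Phi> (u x) / h n) - (LINT x|lborel. \<phi> x * \<Phi> (u x) / h n)"
        using square_integrable_mult_integrable[OF s\<phi>(1) s\<Phi>]
          square_integrable_mult_integrable[OF square_integrable_translate[OF s\<phi>(1), of "- (h n *\<^sub>R b)"] s\<Phi>]
        by (intro Bochner_Integration.integral_diff) auto
      also have "(LINT x|lborel. \<phi> (x - h n *\<^sub>R b) * \<Phi> (u x) / h n) = (LINT x|lborel. \<phi> x * \<Phi> (u (x + h n *\<^sub>R b)) / h n)"
        using integral_translate[of "\<lambda>x. \<phi> (x - h n *\<^sub>R b) * \<Phi> (u x) / h n" "h n *\<^sub>R b", symmetric]
        by simp
      also have "\<dots> - (LINT x|lborel. \<phi> x * \<Phi> (u x) / h n) =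
          (LINT x|lborel. \<phi> x * \<Phi> (u (x + h n *\<^sub>R b)) / h n - \<phi> x * \<Phi> (u x) / h n)"
        using square_integrable_mult_integrable[OF s\<phi>(1) s\<Phi>] square_integrable_mult_integrable[OF s\<phi>(1) s1]
        by (intro Bochner_Integration.integral_diff[symmetric]) auto
      also have "\<dots> = (LINT x|lborel. (\<Phi> (u (x + h n *\<^sub>R b)) - \<Phi> (u x)) / h n * \<phi> x)"
        by (simp add: diff_divide_distrib left_diff_distrib right_diff_distrib mult.commute)
      finally have A: "A n = (LINT x|lborel. (\<Phi> (u (x + h n *\<^sub>R b)) - \<Phi> (u x)) / h n * \<phi> x)" .
      have "\<bar>A n - (LINT x|lborel. a n x * (\<Phi>' (u x) * \<phi> x))\<bar> =
          \<bar>LINT x|lborel. (\<Phi> (u (x + h n *\<^sub>R b)) - \<Phi> (u x)) / h n * \<phi> x - a n x * (\<Phi>' (u x) * \<phi> x)\<bar>"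
        unfolding A by (simp only: Bochner_Integration.integral_diff[OF i1 i2])
      also have "\<dots> \<le> (LINT x|lborel. \<bar>(\<Phi> (u (x + h n *\<^sub>R b)) - \<Phi> (u x)) / h n * \<phi> x - a n x * (\<Phi>' (u x) * \<phi> x)\<bar>)"
        by (rule integral_abs_bound)
      also have "\<dots> \<le> (LINT x|lborel. L * B * h n * (a n x)\<^sup>2)"
      proof (rule integral_mono_AE)
        show "integrable lborel (\<lambda>x. \<bar>(\<Phi> (u (x + h n *\<^sub>R b)) - \<Phi> (u x)) / h n * \<phi> x - a n x * (\<Phi>' (u x) * \<phi> x)\<bar>)"
          using i1 i2 by (intro integrable_abs Bochner_Integration.integrable_diff)
        show "integrable lborel (\<lambda>x. L * B * h n * (a n x)\<^sup>2)"
          using sa[of n] by (simp add: square_integrable_def)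
        show "AE x in lborel. \<bar>(\<Phi> (u (x + h n *\<^sub>R b)) - \<Phi> (u x)) / h n * \<phi> x - a n x * (\<Phi>' (u x) * \<phi> x)\<bar>
            \<le> L * B * h n * (a n x)\<^sup>2"
          using diff_eq[of n]
        proof eventually_elim
          case (elim x)
          show ?case
          proof (cases "x \<in> U")
            case False
            then have "\<phi> x = 0" using K(4) U(2) by blast
            then show ?thesis using Lnn B(1) h0[of n] by simp
          next
            case True
            define D where "D = u (x + h n *\<^sub>R b) - u x"
            have D: "D = h n * a n x" using elim True by (simp add: D_def)
            \<comment> \<open>The remainder is quadratic in \<open>D\<close>, and \<open>D\<close>
              is \<open>h n * a n x\<close>; dividing by \<open>h n\<close> leaves one factor
              \<open>h n\<close>, which makes the error vanish in the limit.\<close>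
            define R where "R = \<Phi> (u (x + h n *\<^sub>R b)) - \<Phi> (u x) - \<Phi>' (u x) * D"
            have R: "\<bar>R\<bar> \<le> L * D\<^sup>2" using taylor[of "u (x + h n *\<^sub>R b)" "u x"] by (simp add: R_def D_def)
            have "(\<Phi> (u (x + h n *\<^sub>R b)) - \<Phi> (u x)) / h n * \<phi> x - a n x * (\<Phi>' (u x) * \<phi> x) = R / h n * \<phi> x"
              using h0[of n] unfolding R_def D by (simp add: field_simps)
            also have "\<bar>\<dots>\<bar> = \<bar>R\<bar> / h n * \<bar>\<phi> x\<bar>" using h0[of n] by (simp add: abs_mult)
            also have "\<dots> \<le> (L * D\<^sup>2) / h n * B"
              using R B h0[of n] Lnn by (intro mult_mono divide_right_mono) auto
            also have "\<dots> = L * B * h n * (a n x)\<^sup>2"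
              using h0[of n] by (simp add: D power2_eq_square field_simps)
            finally show ?thesis .
          qed
        qed
      qed
      also have "\<dots> = L * B * h n * sq_integral lborel (a n)" by (simp add: sq_integral_def)
      also have "\<dots> \<le> L * B * h n * sq_integral lborel (\<lambda>x. g x \<bullet> b)"
        using sqa[of n] Lnn B(1) h0[of n] by (intro mult_left_mono) auto
      finally show ?thesis by (simp add: mult_ac)
    qed
    have "(\<lambda>n. A n - (LINT x|lborel. a n x * (\<Phi>' (u x) * \<phi> x))) \<longlonglongrightarrow> 0"
      by (rule Lim_null_comparison[OF always_eventually tendsto_mult_right_zero[OF hlim, of "L * B * sq_integral lborel (\<lambda>x. g x \<bullet> b)"]])
        (use close in simp)
    moreover have "(\<lambda>n. A n - (LINT x|lborel. a n x * (\<Phi>' (u x) * \<phi> x))) \<longlonglongrightarrow>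
        (LINT x|lborel. frechet_derivative \<phi> (at x) (- b) * \<Phi> (u x)) - (LINT x|lborel. (g x \<bullet> b) * (\<Phi>' (u x) * \<phi> x))"
      by (intro tendsto_diff lim1 lim2)
    ultimately have "(LINT x|lborel. frechet_derivative \<phi> (at x) (- b) * \<Phi> (u x)) = (LINT x|lborel. (g x \<bullet> b) * (\<Phi>' (u x) * \<phi> x))"
      using LIMSEQ_unique by fastforce
    moreover have "frechet_derivative \<phi> (at x) (- b) = - frechet_derivative \<phi> (at x) b" for x
      using frechet_derivative_scaleR[OF sm, of x "-1" b] by simp
    ultimately show "(LINT x|lborel. \<Phi> (u x) * frechet_derivative \<phi> (at x) b) =
        - (LINT x|lborel. (\<Phi>' (u x) *\<^sub>R g x) \<bullet> b * \<phi> x)"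
      by (simp add: mult_ac)
  next
    fix x
    show "x \<notin> \<Omega> \<longrightarrow> \<Phi> (u x) = 0 \<and> \<Phi>' (u x) *\<^sub>R g x = 0"
      using sobolevD(2,3)[OF s, of x] \<Phi>0 by simp
  qed (use s\<Phi> s\<Phi>g in auto)
qed

text \<open>The product of \<psi> with a test function is again a test function; the part of its
  derivative that falls on \<psi> becomes the second term of the gradient.\<close>

lemma sobolev_smooth_mult:
  assumes s: "sobolev \<Omega> u g" and bO: "bounded \<Omega>" and \<psi>: "smooth \<psi>"
  shows "sobolev \<Omega> (\<lambda>x. \<psi> x * u x)
    (\<lambda>x. \<psi> x *\<^sub>R g x + u x *\<^sub>R (\<Sum>b\<in>Basis. frechet_derivative \<psi> (at x) b *\<^sub>R b))"
proof -
  note um[measurable] = sobolevD(4)[OF s]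
  note su = sobolevD(1)[OF s] and sg = sobolev_gradient_square_integrable[OF s]
  have cO: "compact (closure \<Omega>)" using bO by (simp add: compact_closure)
  have mult: "square_integrable lborel (\<lambda>x. f x * v x)"
    if f: "continuous_on UNIV f" and v: "square_integrable lborel v" "\<And>x. x \<notin> \<Omega> \<Longrightarrow> v x = 0" for f v :: "'a \<Rightarrow> real"
  proof -
    have "bounded (f ` closure \<Omega>)"
      using f by (intro compact_imp_bounded compact_continuous_image cO) (auto intro: continuous_on_subset)
    then obtain B where B: "\<And>x. x \<in> closure \<Omega> \<Longrightarrow> \<bar>f x\<bar> \<le> B" by (auto simp: bounded_iff)
    have [measurable]: "f \<in> borel_measurable borel" using f by (rule borel_measurable_continuous_onI)
    \<comment> \<open>The factor \<open>f\<close> is bounded on the compact closure of \<Omega>, and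
      cutting it off there leaves the product unchanged because \<open>v\<close> vanishes outside
      \<Omega>.\<close>
    have eq: "(\<lambda>x. f x * v x) = (\<lambda>x. (indicator (closure \<Omega>) x * f x) * v x)"
      using v(2) closure_subset[of \<Omega>] by (intro ext) (auto simp: indicator_def)
    show ?thesis
      unfolding eq
    proof (rule square_integrable_bounded_mult[OF v(1)])
      have [measurable]: "closure \<Omega> \<in> sets borel" by simp
      show "(\<lambda>x. indicator (closure \<Omega>) x * f x) \<in> borel_measurable lborel" by measurable
      show "AE x in lborel. \<bar>indicator (closure \<Omega>) x * f x\<bar> \<le> max B 0"
        using B by (intro always_eventually) (auto simp: indicator_def le_max_iff_disj)
    qed
  qed
  note c\<psi> = smooth_continuous[OF \<psi>, of UNIV] and cD = continuous_frechet_derivative[OF \<psi>, of UNIV]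
  have grad: "(\<psi> x *\<^sub>R g x + u x *\<^sub>R (\<Sum>b\<in>Basis. frechet_derivative \<psi> (at x) b *\<^sub>R b)) \<bullet> b =
      \<psi> x * (g x \<bullet> b) + frechet_derivative \<psi> (at x) b * u x" if "b \<in> Basis" for x b
    using that by (simp add: inner_add_left)
  have u0: "u x = 0" and g0: "g x = 0" if "x \<notin> \<Omega>" for x using sobolevD(2,3)[OF s that] by auto
  have s1: "square_integrable lborel (\<lambda>x. \<psi> x * u x)" by (rule mult[OF c\<psi> su u0])
  have s2: "square_integrable lborel (\<lambda>x. \<psi> x * (g x \<bullet> b))" for b
    by (rule mult[OF c\<psi> sg]) (simp add: g0)
  have s3: "square_integrable lborel (\<lambda>x. frechet_derivative \<psi> (at x) b * u x)" for b
    by (rule mult[OF cD su u0])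
  show ?thesis
    unfolding sobolev_def
  proof (intro conjI ballI allI)
    fix \<phi> b assume \<phi>: "\<phi> \<in> test_functions \<Omega>" and b: "b \<in> (Basis :: 'a set)"
    note s\<phi> = test_functions_square_integrable[OF \<phi>]
    have "(LINT x|lborel. u x * frechet_derivative (\<lambda>x. \<psi> x * \<phi> x) (at x) b) = - (LINT x|lborel. (g x \<bullet> b) * (\<psi> x * \<phi> x))"
      by (rule sobolev_integration_by_parts[OF s test_functions_mult[OF \<psi> \<phi>]])
    moreover have "(LINT x|lborel. u x * frechet_derivative (\<lambda>x. \<psi> x * \<phi> x) (at x) b) =
        (LINT x|lborel. (\<psi> x * u x) * frechet_derivative \<phi> (at x) b + (frechet_derivative \<psi> (at x) b * u x) * \<phi> x)"
      unfolding frechet_derivative_smooth_mult[OF \<psi> test_functions_smooth[OF \<phi>]]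
      by (rule Bochner_Integration.integral_cong) (simp_all add: algebra_simps)
    moreover have "\<dots> = (LINT x|lborel. (\<psi> x * u x) * frechet_derivative \<phi> (at x) b) +
        (LINT x|lborel. (frechet_derivative \<psi> (at x) b * u x) * \<phi> x)"
      by (intro Bochner_Integration.integral_add square_integrable_mult_integrable s1 s3 s\<phi>)
    moreover have "(LINT x|lborel. (\<psi> x *\<^sub>R g x + u x *\<^sub>R (\<Sum>b\<in>Basis. frechet_derivative \<psi> (at x) b *\<^sub>R b)) \<bullet> b * \<phi> x) =
        (LINT x|lborel. (\<psi> x * (g x \<bullet> b)) * \<phi> x + (frechet_derivative \<psi> (at x) b * u x) * \<phi> x)"
      unfolding grad[OF b] by (rule Bochner_Integration.integral_cong) (simp_all add: algebra_simps)
    moreover have "\<dots> = (LINT x|lborel. (\<psi> x * (g x \<bullet> b)) * \<phi> x) + (LINT x|lborel. (frechet_derivative \<psi> (at x) b * u x) * \<phi> x)"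
      by (intro Bochner_Integration.integral_add square_integrable_mult_integrable s2 s3 s\<phi>)
    moreover have "(LINT x|lborel. (\<psi> x * (g x \<bullet> b)) * \<phi> x) = (LINT x|lborel. (g x \<bullet> b) * (\<psi> x * \<phi> x))"
      by (rule Bochner_Integration.integral_cong) (simp_all add: mult_ac)
    ultimately show "(LINT x|lborel. \<psi> x * u x * frechet_derivative \<phi> (at x) b) =
        - (LINT x|lborel. (\<psi> x *\<^sub>R g x + u x *\<^sub>R (\<Sum>b\<in>Basis. frechet_derivative \<psi> (at x) b *\<^sub>R b)) \<bullet> b * \<phi> x)"
      by linarith
  next
    fix b assume b: "b \<in> (Basis :: 'a set)"
    show "square_integrable lborel (\<lambda>x. (\<psi> x *\<^sub>R g x + u x *\<^sub>R (\<Sum>b\<in>Basis. frechet_derivative \<psi> (at x) b *\<^sub>R b)) \<bullet> b)"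
      unfolding grad[OF b] by (rule square_integrable_add[OF s2 s3])
  next
    fix x
    show "x \<notin> \<Omega> \<longrightarrow> \<psi> x * u x = 0 \<and> \<psi> x *\<^sub>R g x + u x *\<^sub>R (\<Sum>b\<in>Basis. frechet_derivative \<psi> (at x) b *\<^sub>R b) = 0"
      using u0[of x] g0[of x] by simp
  qed (rule s1)
qed

subsection \<open>Constants and functions with vanishing gradient\<close>

text \<open>The integral of \<open>\<phi> (x + z) - \<phi> x\<close> is 0 by translation invariance.
  It is also the average over the segment of integrals of translates of the derivative, and these
  all coincide, again by translation invariance.\<close>

lemma integral_test_function_derivative:
  fixes \<phi> :: "'a::euclidean_space \<Rightarrow> real"
  assumes \<phi>: "\<phi> \<in> test_functions \<Omega>"
  shows "(LINT x|lborel. frechet_derivative \<phi> (at x) z) = 0"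
proof -
  interpret prob_shift "segment_measure z" by (rule prob_shift_segment)
  note s\<phi> = test_functions_square_integrable[OF \<phi>]
  have [measurable]: "\<phi> \<in> borel_measurable borel" "(\<lambda>x. frechet_derivative \<phi> (at x) z) \<in> borel_measurable borel"
    using s\<phi>[THEN square_integrable_measurable] by auto
  obtain K where K: "smooth \<phi>" "compact K" "K \<subseteq> \<Omega>" "\<And>x. x \<notin> K \<Longrightarrow> \<phi> x = 0"
    "\<And>x z. x \<notin> K \<Longrightarrow> frechet_derivative \<phi> (at x) z = 0"
    using test_functionsE[OF \<phi>] by blast
  obtain N where N: "\<And>x. x \<in> K \<Longrightarrow> norm x \<le> N"
    using compact_imp_bounded[OF K(2)] by (auto simp: bounded_iff)
  \<comment> \<open>The pairing lemma needs a square-integrable partner in place of the constant 1.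
    This ball contains every translate of the support by at most \<open>norm z\<close>, so its
    indicator acts as 1.\<close>
  define C where "C = ball (0::'a) (N + norm z + 1)"
  have C: "x \<in> C" if "x + y \<in> K" "norm y \<le> norm z" for x y
    using N[OF that(1)] that(2) norm_triangle_sub[of x "- y"] by (simp add: C_def)
  have sC: "square_integrable lborel (indicator C :: 'a \<Rightarrow> real)"
    using emeasure_bounded_finite[of C] by (intro square_integrable_indicator) (auto simp: C_def)
  have \<phi>C: "\<phi> (x + y) * indicator C x = \<phi> (x + y)" if "norm y \<le> norm z" for x y
    using C[OF _ that, of x] K(4)[of "x + y"] by (auto simp: indicator_def)
  have DC: "frechet_derivative \<phi> (at (x + y)) z * indicator C x = frechet_derivative \<phi> (at (x + y)) z"
    if "norm y \<le> norm z" for x y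
    using C[OF _ that, of x] K(5)[of "x + y" z] by (auto simp: indicator_def)
  have "(LINT x|lborel. (\<phi> (x + z) - \<phi> x) * indicator C x) =
      (LINT x|lborel. \<phi> (x + z) * indicator C x) - (LINT x|lborel. \<phi> x * indicator C x)"
    unfolding left_diff_distrib
    by (intro Bochner_Integration.integral_diff square_integrable_mult_integrable sC s\<phi> square_integrable_translate)
  also have "\<dots> = (LINT x|lborel. \<phi> (x + z)) - (LINT x|lborel. \<phi> x)"
    using \<phi>C[of 0] by (simp only: \<phi>C[OF order_refl] add_0_right norm_zero norm_ge_zero)
  also have "\<dots> = 0" by (simp add: integral_translate)
  finally have "0 = (LINT x|lborel. (\<phi> (x + z) - \<phi> x) * indicator C x)" by simp
  also have "\<dots> = (LINT y|segment_measure z. LINT x|lborel. frechet_derivative \<phi> (at (x + y)) z * indicator C x)"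
    unfolding smooth_difference_eq_average[OF K(1)] by (rule integral_average_mult[OF s\<phi>(2) sC])
  also have "\<dots> = (LINT y|segment_measure z. LINT x|lborel. frechet_derivative \<phi> (at x) z)"
  proof (rule integral_cong_AE)
    have [measurable]: "C \<in> sets borel" by (simp add: C_def)
    show "(\<lambda>y. LINT x|lborel. frechet_derivative \<phi> (at (x + y)) z * indicator C x) \<in> borel_measurable (segment_measure z)"
      by measurable
    show "AE y in segment_measure z. (LINT x|lborel. frechet_derivative \<phi> (at (x + y)) z * indicator C x) =
        (LINT x|lborel. frechet_derivative \<phi> (at x) z)"
      using norm_AE_segment_measure[of z]
    proof eventually_elim
      case (elim y)
      show ?case unfolding DC[OF elim] by (rule integral_translate) measurable
    qed
  qed simp
  also have "\<dots> = (LINT x|lborel. frechet_derivative \<phi> (at x) z)" by (simp add: prob_space)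
  finally show ?thesis by simp
qed

text \<open>Puts constants into H^1 with zero gradient, so that a function that turns out to be
  constant can be compared with a continuous one at the level of traces.\<close>

lemma sobolev_const:
  assumes O: "open \<Omega>" "bounded \<Omega>"
  shows "sobolev \<Omega> (\<lambda>x. indicator \<Omega> x * c) (\<lambda>x. 0)"
  unfolding sobolev_def
proof (intro conjI ballI allI)
  have "square_integrable lborel (indicator \<Omega> :: 'a \<Rightarrow> real)"
    using emeasure_bounded_finite[OF O(2)] O(1) by (intro square_integrable_indicator) auto
  then show "square_integrable lborel (\<lambda>x. indicator \<Omega> x * c)"
    using square_integrable_cmult[of lborel "indicator \<Omega>" c] by (simp add: mult.commute)
  fix \<phi> b assume \<phi>: "\<phi> \<in> test_functions \<Omega>"
  obtain K where K: "smooth \<phi>" "compact K" "K \<subseteq> \<Omega>" "\<And>x. x \<notin> K \<Longrightarrow> \<phi> x = 0"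
    "\<And>x z. x \<notin> K \<Longrightarrow> frechet_derivative \<phi> (at x) z = 0"
    using test_functionsE[OF \<phi>] by blast
  have "indicator \<Omega> x * c * frechet_derivative \<phi> (at x) b = c * frechet_derivative \<phi> (at x) b" for x
    using K(3) K(5)[of x b] by (cases "x \<in> \<Omega>") auto
  then have "(LINT x|lborel. indicator \<Omega> x * c * frechet_derivative \<phi> (at x) b) =
      (LINT x|lborel. c * frechet_derivative \<phi> (at x) b)"
    by (simp only:)
  then show "(LINT x|lborel. indicator \<Omega> x * c * frechet_derivative \<phi> (at x) b) = - (LINT x|lborel. (0 \<bullet> b) * \<phi> x)"
    by (simp add: integral_test_function_derivative[OF \<phi>])
qed auto

lemma AE_lborel_translate:
  fixes P :: "'a::euclidean_space \<Rightarrow> bool"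
  assumes [measurable]: "Measurable.pred borel P"
  shows "(AE x in lborel. P (x + z)) \<longleftrightarrow> (AE x in lborel. P x)"
proof -
  have "(AE x in lborel. P x) \<longleftrightarrow> (AE x in distr lborel borel (\<lambda>x. x + z). P x)"
    unfolding lborel_translate by (rule refl)
  also have "\<dots> \<longleftrightarrow> (AE x in lborel. P (x + z))"
    by (rule AE_distr_iff) auto
  finally show ?thesis by simp
qed

lemma AE_ball_nontrivial:
  assumes "AE x in lborel. x \<in> ball a r \<longrightarrow> P x" "r > 0"
  shows "\<exists>x\<in>ball a r. P x"
proof (rule ccontr)
  assume "\<not> ?thesis"
  then have "AE x in lborel. x \<notin> ball a r"
    using assms(1) by (auto elim!: eventually_mono)
  then have "emeasure lborel (ball a r) = 0"
    by (subst (asm) AE_iff_measurable[of "ball a r"]) auto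
  then show False using content_ball_pos[OF assms(2), of a] by (simp add: measure_def)
qed

text \<open>For every small shift \<open>z\<close> the increment is an average of 0, so
  \<open>w (x + z) = w x\<close> for almost every \<open>x\<close>. After exchanging the quantifiers
  a single base point \<open>x\<close> serves almost all shifts, and \<open>w\<close> equals
  \<open>w x\<close> around it.\<close>

lemma sobolev_zero_gradient_local:
  fixes w :: "'a::euclidean_space \<Rightarrow> real"
  assumes s: "sobolev \<Omega> w g" and g0: "AE x in lborel. g x = 0"
    and r: "r > 0" and sub: "ball a (2 * r) \<subseteq> \<Omega>"
  shows "\<exists>c. AE x in lborel. x \<in> ball a (r / 2) \<longrightarrow> w x = c"
proof -
  note [measurable] = sobolevD(4)[OF s] sobolev_gradient_measurable[OF s]
  have [measurable]: "ball a r \<in> sets borel" for a :: 'a and r by simp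
  have "AE x in lborel. z \<in> ball 0 r \<longrightarrow> x \<in> ball a r \<longrightarrow> w (x + z) = w x" for z
  proof (cases "z \<in> ball 0 r")
    case True
    interpret prob_shift "segment_measure z" by (rule prob_shift_segment)
    note sg = sobolev_gradient_square_integrable[OF s, of z]
    have "AE x in lborel. x \<in> ball a r \<longrightarrow> w (x + z) - w x = average (\<lambda>y. g y \<bullet> z) x"
    proof (rule sobolev_difference[OF s])
      fix x and t :: real assume x: "x \<in> ball a r" and t: "t \<in> {0..1}"
      have "norm (t *\<^sub>R z) \<le> norm z" using t by (simp add: mult_left_le_one_le)
      then have "dist a (x + t *\<^sub>R z) < 2 * r"
        using x True norm_triangle_ineq4[of "a - x" "t *\<^sub>R z"] by (simp add: dist_norm diff_diff_eq)
      then show "x + t *\<^sub>R z \<in> \<Omega>" using sub by (meson mem_ball subsetD)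
    qed simp
    moreover have "AE x in lborel. average (\<lambda>y. g y \<bullet> z) x = 0"
    proof -
      have "AE x in lborel. g x \<bullet> z = 0" using g0 by eventually_elim simp
      then have "sq_integral lborel (\<lambda>x. g x \<bullet> z) = 0" using sq_integral_zero_iff[OF sg] by simp
      then have "sq_integral lborel (average (\<lambda>y. g y \<bullet> z)) = 0"
        using average_L2(2)[OF sg] sq_integral_nonneg[of lborel "average (\<lambda>y. g y \<bullet> z)"] by linarith
      then show ?thesis using sq_integral_zero_iff[OF average_L2(1)[OF sg]] by simp
    qed
    ultimately show ?thesis by eventually_elim auto
  qed simp
  then have "AE z in lborel. AE x in lborel. z \<in> ball 0 r \<longrightarrow> x \<in> ball a r \<longrightarrow> w (x + z) = w x"
    by simp
  \<comment> \<open>The exceptional null set of points depends on the shift; Fubini's theorem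
    exchanges the two quantifiers.\<close>
  then have "AE x in lborel. AE z in lborel. z \<in> ball 0 r \<longrightarrow> x \<in> ball a r \<longrightarrow> w (x + z) = w x"
    by (subst (asm) lborel_pair.AE_commute) measurable
  then have "AE x in lborel. x \<in> ball a (r / 2) \<longrightarrow>
      x \<in> ball a (r / 2) \<and> (AE z in lborel. z \<in> ball 0 r \<longrightarrow> x \<in> ball a r \<longrightarrow> w (x + z) = w x)"
    by eventually_elim simp
  then obtain x where x: "x \<in> ball a (r / 2)"
    "AE z in lborel. z \<in> ball 0 r \<longrightarrow> x \<in> ball a r \<longrightarrow> w (x + z) = w x"
    using AE_ball_nontrivial[of a "r / 2"] r by fastforce
  have xr: "x \<in> ball a r" using x(1) r by simp
  have "AE z in lborel. z + x \<in> ball x r \<longrightarrow> w (z + x) = w x"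
    using x(2)
  proof eventually_elim
    case (elim z)
    then show ?case using xr by (simp add: dist_norm add.commute)
  qed
  then have "AE y in lborel. y \<in> ball x r \<longrightarrow> w y = w x"
    by (subst (asm) AE_lborel_translate) measurable
  \<comment> \<open>The base point is only known to lie within \<open>r / 2\<close> of
    \<open>a\<close>, and the ball of radius \<open>r\<close> around it then covers
    \<open>ball a (r / 2)\<close>.\<close>
  moreover have "y \<in> ball x r" if "y \<in> ball a (r / 2)" for y
    using that x(1) dist_triangle[of x y a] by (simp add: dist_commute)
  ultimately show ?thesis
    by (intro exI[of _ "w x"]) (auto elim!: eventually_mono)
qed

text \<open>Two points are related if \<open>w\<close> has the same constant value near both. The
  constant at a point is unique because balls have positive measure, so this is an equivalence
  relation; every point is related to all points near it, and connectedness leaves one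
  class.\<close>

lemma sobolev_zero_gradient_const:
  fixes w :: "'a::euclidean_space \<Rightarrow> real"
  assumes s: "sobolev \<Omega> w g" and g0: "AE x in lborel. g x = 0" and O: "open \<Omega>" "connected \<Omega>"
  shows "\<exists>c. AE x in lborel. x \<in> \<Omega> \<longrightarrow> w x = c"
proof (cases "\<Omega> = {}")
  case False
  define Q where "Q c x r \<longleftrightarrow> r > 0 \<and> (AE y in lborel. y \<in> ball x r \<longrightarrow> w y = c)" for c x r
  define R where "R x y \<longleftrightarrow> (\<exists>c r. Q c x r \<and> Q c y r)" for x y
  have mono: "Q c x r'" if "Q c x r" "0 < r'" "r' \<le> r" for c x r r'
    using that by (auto simp: Q_def elim!: eventually_mono)
  have unique: "c = c'" if "Q c x r" "Q c' x r'" for c c' x r r'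
  proof -
    have "Q c x (min r r')" "Q c' x (min r r')"
      using mono[OF that(1), of "min r r'"] mono[OF that(2), of "min r r'"] that by (auto simp: Q_def)
    then have m: "AE y in lborel. y \<in> ball x (min r r') \<longrightarrow> w y = c"
      "AE y in lborel. y \<in> ball x (min r r') \<longrightarrow> w y = c'" "min r r' > 0"
      unfolding Q_def by blast+
    from m(1,2) have "AE y in lborel. y \<in> ball x (min r r') \<longrightarrow> c = c'"
      by eventually_elim blast
    from AE_ball_nontrivial[OF this m(3)] show ?thesis by auto
  qed
  obtain a where a: "a \<in> \<Omega>" using False by blast
  have R: "R a b" if b: "b \<in> \<Omega>" for b
  proof (rule connected_equivalence_relation[OF O(2) a b])
    fix x y assume "R x y" then show "R y x" by (auto simp: R_def)
  next
    fix x y z assume "R x y" "R y z"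
    then obtain c r c' r' where q: "Q c x r" "Q c y r" "Q c' y r'" "Q c' z r'" by (auto simp: R_def)
    then have "c = c'" using unique by blast
    then have "Q c x (min r r')" "Q c z (min r r')"
      using mono[OF q(1), of "min r r'"] mono[OF q(4), of "min r r'"] q by (auto simp: Q_def)
    then show "R x z" by (auto simp: R_def)
  next
    fix x assume "x \<in> \<Omega>"
    then obtain e where e: "e > 0" "ball x e \<subseteq> \<Omega>" using O(1) open_contains_ball by blast
    \<comment> \<open>The local result with \<open>r = e / 2\<close> needs the ball of radius
      \<open>2 * r = e\<close> in \<Omega> and gives a constant on the ball of radius
      \<open>r / 2 = e / 4\<close>.\<close>
    obtain c where c: "AE y in lborel. y \<in> ball x (e / 4) \<longrightarrow> w y = c"
      using sobolev_zero_gradient_local[OF s g0, of "e / 2" x] e by auto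
    show "\<exists>T. openin (top_of_set \<Omega>) T \<and> x \<in> T \<and> (\<forall>y\<in>T. R x y)"
    proof (intro exI conjI ballI)
      show "openin (top_of_set \<Omega>) (ball x (e / 4))"
        using e O(1) by (subst openin_open_eq) auto
      fix y assume y: "y \<in> ball x (e / 4)"
      define r where "r = e / 4 - dist x y"
      have "r > 0" using y by (simp add: r_def)
      moreover have "z \<in> ball x (e / 4)" if "z \<in> ball y r" for z
        using that dist_triangle[of x z y] by (simp add: r_def)
      moreover have "z \<in> ball x (e / 4)" if "z \<in> ball x r" for z
        using that zero_le_dist[of x y] unfolding r_def mem_ball by linarith
      ultimately have "Q c x r" "Q c y r"
        unfolding Q_def using c by (blast intro: eventually_mono)+
      then show "R x y" by (auto simp: R_def)
    qed (use e in auto)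
  qed
  obtain c r where c: "Q c a r" using R[OF a] by (auto simp: R_def)
  have "\<exists>r. Q c b r" if "b \<in> \<Omega>" for b
  proof -
    obtain c' r' where "Q c' a r'" "Q c' b r'" using R[OF \<open>b \<in> \<Omega>\<close>] by (auto simp: R_def)
    then show ?thesis using unique[OF c] by metis
  qed
  then obtain \<rho> where \<rho>: "\<And>b. b \<in> \<Omega> \<Longrightarrow> Q c b (\<rho> b)" by metis
  \<comment> \<open>The balls form an uncountable family, each with its own null set; a countable
    subcover keeps the union of these sets null.\<close>
  obtain F where F: "F \<subseteq> (\<lambda>b. ball b (\<rho> b)) ` \<Omega>" "countable F" "\<Union>F = \<Union>((\<lambda>b. ball b (\<rho> b)) ` \<Omega>)"
    using Lindelof[of "(\<lambda>b. ball b (\<rho> b)) ` \<Omega>"] by auto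
  have cover: "\<Omega> \<subseteq> \<Union>F" unfolding F(3) using \<rho> by (auto simp: Q_def)
  have "AE y in lborel. \<forall>B\<in>F. y \<in> B \<longrightarrow> w y = c"
    using F(1) \<rho> by (subst AE_ball_countable[OF F(2)]) (auto simp: Q_def)
  then have "AE y in lborel. y \<in> \<Omega> \<longrightarrow> w y = c"
    by eventually_elim (use cover in blast)
  then show ?thesis by blast
qed simp

subsection \<open>Density of functions continuous up to the boundary\<close>

definition sobolev_sq :: "('a::euclidean_space \<Rightarrow> real) \<Rightarrow> ('a \<Rightarrow> 'a) \<Rightarrow> real" where
  "sobolev_sq u g = sq_integral lborel u + (\<Sum>b\<in>Basis. sq_integral lborel (\<lambda>x. g x \<bullet> b))"

text \<open>\<open>U\<close> is continuous on the whole space and so has boundary values of its own,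
  whereas \<open>indicator \<Omega> x * U x\<close> is its representative in \<open>sobolev\<close>,
  cut off at the boundary.\<close>

definition approximable :: "'a::euclidean_space set \<Rightarrow> ('a \<Rightarrow> real) \<Rightarrow> ('a \<Rightarrow> 'a) \<Rightarrow> bool" where
  "approximable \<Omega> u g \<longleftrightarrow> (\<forall>e>0. \<exists>U G. continuous_on UNIV U \<and> sobolev \<Omega> (\<lambda>x. indicator \<Omega> x * U x) G \<and>
     sobolev_sq (\<lambda>x. indicator \<Omega> x * U x - u x) (\<lambda>x. G x - g x) < e)"

lemma sobolev_sq_add_le:
  assumes "sobolev \<Omega> u g" "sobolev \<Omega> v h"
  shows "sobolev_sq (\<lambda>x. u x + v x) (\<lambda>x. g x + h x) \<le> 2 * sobolev_sq u g + 2 * sobolev_sq v h"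
proof -
  have "(\<Sum>b\<in>Basis. sq_integral lborel (\<lambda>x. (g x + h x) \<bullet> b)) \<le>
      (\<Sum>b\<in>Basis. 2 * sq_integral lborel (\<lambda>x. g x \<bullet> b) + 2 * sq_integral lborel (\<lambda>x. h x \<bullet> b))"
    unfolding inner_add_left
    by (intro sum_mono sq_integral_add_le sobolev_gradient_square_integrable[OF assms(1)]
        sobolev_gradient_square_integrable[OF assms(2)])
  then show ?thesis
    using sq_integral_add_le[OF sobolevD(1)[OF assms(1)] sobolevD(1)[OF assms(2)]]
    by (simp add: sobolev_sq_def sum.distrib sum_distrib_left)
qed

lemma approximable_add:
  assumes s: "sobolev \<Omega> u g" "sobolev \<Omega> v h" and a: "approximable \<Omega> u g" "approximable \<Omega> v h"
  shows "approximable \<Omega> (\<lambda>x. u x + v x) (\<lambda>x. g x + h x)"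
  unfolding approximable_def
proof (intro allI impI)
  fix e :: real assume "e > 0"
  then have e4: "e / 4 > 0" by simp
  obtain U G where U: "continuous_on UNIV U" "sobolev \<Omega> (\<lambda>x. indicator \<Omega> x * U x) G"
    "sobolev_sq (\<lambda>x. indicator \<Omega> x * U x - u x) (\<lambda>x. G x - g x) < e / 4"
    using a(1) e4 unfolding approximable_def by blast
  obtain V H where V: "continuous_on UNIV V" "sobolev \<Omega> (\<lambda>x. indicator \<Omega> x * V x) H"
    "sobolev_sq (\<lambda>x. indicator \<Omega> x * V x - v x) (\<lambda>x. H x - h x) < e / 4"
    using a(2) e4 unfolding approximable_def by blast
  have "sobolev_sq (\<lambda>x. (indicator \<Omega> x * U x - u x) + (indicator \<Omega> x * V x - v x))
      (\<lambda>x. (G x - g x) + (H x - h x)) < e"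
    using sobolev_sq_add_le[OF sobolev_diff[OF U(2) s(1)] sobolev_diff[OF V(2) s(2)]] U(3) V(3) by linarith
  moreover have "(\<lambda>x. (indicator \<Omega> x * U x - u x) + (indicator \<Omega> x * V x - v x)) =
      (\<lambda>x. indicator \<Omega> x * (U x + V x) - (u x + v x))"
    by (simp add: algebra_simps)
  moreover have "(\<lambda>x. (G x - g x) + (H x - h x)) = (\<lambda>x. (G x + H x) - (g x + h x))"
    by (simp add: algebra_simps)
  ultimately have "sobolev_sq (\<lambda>x. indicator \<Omega> x * (U x + V x) - (u x + v x)) (\<lambda>x. (G x + H x) - (g x + h x)) < e"
    by (simp only:)
  moreover have "sobolev \<Omega> (\<lambda>x. indicator \<Omega> x * (U x + V x)) (\<lambda>x. G x + H x)"
    using sobolev_add[OF U(2) V(2)] by (simp add: distrib_left)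
  ultimately show "\<exists>W K. continuous_on UNIV W \<and> sobolev \<Omega> (\<lambda>x. indicator \<Omega> x * W x) K \<and>
      sobolev_sq (\<lambda>x. indicator \<Omega> x * W x - (u x + v x)) (\<lambda>x. K x - (g x + h x)) < e"
    using continuous_on_add[OF U(1) V(1)] by blast
qed

text \<open>The average at \<open>x\<close> is a pairing of the translate of \<open>f\<close> by
  \<open>x\<close> with a fixed square-integrable function, the indicator of the ball. Continuity of
  translations and Cauchy-Schwarz give the claim.\<close>

lemma continuous_average_ball:
  fixes f :: "'a::euclidean_space \<Rightarrow> real"
  assumes f: "square_integrable lborel f" and r: "r > 0"
  shows "continuous_on UNIV (prob_shift.average (ball_measure c r) f)"
proof -
  interpret prob_shift "ball_measure c r" using r by (rule prob_shift_ball)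
  have [measurable]: "f \<in> borel_measurable borel" using square_integrable_measurable[OF f] by simp
  define m where "m = measure lborel (ball c r)"
  have m: "m > 0" using r by (simp add: m_def content_ball_pos)
  define I where "I = (indicator (ball c r) :: 'a \<Rightarrow> real)"
  have sI: "square_integrable lborel I"
    unfolding I_def using emeasure_bounded_finite[of "ball c r"] by (intro square_integrable_indicator) auto
  have I: "average f x = (LINT y|lborel. I y * f (y + x)) / m" for x
    unfolding average_def I_def m_def
    by (subst integral_ball_measure[OF _ r]) (simp_all add: add.commute)
  show ?thesis
    unfolding continuous_on_iff
  proof (intro ballI allI impI)
    fix x :: 'a and e :: real assume e: "e > 0"
    \<comment> \<open>Chosen so that Cauchy-Schwarz bounds the change of the pairing by
      \<open>e * m / 2\<close>; dividing by the volume \<open>m\<close> then gives less than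
      \<open>e\<close>. Adding 1 makes the denominator visibly positive.\<close>
    define e' where "e' = (e * m / 2)\<^sup>2 / (sq_integral lborel I + 1)"
    have I1: "sq_integral lborel I + 1 > 0" by (simp add: add_nonneg_pos)
    then have e': "e' > 0" using e m by (simp add: e'_def)
    obtain d where d: "d > 0" "\<And>z. norm z \<le> d \<Longrightarrow> sq_integral lborel (\<lambda>x. f (x + z) - f x) \<le> e'"
      using L2_translation_continuous[OF f] e' unfolding L2_translation_continuous_def by blast
    have "dist (average f x') (average f x) < e" if x': "dist x' x < d" for x'
    proof -
      define k where "k y = f (y + x') - f (y + x)" for y
      have sk: "square_integrable lborel k" unfolding k_def using f by (intro square_integrable_diff) auto
      have "sq_integral lborel k = sq_integral lborel (\<lambda>y. f (y + (x' - x)) - f y)"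
        using sq_integral_translate[of "\<lambda>y. f (y + (x' - x)) - f y" x] by (simp add: k_def[abs_def] algebra_simps)
      also have "\<dots> \<le> e'" using d(2)[of "x' - x"] x' by (simp add: dist_norm)
      finally have sqk: "sq_integral lborel k \<le> e'" .
      have "(LINT y|lborel. I y * k y)\<^sup>2 \<le> sq_integral lborel I * sq_integral lborel k"
        by (rule Cauchy_Schwarz_integral[OF sI sk])
      also have "\<dots> \<le> (sq_integral lborel I + 1) * e'"
        using sqk e' by (intro mult_mono) auto
      also have "\<dots> = (e * m / 2)\<^sup>2"
        using I1 by (simp add: e'_def)
      finally have "\<bar>LINT y|lborel. I y * k y\<bar> \<le> e * m / 2"
        using e m by (subst (asm) abs_le_square_iff[symmetric]) auto
      moreover have "(LINT y|lborel. I y * k y) = (LINT y|lborel. I y * f (y + x')) - (LINT y|lborel. I y * f (y + x))"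
        unfolding k_def right_diff_distrib
        by (intro Bochner_Integration.integral_diff square_integrable_mult_integrable sI square_integrable_translate f)
      moreover have "e * m / 2 < e * m" using e m by simp
      ultimately have "\<bar>(LINT y|lborel. I y * f (y + x')) - (LINT y|lborel. I y * f (y + x))\<bar> < e * m"
        by linarith
      then show ?thesis
        using m by (simp add: dist_real_def I pos_divide_less_eq flip: diff_divide_distrib)
    qed
    then show "\<exists>d>0. \<forall>x'\<in>UNIV. dist x' x < d \<longrightarrow> dist (average f x') (average f x) < e"
      using d(1) by blast
  qed
qed

text \<open>Averaging over small balls centred at \<open>c\<close> only sees points of \<open>\<Omega>\<close>; near the boundary \<open>c\<close> must point inwards.\<close>

definition inward_translatable :: "'a::euclidean_space set \<Rightarrow> 'a \<Rightarrow> real \<Rightarrow> bool" where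
  "inward_translatable \<Omega> a R \<longleftrightarrow> (\<forall>\<delta>>0. \<exists>c \<rho>. 0 < \<rho> \<and> norm c + \<rho> < \<delta> \<and>
     (\<forall>x\<in>\<Omega>. \<forall>z\<in>ball c \<rho>. x + z \<in> ball a R \<longrightarrow> x + z \<in> \<Omega>))"

text \<open>The shifted test function may leave \<Omega>, since shifted points are known to stay in
  \<Omega> only inside \<open>ball a R\<close>. A cutoff that is 1 on \<open>ball a (R / 2)\<close>,
  where \<open>u\<close> and \<open>g\<close> live, removes the rest of the support without changing
  either integral.\<close>

lemma sobolev_translate:
  fixes u :: "'a::euclidean_space \<Rightarrow> real"
  assumes s: "sobolev \<Omega> u g" and R: "R > 0"
    and van: "\<And>x. x \<notin> ball a (R / 2) \<Longrightarrow> u x = 0 \<and> g x = 0"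
    and z: "\<And>x. x \<in> \<Omega> \<Longrightarrow> x + z \<in> ball a R \<Longrightarrow> x + z \<in> \<Omega>"
    and \<phi>: "\<phi> \<in> test_functions \<Omega>"
  shows "(LINT x|lborel. u (x + z) * frechet_derivative \<phi> (at x) b) = - (LINT x|lborel. (g (x + z) \<bullet> b) * \<phi> x)"
proof -
  note [measurable] = sobolevD(4)[OF s] sobolev_gradient_measurable[OF s]
  note s\<phi> = test_functions_square_integrable[OF \<phi>]
  have [measurable]: "\<phi> \<in> borel_measurable borel" "(\<lambda>x. frechet_derivative \<phi> (at x) b) \<in> borel_measurable borel"
    using s\<phi>[THEN square_integrable_measurable] by auto
  obtain K where K: "smooth \<phi>" "compact K" "K \<subseteq> \<Omega>" "\<And>x. x \<notin> K \<Longrightarrow> \<phi> x = 0"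
    "\<And>x z. x \<notin> K \<Longrightarrow> frechet_derivative \<phi> (at x) z = 0"
    using test_functionsE[OF \<phi>] by blast
  \<comment> \<open>The outer radius lies strictly between \<open>R / 2\<close> and
    \<open>R\<close>, so that the closed ball containing the support is still inside
    \<open>ball a R\<close>.\<close>
  obtain \<psi> where \<psi>: "smooth \<psi>" "\<And>x. 0 \<le> \<psi> x" "\<And>x. \<psi> x \<le> 1" "\<And>x. x \<in> cball a (R / 2) \<Longrightarrow> \<psi> x = 1"
    "\<And>x. x \<notin> ball a (3 * R / 4) \<Longrightarrow> \<psi> x = 0"
    using smooth_cutoff_exists[of "R / 2" "3 * R / 4" a] R by auto
  have sm: "smooth (\<lambda>x. \<phi> (x + - z))" using K(1) k_times_cont_diff_translate by blast
  define \<zeta> where "\<zeta> x = \<psi> x * \<phi> (x + - z)" for x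
  have \<zeta>: "\<zeta> \<in> test_functions \<Omega>"
  proof (rule test_functionsI)
    show "smooth \<zeta>" unfolding \<zeta>_def using \<psi>(1) sm by (simp add: k_times_cont_diff_mult)
    show "compact ((\<lambda>x. z + x) ` K \<inter> cball a (3 * R / 4))"
      using compact_translation[OF K(2), of z] by (intro compact_Int) auto
    show "(\<lambda>x. z + x) ` K \<inter> cball a (3 * R / 4) \<subseteq> \<Omega>"
    proof
      fix x assume "x \<in> (\<lambda>x. z + x) ` K \<inter> cball a (3 * R / 4)"
      then obtain y where y: "y \<in> K" "x = y + z" "dist a x \<le> 3 * R / 4" by (auto simp: add.commute)
      then have "y + z \<in> ball a R" using R by simp
      then show "x \<in> \<Omega>" using z[of y] y K(3) by auto
    qed
    fix x assume x: "x \<notin> (\<lambda>x. z + x) ` K \<inter> cball a (3 * R / 4)"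
    show "\<zeta> x = 0"
    proof (cases "x + - z \<in> K")
      case True
      then have "x \<in> (\<lambda>x. z + x) ` K" by (intro image_eqI[of _ _ "x + - z"]) auto
      then have "x \<notin> ball a (3 * R / 4)" using x by auto
      then show ?thesis by (simp add: \<zeta>_def \<psi>(5))
    qed (simp add: \<zeta>_def K(4))
  qed
  have uD: "u x * frechet_derivative \<zeta> (at x) b = u x * frechet_derivative \<phi> (at (x + - z)) b" for x
  proof (cases "x \<in> ball a (R / 2)")
    case True
    then have 1: "\<psi> x = 1" by (intro \<psi>(4)) auto
    then have "frechet_derivative \<psi> (at x) b = 0"
      by (intro smooth_derivative_zero_maxmin[OF \<psi>(1)]) (simp add: \<psi>(3))
    then show ?thesis
      unfolding \<zeta>_def frechet_derivative_smooth_mult[OF \<psi>(1) sm] frechet_derivative_translate[OF K(1)]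
      by (simp add: 1)
  qed (simp add: van)
  have g\<zeta>: "(g x \<bullet> b) * \<zeta> x = (g x \<bullet> b) * \<phi> (x + - z)" for x
  proof (cases "x \<in> ball a (R / 2)")
    case True
    then have "\<psi> x = 1" by (intro \<psi>(4)) auto
    then show ?thesis by (simp add: \<zeta>_def)
  qed (simp add: van)
  have "(LINT x|lborel. u (x + z) * frechet_derivative \<phi> (at x) b) =
      (LINT x|lborel. u (x + z) * frechet_derivative \<phi> (at ((x + z) + - z)) b)" by simp
  also have "\<dots> = (LINT x|lborel. u x * frechet_derivative \<phi> (at (x + - z)) b)"
    by (rule integral_translate) measurable
  also have "\<dots> = - (LINT x|lborel. (g x \<bullet> b) * \<phi> (x + - z))"
    using sobolev_integration_by_parts[OF s \<zeta>, of b] unfolding uD g\<zeta> .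
  also have "(LINT x|lborel. (g x \<bullet> b) * \<phi> (x + - z)) = (LINT x|lborel. (g (x + z) \<bullet> b) * \<phi> ((x + z) + - z))"
    by (rule integral_translate[symmetric]) measurable
  finally show ?thesis by simp
qed

text \<open>The weak identity holds for every shift in the ball, and Fubini's theorem averages it.
  The factor \<open>indicator \<Omega> x\<close> restores the vanishing off \<Omega> and is
  invisible to test functions, which are supported in \<Omega>.\<close>

lemma sobolev_average:
  fixes u :: "'a::euclidean_space \<Rightarrow> real"
  assumes s: "sobolev \<Omega> u g" and O: "open \<Omega>" and R: "R > 0" and \<rho>: "\<rho> > 0"
    and van: "\<And>x. x \<notin> ball a (R / 2) \<Longrightarrow> u x = 0 \<and> g x = 0"
    and z: "\<And>x z. x \<in> \<Omega> \<Longrightarrow> z \<in> ball c \<rho> \<Longrightarrow> x + z \<in> ball a R \<Longrightarrow> x + z \<in> \<Omega>"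
  shows "sobolev \<Omega> (\<lambda>x. indicator \<Omega> x * prob_shift.average (ball_measure c \<rho>) u x)
    (\<lambda>x. indicator \<Omega> x *\<^sub>R (\<Sum>b\<in>Basis. prob_shift.average (ball_measure c \<rho>) (\<lambda>y. g y \<bullet> b) x *\<^sub>R b))"
proof -
  interpret prob_shift "ball_measure c \<rho>" using \<rho> by (rule prob_shift_ball)
  note [measurable] = sobolevD(4)[OF s] sobolev_gradient_measurable[OF s]
  note su = sobolevD(1)[OF s] and sg = sobolev_gradient_square_integrable[OF s]
  have [measurable]: "\<Omega> \<in> sets borel" using O by simp
  have ind: "square_integrable lborel (\<lambda>x. indicator \<Omega> x * f x)" if "square_integrable lborel f" for f :: "'a \<Rightarrow> real"
    by (rule square_integrable_bounded_mult[OF that, where B = 1]) (auto simp: indicator_def)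
  have grad: "(indicator \<Omega> x *\<^sub>R (\<Sum>b\<in>Basis. average (\<lambda>y. g y \<bullet> b) x *\<^sub>R b)) \<bullet> b = indicator \<Omega> x * average (\<lambda>y. g y \<bullet> b) x"
    if "b \<in> Basis" for b x using that by simp
  show ?thesis
    unfolding sobolev_def
  proof (intro conjI ballI allI)
    fix \<phi> b assume \<phi>: "\<phi> \<in> test_functions \<Omega>" and b: "b \<in> (Basis :: 'a set)"
    note s\<phi> = test_functions_square_integrable[OF \<phi>]
    have [measurable]: "\<phi> \<in> borel_measurable borel" "(\<lambda>x. frechet_derivative \<phi> (at x) b) \<in> borel_measurable borel"
      using s\<phi>[THEN square_integrable_measurable] by auto
    obtain K where K: "smooth \<phi>" "compact K" "K \<subseteq> \<Omega>" "\<And>x. x \<notin> K \<Longrightarrow> \<phi> x = 0"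
      "\<And>x z. x \<notin> K \<Longrightarrow> frechet_derivative \<phi> (at x) z = 0"
      using test_functionsE[OF \<phi>] by blast
    have 1: "indicator \<Omega> x * average u x * frechet_derivative \<phi> (at x) b = average u x * frechet_derivative \<phi> (at x) b" for x
      using K(3) K(5)[of x b] by (cases "x \<in> \<Omega>") auto
    have 2: "indicator \<Omega> x * average (\<lambda>y. g y \<bullet> b) x * \<phi> x = average (\<lambda>y. g y \<bullet> b) x * \<phi> x" for x
      using K(3) K(4)[of x] by (cases "x \<in> \<Omega>") auto
    have "(LINT x|lborel. average u x * frechet_derivative \<phi> (at x) b) =
        (LINT z|ball_measure c \<rho>. LINT x|lborel. u (x + z) * frechet_derivative \<phi> (at x) b)"
      by (rule integral_average_mult[OF su s\<phi>(2)])
    also have "\<dots> = (LINT z|ball_measure c \<rho>. - (LINT x|lborel. (g (x + z) \<bullet> b) * \<phi> x))"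
    proof (rule integral_cong_AE)
      show "AE y in ball_measure c \<rho>. (LINT x|lborel. u (x + y) * frechet_derivative \<phi> (at x) b) =
          - (LINT x|lborel. (g (x + y) \<bullet> b) * \<phi> x)"
        using AE_ball_measure[of c \<rho>]
      proof eventually_elim
        case (elim y)
        then show ?case using z by (intro sobolev_translate[OF s R van _ \<phi>]) auto
      qed
    qed measurable
    also have "\<dots> = - (LINT x|lborel. average (\<lambda>y. g y \<bullet> b) x * \<phi> x)"
      using integral_average_mult[OF sg s\<phi>(1), of b] by simp
    finally show "(LINT x|lborel. indicator \<Omega> x * average u x * frechet_derivative \<phi> (at x) b) =
        - (LINT x|lborel. (indicator \<Omega> x *\<^sub>R (\<Sum>b\<in>Basis. average (\<lambda>y. g y \<bullet> b) x *\<^sub>R b)) \<bullet> b * \<phi> x)"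
      unfolding grad[OF b] 1 2 .
  next
    fix b assume b: "b \<in> (Basis :: 'a set)"
    show "square_integrable lborel (\<lambda>x. (indicator \<Omega> x *\<^sub>R (\<Sum>b\<in>Basis. average (\<lambda>y. g y \<bullet> b) x *\<^sub>R b)) \<bullet> b)"
      unfolding grad[OF b] by (rule ind[OF average_L2(1)[OF sg]])
  qed (use ind[OF average_L2(1)[OF su]] in auto)
qed

text \<open>Inward translatability supplies balls of admissible shifts that shrink to 0, so the
  averages converge in L^2 for \<open>u\<close> and for each component of \<open>g\<close>. Cutting
  them off outside \<Omega> can only reduce the error, as the limits vanish there.\<close>

lemma approximable_local:
  fixes u :: "'a::euclidean_space \<Rightarrow> real"
  assumes s: "sobolev \<Omega> u g" and O: "open \<Omega>" and R: "R > 0" and inw: "inward_translatable \<Omega> a R"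
    and van: "\<And>x. x \<notin> ball a (R / 2) \<Longrightarrow> u x = 0 \<and> g x = 0"
  shows "approximable \<Omega> u g"
proof -
  note su = sobolevD(1)[OF s] and sg = sobolev_gradient_square_integrable[OF s]
  have [measurable]: "\<Omega> \<in> sets borel" using O by simp
  have "\<exists>c \<rho>. 0 < \<rho> \<and> norm c + \<rho> < inverse (real (Suc n)) \<and>
     (\<forall>x\<in>\<Omega>. \<forall>z\<in>ball c \<rho>. x + z \<in> ball a R \<longrightarrow> x + z \<in> \<Omega>)" for n
    using inw by (simp add: inward_translatable_def del: of_nat_Suc)
  then obtain c \<rho> where c: "\<And>n. 0 < \<rho> n" "\<And>n. norm (c n) + \<rho> n < inverse (real (Suc n))"
    "\<And>n x z. x \<in> \<Omega> \<Longrightarrow> z \<in> ball (c n) (\<rho> n) \<Longrightarrow> x + z \<in> ball a R \<Longrightarrow> x + z \<in> \<Omega>" by metis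
  define A where "A n = prob_shift.average (ball_measure (c n) (\<rho> n))" for n
  define G where "G n x = indicator \<Omega> x *\<^sub>R (\<Sum>b\<in>Basis. A n (\<lambda>y. g y \<bullet> b) x *\<^sub>R b)" for n x
  have ps: "prob_shift (ball_measure (c n) (\<rho> n))" for n using c(1) by (rule prob_shift_ball)
  have sA: "square_integrable lborel (A n f)" if "square_integrable lborel f" for f n
    unfolding A_def by (rule prob_shift.average_L2(1)[OF ps that])
  have lim: "(\<lambda>n. sq_integral lborel (\<lambda>x. indicator \<Omega> x * A n f x - f x)) \<longlonglongrightarrow> 0"
    if f: "square_integrable lborel f" and f0: "\<And>x. x \<notin> \<Omega> \<Longrightarrow> f x = 0" for f
  proof (rule Lim_null_comparison)
    show "(\<lambda>n. sq_integral lborel (\<lambda>x. A n f x - f x)) \<longlonglongrightarrow> 0"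
      unfolding A_def
    proof (rule averages_tendsto[OF f ps])
      show "AE z in ball_measure (c n) (\<rho> n). norm z \<le> inverse (real (Suc n))" for n
        using norm_AE_ball_measure[of "c n" "\<rho> n"] by eventually_elim (use c(2)[of n] in linarith)
    qed (rule LIMSEQ_inverse_real_of_nat)
    show "\<forall>\<^sub>F n in sequentially. norm (sq_integral lborel (\<lambda>x. indicator \<Omega> x * A n f x - f x))
        \<le> sq_integral lborel (\<lambda>x. A n f x - f x)"
    proof (intro always_eventually allI)
      fix n
      have [measurable]: "A n f \<in> borel_measurable borel" "f \<in> borel_measurable borel"
        using sA[OF f, of n] f by (auto dest!: square_integrable_measurable)
      have "AE x in lborel. \<bar>indicator \<Omega> x * A n f x - f x\<bar> \<le> \<bar>A n f x - f x\<bar>"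
        by (intro always_eventually allI) (use f0 in \<open>auto simp: indicator_def\<close>)
      then show "norm (sq_integral lborel (\<lambda>x. indicator \<Omega> x * A n f x - f x)) \<le> sq_integral lborel (\<lambda>x. A n f x - f x)"
        using sq_integral_mono[OF square_integrable_diff[OF sA[OF f] f], of "\<lambda>x. indicator \<Omega> x * A n f x - f x" n]
        by simp
    qed
  qed
  have G: "(G n x - g x) \<bullet> b = indicator \<Omega> x * A n (\<lambda>y. g y \<bullet> b) x - g x \<bullet> b" if "b \<in> Basis" for b n x
    using that by (simp add: G_def inner_diff_left)
  have "(\<lambda>n. sobolev_sq (\<lambda>x. indicator \<Omega> x * A n u x - u x) (\<lambda>x. G n x - g x)) \<longlonglongrightarrow> 0 + (\<Sum>b\<in>(Basis :: 'a set). 0)"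
    unfolding sobolev_sq_def
  proof (intro tendsto_add tendsto_sum)
    show "(\<lambda>n. sq_integral lborel (\<lambda>x. indicator \<Omega> x * A n u x - u x)) \<longlonglongrightarrow> 0"
      using sobolevD(2)[OF s] by (intro lim[OF su])
    fix b assume b: "b \<in> (Basis :: 'a set)"
    show "(\<lambda>n. sq_integral lborel (\<lambda>x. (G n x - g x) \<bullet> b)) \<longlonglongrightarrow> 0"
      unfolding G[OF b] using sobolevD(3)[OF s] by (intro lim[OF sg]) simp
  qed
  then have lim0: "(\<lambda>n. sobolev_sq (\<lambda>x. indicator \<Omega> x * A n u x - u x) (\<lambda>x. G n x - g x)) \<longlonglongrightarrow> 0" by simp
  show ?thesis
    unfolding approximable_def
  proof (intro allI impI)
    fix e :: real assume "e > 0"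
    then obtain n where n: "sobolev_sq (\<lambda>x. indicator \<Omega> x * A n u x - u x) (\<lambda>x. G n x - g x) < e"
      using order_tendstoD(2)[OF lim0] by (meson eventually_happens trivial_limit_sequentially)
    have "continuous_on UNIV (A n u)"
      unfolding A_def by (rule continuous_average_ball[OF su c(1)])
    moreover have "sobolev \<Omega> (\<lambda>x. indicator \<Omega> x * A n u x) (G n)"
      unfolding A_def G_def[abs_def] by (rule sobolev_average[OF s O R c(1) van c(3)])
    ultimately show "\<exists>U G. continuous_on UNIV U \<and> sobolev \<Omega> (\<lambda>x. indicator \<Omega> x * U x) G \<and>
        sobolev_sq (\<lambda>x. indicator \<Omega> x * U x - u x) (\<lambda>x. G x - g x) < e"
      using n by blast
  qed
qed

text \<open>A partition of unity, peeled off one ball at a time: \<open>\<psi> u\<close> lives near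
  \<open>a\<close> and is handled locally, while \<open>u - \<psi> u\<close> vanishes outside the
  remaining balls. Since the function changes at each stage, the induction is over all
  \<open>u\<close> and \<open>g\<close>.\<close>

lemma approximable_cover:
  fixes u :: "'a::euclidean_space \<Rightarrow> real"
  assumes I: "finite I" and O: "open \<Omega>" "bounded \<Omega>"
    and R: "\<And>a. a \<in> I \<Longrightarrow> R a > 0 \<and> inward_translatable \<Omega> a (R a)"
    and s: "sobolev \<Omega> u g"
    and van: "\<And>x. x \<notin> (\<Union>a\<in>I. ball a (R a / 4)) \<Longrightarrow> u x = 0 \<and> g x = 0"
  shows "approximable \<Omega> u g"
  using I R s van
proof (induction I arbitrary: u g)
  case empty
  then have "u = (\<lambda>x. 0)" "g = (\<lambda>x. 0)" by auto
  then show ?case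
    using empty(2) by (auto simp: approximable_def sobolev_sq_def sq_integral_def intro!: exI[of _ "\<lambda>x. 0"])
next
  case (insert a I)
  have a: "R a > 0" "inward_translatable \<Omega> a (R a)" using insert.prems(1) by auto
  obtain \<psi> where \<psi>: "smooth \<psi>" "\<And>x. 0 \<le> \<psi> x" "\<And>x. \<psi> x \<le> 1" "\<And>x. x \<in> cball a (R a / 4) \<Longrightarrow> \<psi> x = 1"
    "\<And>x. x \<notin> ball a (R a / 2) \<Longrightarrow> \<psi> x = 0"
    using smooth_cutoff_exists[of "R a / 4" "R a / 2" a] a by auto
  define v h where "v x = \<psi> x * u x"
    and "h x = \<psi> x *\<^sub>R g x + u x *\<^sub>R (\<Sum>b\<in>Basis. frechet_derivative \<psi> (at x) b *\<^sub>R b)" for x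
  have sv: "sobolev \<Omega> v h"
    unfolding v_def[abs_def] h_def[abs_def] by (rule sobolev_smooth_mult[OF insert.prems(2) O(2) \<psi>(1)])
  \<comment> \<open>The values 0 and 1 are extrema of the cutoff, so its derivative drops out there.
    Hence \<open>v\<close> and \<open>h\<close> vanish off the outer ball and equal \<open>u\<close>
    and \<open>g\<close> on the inner one at every point, as the vanishing conditions
    demand.\<close>
  have D: "frechet_derivative \<psi> (at x) b = 0" if "\<psi> x = 0 \<or> \<psi> x = 1" for x b
    using that \<psi>(2,3) by (intro smooth_derivative_zero_maxmin[OF \<psi>(1)]) auto
  have "approximable \<Omega> v h"
  proof (rule approximable_local[OF sv O(1) a])
    fix x assume "x \<notin> ball a (R a / 2)"
    then show "v x = 0 \<and> h x = 0" using \<psi>(5)[of x] D[of x] by (simp add: v_def h_def)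
  qed
  moreover have sd: "sobolev \<Omega> (\<lambda>x. u x - v x) (\<lambda>x. g x - h x)"
    by (rule sobolev_diff[OF insert.prems(2) sv])
  moreover have "approximable \<Omega> (\<lambda>x. u x - v x) (\<lambda>x. g x - h x)"
  proof (rule insert.IH[OF _ sd])
    fix x assume x: "x \<notin> (\<Union>a\<in>I. ball a (R a / 4))"
    show "u x - v x = 0 \<and> g x - h x = 0"
    proof (cases "x \<in> ball a (R a / 4)")
      case True
      then have "\<psi> x = 1" by (intro \<psi>(4)) auto
      then show ?thesis using D[of x] by (simp add: v_def h_def)
    next
      case False
      then have "u x = 0 \<and> g x = 0" using x by (intro insert.prems(3)) auto
      then show ?thesis by (simp add: v_def h_def)
    qed
  qed (use insert.prems(1) in auto)
  ultimately show ?case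
    using approximable_add[OF sv sd] by simp
qed

section \<open>Admissible shifts at interior and boundary points\<close>

lemma inward_translatable_interior:
  assumes "ball a R \<subseteq> \<Omega>"
  shows "inward_translatable \<Omega> a R"
  unfolding inward_translatable_def
proof (intro allI impI)
  fix \<delta> :: real assume "\<delta> > 0"
  then show "\<exists>c \<rho>. 0 < \<rho> \<and> norm c + \<rho> < \<delta> \<and> (\<forall>x\<in>\<Omega>. \<forall>z\<in>ball c \<rho>. x + z \<in> ball a R \<longrightarrow> x + z \<in> \<Omega>)"
    using assms by (intro exI[of _ 0] exI[of _ "\<delta> / 2"]) auto
qed

text \<open>Moving down by \<open>t\<close> along \<open>e\<close> leads away from the graph. A
  further perturbation shorter than \<rho> raises the point by less than \<rho> and lowers the graph
  function by at most \<open>2 * L * \<rho>\<close>, so the point stays below the graph when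
  \<open>\<rho> + 2 * L * \<rho> = t\<close>.\<close>

lemma inward_translatable_boundary:
  fixes a e :: "'a::euclidean_space"
  assumes r: "r > 0" and e: "norm e = 1" and h: "L-lipschitz_on UNIV (h :: 'a \<Rightarrow> real)"
    and sub: "\<Omega> \<inter> ball a r = {y \<in> ball a r. y \<bullet> e < h (y - (y \<bullet> e) *\<^sub>R e)}"
  shows "inward_translatable \<Omega> a (r / 2)"
  unfolding inward_translatable_def
proof (intro allI impI)
  fix \<delta> :: real assume \<delta>: "\<delta> > 0"
  have L: "L \<ge> 0" using h by (simp add: lipschitz_on_def)
  \<comment> \<open>Every shift used has norm at most \<open>2 * t\<close>. The first bound on
    \<open>t\<close> keeps this below \<open>\<delta>\<close>; the second keeps \<open>x\<close> in
    \<open>ball a r\<close>, where the graph description holds, whenever \<open>x + z\<close> is in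
    \<open>ball a (r / 2)\<close>.\<close>
  define t where "t = min \<delta> r / 4"
  define \<rho> where "\<rho> = t / (1 + 2 * L)"
  have t: "t > 0" "2 * t < \<delta>" "2 * t \<le> r / 2" using \<delta> r by (auto simp: t_def)
  have \<rho>0: "\<rho> > 0" using t(1) L by (simp add: \<rho>_def add_pos_nonneg)
  have "\<rho> * (1 + 2 * L) = t" using L by (simp add: \<rho>_def add_pos_nonneg)
  then have \<rho>t: "\<rho> + 2 * L * \<rho> = t" by (simp add: algebra_simps)
  moreover have "L * \<rho> \<ge> 0" using L \<rho>0 by simp
  ultimately have \<rho>: "\<rho> > 0" "\<rho> + 2 * L * \<rho> = t" "\<rho> \<le> t" using \<rho>0 by auto
  show "\<exists>c \<rho>. 0 < \<rho> \<and> norm c + \<rho> < \<delta> \<and> (\<forall>x\<in>\<Omega>. \<forall>z\<in>ball c \<rho>. x + z \<in> ball a (r / 2) \<longrightarrow> x + z \<in> \<Omega>)"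
  proof (intro exI conjI ballI impI)
    show "0 < \<rho>" by (rule \<rho>(1))
    show "norm (- t *\<^sub>R e) + \<rho> < \<delta>" using e t \<rho>(3) by simp
    fix x z assume x: "x \<in> \<Omega>" and z: "z \<in> ball (- t *\<^sub>R e) \<rho>" and xz: "x + z \<in> ball a (r / 2)"
    define y where "y = z + t *\<^sub>R e"
    have zy: "z = y - t *\<^sub>R e" by (simp add: y_def)
    have "- t *\<^sub>R e - z = - y" by (simp add: y_def)
    then have y: "norm y < \<rho>" using z unfolding mem_ball dist_norm by (metis norm_minus_cancel)
    have "norm z \<le> 2 * t"
    proof -
      have "norm z \<le> norm y + norm (t *\<^sub>R e)" unfolding zy by (rule norm_triangle_ineq4)
      also have "norm (t *\<^sub>R e) = t" using e t(1) by simp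
      finally show ?thesis using y \<rho>(3) by simp
    qed
    then have "dist a x < r"
      using xz t(3) norm_triangle_ineq4[of "a - (x + z)" "- z"] by (simp add: dist_norm)
    then have "x \<in> \<Omega> \<inter> ball a r" using x by simp
    then have "x \<in> {y \<in> ball a r. y \<bullet> e < h (y - (y \<bullet> e) *\<^sub>R e)}" unfolding sub .
    then have xe: "x \<bullet> e < h (x - (x \<bullet> e) *\<^sub>R e)" by simp
    define P where "P w = w - (w \<bullet> e) *\<^sub>R e" for w
    have ee: "e \<bullet> e = 1" using e by (simp add: dot_square_norm)
    have ye: "\<bar>y \<bullet> e\<bar> \<le> norm y" using Cauchy_Schwarz_ineq2[of y e] e by simp
    have xze: "(x + z) \<bullet> e = x \<bullet> e + y \<bullet> e - t"
      by (simp add: zy inner_add_left inner_diff_left ee)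
    have Pd: "P (x + z) = P x + P y"
      unfolding P_def xze by (simp add: zy scaleR_add_left scaleR_diff_left)
    \<comment> \<open>The triangle inequality bounds the projection by twice the norm; this is the
      source of the factor 2 in \<rho>.\<close>
    have "norm (P y) \<le> norm y + \<bar>y \<bullet> e\<bar>"
      using norm_triangle_ineq4[of y "(y \<bullet> e) *\<^sub>R e"] e by (simp add: P_def)
    then have "norm (P y) \<le> 2 * \<rho>" using ye y by linarith
    then have "L * norm (P y) \<le> L * (2 * \<rho>)" using L by (intro mult_left_mono) auto
    moreover have "\<bar>h (P x) - h (P (x + z))\<bar> \<le> L * norm (P y)"
      using lipschitz_onD[OF h, of "P x" "P (x + z)"] by (simp add: Pd dist_real_def dist_norm)
    ultimately have "(x + z) \<bullet> e < h (P (x + z))"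
      using xe ye y \<rho>(2) unfolding xze P_def[of x, symmetric] by linarith
    moreover have "x + z \<in> ball a r" using xz r by simp
    ultimately show "x + z \<in> \<Omega>" using sub unfolding P_def by blast
  qed
qed

text \<open>Every point of the closure has a ball with admissible shifts, and compactness selects
  finitely many. The quarter radii leave room for the cutoffs used in the covering argument.\<close>

lemma sobolev_approximable:
  fixes u :: "'a::euclidean_space \<Rightarrow> real"
  assumes D: "bounded_lipschitz_domain \<Omega>" and s: "sobolev \<Omega> u g"
  shows "approximable \<Omega> u g"
proof -
  have O: "open \<Omega>" "bounded \<Omega>" using D by (auto simp: bounded_lipschitz_domain_def)
  have "\<exists>R>0. inward_translatable \<Omega> a R" if a: "a \<in> closure \<Omega>" for a
  proof (cases "a \<in> \<Omega>")
    case True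
    then obtain R where "R > 0" "ball a R \<subseteq> \<Omega>" using O(1) open_contains_ball by blast
    then show ?thesis using inward_translatable_interior by blast
  next
    case False
    then have "a \<in> frontier \<Omega>" using a O(1) by (simp add: frontier_def interior_open)
    then obtain r e L and h :: "'a \<Rightarrow> real" where *: "r > 0" "norm e = 1" "L-lipschitz_on UNIV h"
      "\<Omega> \<inter> ball a r = {y \<in> ball a r. y \<bullet> e < h (y - (y \<bullet> e) *\<^sub>R e)}"
      using D unfolding bounded_lipschitz_domain_def by meson
    from inward_translatable_boundary[OF this] show ?thesis
      using *(1) by (intro exI[of _ "r / 2"]) auto
  qed
  then obtain R where R: "\<And>a. a \<in> closure \<Omega> \<Longrightarrow> R a > 0 \<and> inward_translatable \<Omega> a (R a)" by metis
  have "compact (closure \<Omega>)" using O(2) by (simp add: compact_closure)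
  then obtain I where I: "I \<subseteq> closure \<Omega>" "finite I" "closure \<Omega> \<subseteq> (\<Union>a\<in>I. ball a (R a / 4))"
    by (rule compactE_image[of "closure \<Omega>" "closure \<Omega>" "\<lambda>a. ball a (R a / 4)"]) (use R in force)+
  show ?thesis
  proof (rule approximable_cover[OF I(2) O _ s])
    fix x assume "x \<notin> (\<Union>a\<in>I. ball a (R a / 4))"
    then have "x \<notin> \<Omega>" using I(3) closure_subset by blast
    then show "u x = 0 \<and> g x = 0" using sobolevD(2,3)[OF s] by blast
  qed (use R I(1) in blast)
qed

subsection \<open>Borel representatives of functions in \<open>H\<^sup>1\<close>\<close>

lemma AE_lebesgue_on_iff:
  fixes \<Omega> :: "'a::euclidean_space set"
  assumes "open \<Omega>"
  shows "(AE x in lebesgue_on \<Omega>. P x) \<longleftrightarrow> (AE x in lborel. x \<in> \<Omega> \<longrightarrow> P x)"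
  using assms by (subst AE_restrict_space_iff) (auto simp: AE_completion_iff)

lemma borel_measurable_lebesgue_on:
  fixes f :: "'a::euclidean_space \<Rightarrow> 'b::topological_space"
  assumes "f \<in> borel_measurable borel"
  shows "f \<in> borel_measurable (lebesgue_on \<Omega>)"
  using assms by (intro measurable_restrict_space1 measurable_completion) simp

lemma lebesgue_on_borel_representative:
  fixes f :: "'a::euclidean_space \<Rightarrow> real"
  assumes O: "open \<Omega>" and f: "f \<in> borel_measurable (lebesgue_on \<Omega>)"
  shows "\<exists>v\<in>borel_measurable borel. (\<forall>x. x \<notin> \<Omega> \<longrightarrow> v x = 0) \<and> (AE x in lborel. x \<in> \<Omega> \<longrightarrow> f x = v x)"
proof -
  have "(\<lambda>x. if x \<in> \<Omega> then f x else 0) \<in> borel_measurable lebesgue"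
    using f O by (subst borel_measurable_if) auto
  then obtain v where v: "v \<in> borel_measurable lborel" "AE x in lborel. (if x \<in> \<Omega> then f x else 0) = v x"
    using completion_ex_borel_measurable_real by blast
  have [measurable]: "v \<in> borel_measurable borel" "\<Omega> \<in> sets borel" using v(1) O by auto
  show ?thesis
  proof (intro bexI conjI allI impI)
    show "(\<lambda>x. indicator \<Omega> x * v x) \<in> borel_measurable borel" by measurable
    show "AE x in lborel. x \<in> \<Omega> \<longrightarrow> f x = indicator \<Omega> x * v x"
      using v(2) by eventually_elim auto
  qed simp
qed

lemma lebesgue_on_integral_eq:
  fixes f v :: "'a::euclidean_space \<Rightarrow> real"
  assumes O: "open \<Omega>" and f: "f \<in> borel_measurable (lebesgue_on \<Omega>)" and v: "v \<in> borel_measurable borel"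
    and v0: "\<And>x. x \<notin> \<Omega> \<Longrightarrow> v x = 0" and eq: "AE x in lborel. x \<in> \<Omega> \<longrightarrow> f x = v x"
  shows "(LINT x|lebesgue_on \<Omega>. f x) = (LINT x|lborel. v x)"
    and "integrable (lebesgue_on \<Omega>) f \<longleftrightarrow> integrable lborel v"
proof -
  have vL: "v \<in> borel_measurable (lebesgue_on \<Omega>)" using v by (rule borel_measurable_lebesgue_on)
  have eq': "AE x in lebesgue_on \<Omega>. f x = v x" using eq by (simp add: AE_lebesgue_on_iff[OF O])
  have iv: "(\<lambda>x. indicator \<Omega> x *\<^sub>R v x) = v"
    using v0 by (intro ext) (auto simp: indicator_def)
  have [simp]: "\<Omega> \<in> sets lebesgue" using O by (simp add: sets_completionI_sets)
  have "(LINT x|lebesgue_on \<Omega>. f x) = (LINT x|lebesgue_on \<Omega>. v x)"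
    using f vL eq' by (rule integral_cong_AE)
  also have "\<dots> = (LINT x|lebesgue. indicator \<Omega> x *\<^sub>R v x)"
    by (rule integral_restrict_space) simp
  also have "\<dots> = (LINT x|lborel. v x)"
    unfolding iv using v by (intro integral_completion) simp
  finally show "(LINT x|lebesgue_on \<Omega>. f x) = (LINT x|lborel. v x)" .
  have "integrable (lebesgue_on \<Omega>) f \<longleftrightarrow> integrable (lebesgue_on \<Omega>) v"
    using f vL eq' by (rule integrable_cong_AE)
  also have "\<dots> \<longleftrightarrow> integrable lebesgue (\<lambda>x. indicator \<Omega> x *\<^sub>R v x)"
    by (rule integrable_restrict_space) simp
  also have "\<dots> \<longleftrightarrow> integrable lborel v"
    unfolding iv using v by (intro integrable_completion) simp
  finally show "integrable (lebesgue_on \<Omega>) f \<longleftrightarrow> integrable lborel v" .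
qed

lemma Lp_2_iff: "f \<in> Lp 2 M \<longleftrightarrow> square_integrable M f"
  by (simp add: Lp_def square_integrable_def)

lemma square_integrable_lebesgue_on_iff:
  fixes f v :: "'a::euclidean_space \<Rightarrow> real"
  assumes O: "open \<Omega>" and f: "f \<in> borel_measurable (lebesgue_on \<Omega>)" and v: "v \<in> borel_measurable borel"
    and v0: "\<And>x. x \<notin> \<Omega> \<Longrightarrow> v x = 0" and eq: "AE x in lborel. x \<in> \<Omega> \<longrightarrow> f x = v x"
  shows "square_integrable (lebesgue_on \<Omega>) f \<longleftrightarrow> square_integrable lborel v"
proof -
  have "integrable (lebesgue_on \<Omega>) (\<lambda>x. (f x)\<^sup>2) \<longleftrightarrow> integrable lborel (\<lambda>x. (v x)\<^sup>2)"
  proof (rule lebesgue_on_integral_eq(2)[OF O])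
    show "AE x in lborel. x \<in> \<Omega> \<longrightarrow> (f x)\<^sup>2 = (v x)\<^sup>2" using eq by eventually_elim auto
  qed (use f v v0 in auto)
  then show ?thesis using f v by (simp add: square_integrable_def)
qed

text \<open>The dictionary between \<open>H1\<close>, whose members are Lebesgue measurable on
  \<Omega> and arbitrary elsewhere, and the pairs of \<open>sobolev\<close>, for which the analysis
  is done.\<close>

definition represents :: "'a::euclidean_space set \<Rightarrow> ('a \<Rightarrow> real) \<Rightarrow> ('a \<Rightarrow> real) \<Rightarrow> ('a \<Rightarrow> 'a) \<Rightarrow> bool" where
  "represents \<Omega> u v h \<longleftrightarrow> u \<in> borel_measurable (lebesgue_on \<Omega>) \<and> sobolev \<Omega> v h \<and>
     (AE x in lborel. x \<in> \<Omega> \<longrightarrow> u x = v x)"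

lemma representsD:
  assumes "represents \<Omega> u v h"
  shows "u \<in> borel_measurable (lebesgue_on \<Omega>)" "sobolev \<Omega> v h" "AE x in lborel. x \<in> \<Omega> \<longrightarrow> u x = v x"
  using assms unfolding represents_def by blast+

lemma lebesgue_on_integral_mult_eq:
  fixes u v :: "'a::euclidean_space \<Rightarrow> real"
  assumes O: "open \<Omega>" and u: "u \<in> borel_measurable (lebesgue_on \<Omega>)" and v: "v \<in> borel_measurable borel"
    and v0: "\<And>x. x \<notin> \<Omega> \<Longrightarrow> v x = 0" and eq: "AE x in lborel. x \<in> \<Omega> \<longrightarrow> u x = v x"
    and k: "k \<in> borel_measurable borel"
  shows "(LINT x|lebesgue_on \<Omega>. u x * k x) = (LINT x|lborel. v x * k x)"
proof (rule lebesgue_on_integral_eq(1)[OF O])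
  show "AE x in lborel. x \<in> \<Omega> \<longrightarrow> u x * k x = v x * k x"
    using eq by (rule eventually_mono) simp
  show "(\<lambda>x. u x * k x) \<in> borel_measurable (lebesgue_on \<Omega>)"
    using u borel_measurable_lebesgue_on[OF k] by (rule borel_measurable_times)
  show "(\<lambda>x. v x * k x) \<in> borel_measurable borel"
    using v k by (rule borel_measurable_times)
qed (simp add: v0)

lemma has_L2_weak_gradient_representative:
  fixes u :: "'a::euclidean_space \<Rightarrow> real"
  assumes O: "open \<Omega>" and u: "u \<in> Lp 2 (lebesgue_on \<Omega>)" and g: "has_L2_weak_gradient \<Omega> u g"
  shows "\<exists>v h. represents \<Omega> u v h \<and> (AE x in lborel. x \<in> \<Omega> \<longrightarrow> g x = h x)"
proof -
  have um: "u \<in> borel_measurable (lebesgue_on \<Omega>)" using u by (simp add: Lp_def)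
  obtain v where v: "v \<in> borel_measurable borel" "\<And>x. x \<notin> \<Omega> \<Longrightarrow> v x = 0" "AE x in lborel. x \<in> \<Omega> \<longrightarrow> u x = v x"
    using lebesgue_on_borel_representative[OF O um] by blast
  have gm: "(\<lambda>x. g x \<bullet> b) \<in> borel_measurable (lebesgue_on \<Omega>)" if "b \<in> Basis" for b
    using g that by (auto simp: has_L2_weak_gradient_def Lp_def)
  have "\<forall>b\<in>Basis. \<exists>k. k \<in> borel_measurable borel \<and> (\<forall>x. x \<notin> \<Omega> \<longrightarrow> k x = 0) \<and>
      (AE x in lborel. x \<in> \<Omega> \<longrightarrow> g x \<bullet> b = k x)"
  proof
    fix b assume "b \<in> (Basis :: 'a set)"
    then show "\<exists>k. k \<in> borel_measurable borel \<and> (\<forall>x. x \<notin> \<Omega> \<longrightarrow> k x = 0) \<and>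
        (AE x in lborel. x \<in> \<Omega> \<longrightarrow> g x \<bullet> b = k x)"
      using lebesgue_on_borel_representative[OF O gm] unfolding Bex_def by blast
  qed
  \<comment> \<open>Measurability of the gradient is given by components, so a Borel version is
    chosen for each of them and \<open>h\<close> is reassembled from these.\<close>
  from bchoice[OF this] obtain k where k': "\<forall>b\<in>Basis. k b \<in> borel_measurable borel \<and>
      (\<forall>x. x \<notin> \<Omega> \<longrightarrow> k b x = 0) \<and> (AE x in lborel. x \<in> \<Omega> \<longrightarrow> g x \<bullet> b = k b x)" ..
  have k: "k b \<in> borel_measurable borel" "x \<notin> \<Omega> \<Longrightarrow> k b x = 0" "AE x in lborel. x \<in> \<Omega> \<longrightarrow> g x \<bullet> b = k b x"
    if "b \<in> Basis" for b x using k' that by blast+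
  define h where "h x = (\<Sum>b\<in>Basis. k b x *\<^sub>R b)" for x
  have h: "h x \<bullet> b = k b x" if "b \<in> Basis" for b x using that by (simp add: h_def)
  have "sobolev \<Omega> v h"
    unfolding sobolev_def
  proof (intro conjI ballI allI impI)
    show "square_integrable lborel v"
      using square_integrable_lebesgue_on_iff[OF O um v] u unfolding Lp_2_iff by blast
    fix b assume b: "b \<in> (Basis :: 'a set)"
    show "square_integrable lborel (\<lambda>x. h x \<bullet> b)"
    proof -
      have "square_integrable (lebesgue_on \<Omega>) (\<lambda>x. g x \<bullet> b)"
        using g b unfolding has_L2_weak_gradient_def Lp_2_iff by blast
      moreover have "square_integrable (lebesgue_on \<Omega>) (\<lambda>x. g x \<bullet> b) \<longleftrightarrow> square_integrable lborel (k b)"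
      proof (rule square_integrable_lebesgue_on_iff[OF O gm[OF b] k(1)[OF b]])
        show "k b x = 0" if "x \<notin> \<Omega>" for x using k(2)[OF b that] .
        show "AE x in lborel. x \<in> \<Omega> \<longrightarrow> g x \<bullet> b = k b x" using k(3)[OF b] .
      qed
      ultimately show ?thesis
        unfolding h[OF b] by blast
    qed
    fix \<phi> assume \<phi>: "\<phi> \<in> test_functions \<Omega>"
    note s\<phi> = test_functions_square_integrable[OF \<phi>, THEN square_integrable_measurable, simplified]
    show "(LINT x|lborel. v x * frechet_derivative \<phi> (at x) b) = - (LINT x|lborel. (h x \<bullet> b) * \<phi> x)"
    proof -
      have "(LINT x|lborel. v x * frechet_derivative \<phi> (at x) b) = (LINT x|lebesgue_on \<Omega>. u x * frechet_derivative \<phi> (at x) b)"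
        by (rule lebesgue_on_integral_mult_eq[OF O um v s\<phi>(2), symmetric])
      also have "\<dots> = - (LINT x|lebesgue_on \<Omega>. (g x \<bullet> b) * \<phi> x)"
        by (rule bspec[OF bspec[OF g[unfolded has_L2_weak_gradient_def] b, THEN conjunct2] \<phi>])
      also have "(LINT x|lebesgue_on \<Omega>. (g x \<bullet> b) * \<phi> x) = (LINT x|lborel. k b x * \<phi> x)"
        by (rule lebesgue_on_integral_mult_eq[OF O gm[OF b] k(1)[OF b] _ k(3)[OF b] s\<phi>(1)]) (rule k(2)[OF b])
      finally show ?thesis unfolding h[OF b] .
    qed
  next
    fix x assume "x \<notin> \<Omega>"
    then show "v x = 0" by (rule v(2))
    show "h x = 0" unfolding h_def using k(2)[OF _ \<open>x \<notin> \<Omega>\<close>] by (intro sum.neutral) simp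
  qed
  moreover have "AE x in lborel. x \<in> \<Omega> \<longrightarrow> g x = h x"
  proof -
    have "AE x in lborel. \<forall>b\<in>Basis. x \<in> \<Omega> \<longrightarrow> g x \<bullet> b = k b x"
      using k(3) by (subst AE_ball_countable) (simp_all add: countable_finite)
    then show ?thesis
    proof eventually_elim
      case (elim x)
      show ?case
      proof (rule impI, rule euclidean_eqI)
        fix b assume "x \<in> \<Omega>" and b: "b \<in> (Basis :: 'a set)"
        then show "g x \<bullet> b = h x \<bullet> b" unfolding h[OF b] using elim by blast
      qed
    qed
  qed
  ultimately show ?thesis using um v(3) unfolding represents_def by blast
qed

lemma represents_has_L2_weak_gradient:
  fixes u :: "'a::euclidean_space \<Rightarrow> real"
  assumes O: "open \<Omega>" and r: "represents \<Omega> u v h"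
  shows "u \<in> Lp 2 (lebesgue_on \<Omega>)" "has_L2_weak_gradient \<Omega> u h"
proof -
  have um: "u \<in> borel_measurable (lebesgue_on \<Omega>)" and s: "sobolev \<Omega> v h"
    and eq: "AE x in lborel. x \<in> \<Omega> \<longrightarrow> u x = v x" using representsD[OF r] by blast+
  have hm: "(\<lambda>x. h x \<bullet> b) \<in> borel_measurable borel" for b
    using sobolev_gradient_square_integrable[OF s] square_integrable_measurable by fastforce
  show "u \<in> Lp 2 (lebesgue_on \<Omega>)"
    using square_integrable_lebesgue_on_iff[OF O um sobolevD(4,2)[OF s] eq] sobolevD(1)[OF s]
    by (simp add: Lp_2_iff)
  have h0: "h x \<bullet> b = 0" if "x \<notin> \<Omega>" for x b using sobolevD(3)[OF s that] by simp
  show "has_L2_weak_gradient \<Omega> u h"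
    unfolding has_L2_weak_gradient_def
  proof (intro ballI conjI)
    fix b assume b: "b \<in> (Basis :: 'a set)"
    show "(\<lambda>x. h x \<bullet> b) \<in> Lp 2 (lebesgue_on \<Omega>)"
      unfolding Lp_2_iff
      by (rule iffD2[OF square_integrable_lebesgue_on_iff[OF O borel_measurable_lebesgue_on[OF hm] hm h0]])
        (auto intro: sobolev_gradient_square_integrable[OF s])
    fix \<phi> assume \<phi>: "\<phi> \<in> test_functions \<Omega>"
    note s\<phi> = test_functions_square_integrable[OF \<phi>, THEN square_integrable_measurable, simplified]
    show "(LINT x|lebesgue_on \<Omega>. u x * partial_deriv b \<phi> x) = - (LINT x|lebesgue_on \<Omega>. (h x \<bullet> b) * \<phi> x)"
    proof -
      have "(LINT x|lebesgue_on \<Omega>. u x * frechet_derivative \<phi> (at x) b) = (LINT x|lborel. v x * frechet_derivative \<phi> (at x) b)"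
        by (rule lebesgue_on_integral_mult_eq[OF O um sobolevD(4,2)[OF s] eq s\<phi>(2)])
      also have "\<dots> = - (LINT x|lborel. (h x \<bullet> b) * \<phi> x)"
        by (rule sobolev_integration_by_parts[OF s \<phi>])
      also have "(LINT x|lborel. (h x \<bullet> b) * \<phi> x) = (LINT x|lebesgue_on \<Omega>. (h x \<bullet> b) * \<phi> x)"
        by (rule lebesgue_on_integral_mult_eq[OF O borel_measurable_lebesgue_on[OF hm] hm h0 _ s\<phi>(1), symmetric]) simp_all
      finally show ?thesis .
    qed
  qed
qed

lemma represents_H1: "open \<Omega> \<Longrightarrow> represents \<Omega> u v h \<Longrightarrow> u \<in> H1 \<Omega>"
  unfolding H1_def using represents_has_L2_weak_gradient by blast

lemma H1_represents: "open \<Omega> \<Longrightarrow> u \<in> H1 \<Omega> \<Longrightarrow> \<exists>v h. represents \<Omega> u v h"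
  unfolding H1_def using has_L2_weak_gradient_representative by blast

lemma represents_unique:
  assumes O: "open \<Omega>" and 1: "represents \<Omega> u v h" and 2: "represents \<Omega> u' v' h'"
    and eq: "AE x in lborel. x \<in> \<Omega> \<longrightarrow> u x = u' x"
  shows "AE x in lborel. v x = v' x" "AE x in lborel. h x = h' x"
proof -
  note s = representsD(2)[OF 1] representsD(2)[OF 2]
  from eq representsD(3)[OF 1] representsD(3)[OF 2] show *: "AE x in lborel. v x = v' x"
  proof eventually_elim
    case (elim x)
    then show ?case using sobolevD(2)[OF s(1), of x] sobolevD(2)[OF s(2), of x] by (cases "x \<in> \<Omega>") auto
  qed
  show "AE x in lborel. h x = h' x" by (rule sobolev_gradient_unique[OF O s *])
qed

text \<open>\<open>weak_grad\<close> picks some weak gradient by choice. Uniqueness up to null sets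
  identifies it with the given \<open>h\<close>, and measurability comes from its being a weak
  gradient at all.\<close>

lemma represents_weak_grad:
  fixes u :: "'a::euclidean_space \<Rightarrow> real"
  assumes O: "open \<Omega>" and r: "represents \<Omega> u v h"
  shows "AE x in lborel. x \<in> \<Omega> \<longrightarrow> weak_grad \<Omega> u x = h x"
    and "weak_grad \<Omega> u \<in> borel_measurable (lebesgue_on \<Omega>)"
proof -
  have wg: "has_L2_weak_gradient \<Omega> u (weak_grad \<Omega> u)"
    unfolding weak_grad_def
    by (rule someI[of "has_L2_weak_gradient \<Omega> u", OF represents_has_L2_weak_gradient(2)[OF O r]])
  obtain v' h' where r': "represents \<Omega> u v' h'" and h': "AE x in lborel. x \<in> \<Omega> \<longrightarrow> weak_grad \<Omega> u x = h' x"
    using has_L2_weak_gradient_representative[OF O represents_has_L2_weak_gradient(1)[OF O r] wg] by blast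
  from represents_unique(2)[OF O r' r] h'
  show "AE x in lborel. x \<in> \<Omega> \<longrightarrow> weak_grad \<Omega> u x = h x" by auto
  have "(\<lambda>x. weak_grad \<Omega> u x \<bullet> b) \<in> borel_measurable (lebesgue_on \<Omega>)" if "b \<in> Basis" for b
    using wg that by (auto simp: has_L2_weak_gradient_def Lp_def)
  then show "weak_grad \<Omega> u \<in> borel_measurable (lebesgue_on \<Omega>)"
    by (subst borel_measurable_euclidean_space) auto
qed

lemma represents_A_op:
  fixes u u' :: "'a::euclidean_space \<Rightarrow> real"
  assumes O: "open \<Omega>" and 1: "represents \<Omega> u v h" and 2: "represents \<Omega> u' v' h'"
  shows "A_op \<Omega> \<sigma> u u' = (LINT x|lborel. h x \<bullet> h' x + \<sigma> * v x * v' x)"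
  unfolding A_op_def
proof (rule lebesgue_on_integral_eq(1)[OF O])
  note s = representsD(2)[OF 1] representsD(2)[OF 2]
  note [measurable] = sobolevD(4)[OF s(1)] sobolevD(4)[OF s(2)] sobolev_gradient_measurable[OF s(1)]
    sobolev_gradient_measurable[OF s(2)] represents_weak_grad(2)[OF O 1] represents_weak_grad(2)[OF O 2]
  note [measurable] = representsD(1)[OF 1] representsD(1)[OF 2]
  show "(\<lambda>x. weak_grad \<Omega> u x \<bullet> weak_grad \<Omega> u' x + \<sigma> * u x * u' x) \<in> borel_measurable (lebesgue_on \<Omega>)"
    by measurable
  show "(\<lambda>x. h x \<bullet> h' x + \<sigma> * v x * v' x) \<in> borel_measurable borel" by measurable
  from representsD(3)[OF 1] representsD(3)[OF 2] represents_weak_grad(1)[OF O 1] represents_weak_grad(1)[OF O 2]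
  show "AE x in lborel. x \<in> \<Omega> \<longrightarrow> weak_grad \<Omega> u x \<bullet> weak_grad \<Omega> u' x + \<sigma> * u x * u' x = h x \<bullet> h' x + \<sigma> * v x * v' x"
    by eventually_elim auto
  show "h x \<bullet> h' x + \<sigma> * v x * v' x = 0" if "x \<notin> \<Omega>" for x
    using sobolevD(2,3)[OF s(1) that] by simp
qed

lemma sobolev_gradient_inner_integrable:
  fixes h h' :: "'a::euclidean_space \<Rightarrow> 'a"
  assumes "sobolev \<Omega> v h" "sobolev \<Omega> v' h'"
  shows "integrable lborel (\<lambda>x. h x \<bullet> h' x)"
proof -
  have eq: "(\<lambda>x. h x \<bullet> h' x) = (\<lambda>x. \<Sum>b\<in>Basis. (h x \<bullet> b) * (h' x \<bullet> b))"
    by (rule ext) (rule euclidean_inner)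
  show ?thesis
    unfolding eq
    by (intro Bochner_Integration.integrable_sum square_integrable_mult_integrable
        sobolev_gradient_square_integrable[OF assms(1)] sobolev_gradient_square_integrable[OF assms(2)])
qed

lemma represents_H1_norm:
  fixes u :: "'a::euclidean_space \<Rightarrow> real"
  assumes O: "open \<Omega>" and r: "represents \<Omega> u v h"
  shows "H1_norm \<Omega> u = sqrt (sobolev_sq v h)"
proof -
  note s = representsD(2)[OF r]
  \<comment> \<open>The squared H^1 norm is the bilinear form with \<open>\<sigma> = 1\<close> on
    the diagonal, so the transfer to representatives is already available.\<close>
  have "H1_norm \<Omega> u = sqrt (A_op \<Omega> 1 u u)"
    by (simp add: H1_norm_def A_op_def power2_eq_square add.commute)
  also have "A_op \<Omega> 1 u u = (LINT x|lborel. h x \<bullet> h x + (v x)\<^sup>2)"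
    by (simp add: represents_A_op[OF O r r] power2_eq_square)
  also have "\<dots> = (LINT x|lborel. h x \<bullet> h x) + sq_integral lborel v"
    using sobolev_gradient_inner_integrable[OF s s] sobolevD(1)[OF s]
    by (simp add: sq_integral_def square_integrable_def)
  also have "(LINT x|lborel. h x \<bullet> h x) = (LINT x|lborel. (\<Sum>b\<in>Basis. (h x \<bullet> b)\<^sup>2))"
    unfolding power2_eq_square
    by (rule Bochner_Integration.integral_cong[OF refl]) (rule euclidean_inner)
  also have "\<dots> = (\<Sum>b\<in>Basis. sq_integral lborel (\<lambda>x. h x \<bullet> b))"
    unfolding sq_integral_def using sobolev_gradient_square_integrable[OF s]
    by (intro Bochner_Integration.integral_sum) (auto simp: square_integrable_def)
  finally show ?thesis by (simp add: sobolev_sq_def add.commute)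
qed

lemma represents_add:
  assumes 1: "represents \<Omega> u v h" and 2: "represents \<Omega> u' v' h'"
  shows "represents \<Omega> (\<lambda>x. u x + u' x) (\<lambda>x. v x + v' x) (\<lambda>x. h x + h' x)"
  unfolding represents_def
proof (intro conjI)
  show "(\<lambda>x. u x + u' x) \<in> borel_measurable (lebesgue_on \<Omega>)"
    using representsD(1)[OF 1] representsD(1)[OF 2] by (rule borel_measurable_add)
  show "AE x in lborel. x \<in> \<Omega> \<longrightarrow> u x + u' x = v x + v' x"
    using representsD(3)[OF 1] representsD(3)[OF 2] by eventually_elim simp
qed (rule sobolev_add[OF representsD(2)[OF 1] representsD(2)[OF 2]])

lemma represents_cmult:
  assumes 1: "represents \<Omega> u v h"
  shows "represents \<Omega> (\<lambda>x. c * u x) (\<lambda>x. c * v x) (\<lambda>x. c *\<^sub>R h x)"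
  unfolding represents_def
proof (intro conjI)
  show "(\<lambda>x. c * u x) \<in> borel_measurable (lebesgue_on \<Omega>)"
    using borel_measurable_const representsD(1)[OF 1] by (rule borel_measurable_times)
  show "AE x in lborel. x \<in> \<Omega> \<longrightarrow> c * u x = c * v x"
    using representsD(3)[OF 1] by eventually_elim simp
qed (rule sobolev_cmult[OF representsD(2)[OF 1]])

lemma represents_diff:
  assumes 1: "represents \<Omega> u v h" and 2: "represents \<Omega> u' v' h'"
  shows "represents \<Omega> (\<lambda>x. u x - u' x) (\<lambda>x. v x - v' x) (\<lambda>x. h x - h' x)"
  using represents_add[OF 1 represents_cmult[OF 2, of "-1"]] by simp

lemma represents_continuous:
  fixes U :: "'a::euclidean_space \<Rightarrow> real"
  assumes "continuous_on UNIV U" "sobolev \<Omega> (\<lambda>x. indicator \<Omega> x * U x) G"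
  shows "represents \<Omega> U (\<lambda>x. indicator \<Omega> x * U x) G"
  using assms(2) borel_measurable_lebesgue_on[OF borel_measurable_continuous_onI[OF assms(1)]]
  by (simp add: represents_def)

subsection \<open>Traces\<close>

lemma trace_square_integrable:
  "trace_operator \<Omega> T \<Longrightarrow> u \<in> H1 \<Omega> \<Longrightarrow> square_integrable (boundary_measure \<Omega>) (T u)"
  unfolding trace_operator_def Lp_2_iff by blast

lemma trace_continuous:
  assumes T: "trace_operator \<Omega> T" and u: "u \<in> H1 \<Omega>" and c: "continuous_on (closure \<Omega>) u"
  shows "AE x in boundary_measure \<Omega>. T u x = u x"
proof -
  from T have "\<forall>u\<in>H1 \<Omega>. continuous_on (closure \<Omega>) u \<longrightarrow> (AE x in boundary_measure \<Omega>. T u x = u x)"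
    unfolding trace_operator_def by (elim conjE)
  from this[rule_format, OF u c] show ?thesis .
qed

lemma trace_diff:
  assumes T: "trace_operator \<Omega> T" and O: "open \<Omega>" and u: "u \<in> H1 \<Omega>" and v: "v \<in> H1 \<Omega>"
  shows "AE x in boundary_measure \<Omega>. T (\<lambda>y. u y - v y) x = T u x - T v x"
proof -
  obtain v' h' where "represents \<Omega> v v' h'" using H1_represents[OF O v] by blast
  then have mv: "(\<lambda>y. - 1 * v y) \<in> H1 \<Omega>" using represents_H1[OF O represents_cmult] by blast
  have "AE x in boundary_measure \<Omega>. T (\<lambda>y. u y + - 1 * v y) x = T u x + T (\<lambda>y. - 1 * v y) x"
  proof -
    from T have "\<forall>u\<in>H1 \<Omega>. \<forall>v\<in>H1 \<Omega>. AE x in boundary_measure \<Omega>. T (\<lambda>y. u y + v y) x = T u x + T v x"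
      unfolding trace_operator_def by (elim conjE)
    from this[rule_format, OF u mv] show ?thesis .
  qed
  moreover have "AE x in boundary_measure \<Omega>. T (\<lambda>y. - 1 * v y) x = - 1 * T v x"
  proof -
    from T have "\<forall>c. \<forall>u\<in>H1 \<Omega>. AE x in boundary_measure \<Omega>. T (\<lambda>y. c * u y) x = c * T u x"
      unfolding trace_operator_def by (elim conjE)
    from this[rule_format, OF v] show ?thesis .
  qed
  ultimately show ?thesis by eventually_elim simp
qed

lemma trace_bound:
  assumes T: "trace_operator \<Omega> T" and O: "open \<Omega>"
  obtains C where "\<And>u v h. represents \<Omega> u v h \<Longrightarrow> sq_integral (boundary_measure \<Omega>) (T u) \<le> C * sobolev_sq v h"
proof -
  obtain C where C: "\<And>u. u \<in> H1 \<Omega> \<Longrightarrow> L2_norm (boundary_measure \<Omega>) (T u) \<le> C * H1_norm \<Omega> u"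
    using T unfolding trace_operator_def by blast
  show ?thesis
  proof (rule that[of "C\<^sup>2"])
    fix u v h assume r: "represents \<Omega> u v h"
    have nn: "sobolev_sq v h \<ge> 0" by (simp add: sobolev_sq_def sum_nonneg)
    have "sqrt (sq_integral (boundary_measure \<Omega>) (T u)) \<le> C * sqrt (sobolev_sq v h)"
      using C[OF represents_H1[OF O r]] represents_H1_norm[OF O r] by (simp add: L2_norm_def sq_integral_def)
    then have "(sqrt (sq_integral (boundary_measure \<Omega>) (T u)))\<^sup>2 \<le> (C * sqrt (sobolev_sq v h))\<^sup>2"
      by (intro power_mono) auto
    then show "sq_integral (boundary_measure \<Omega>) (T u) \<le> C\<^sup>2 * sobolev_sq v h"
      using nn by (simp add: power_mult_distrib)
  qed
qed

text \<open>A trace operator acts on functions rather than on classes. Boundedness makes it respect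
  almost everywhere equality: the difference has H^1 norm 0, hence trace 0.\<close>

lemma trace_AE_cong:
  assumes T: "trace_operator \<Omega> T" and O: "open \<Omega>" and u: "u \<in> H1 \<Omega>" and u': "u' \<in> H1 \<Omega>"
    and eq: "AE x in lborel. x \<in> \<Omega> \<longrightarrow> u x = u' x"
  shows "AE x in boundary_measure \<Omega>. T u x = T u' x"
proof -
  obtain v h where r: "represents \<Omega> u v h" using H1_represents[OF O u] by blast
  obtain v' h' where r': "represents \<Omega> u' v' h'" using H1_represents[OF O u'] by blast
  note rd = represents_diff[OF r r']
  note s = representsD(2)[OF rd]
  obtain C where C: "\<And>u v h. represents \<Omega> u v h \<Longrightarrow> sq_integral (boundary_measure \<Omega>) (T u) \<le> C * sobolev_sq v h"
    using trace_bound[OF T O] by blast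
  have "AE x in lborel. v x - v' x = 0"
    using represents_unique(1)[OF O r r' eq] by eventually_elim simp
  then have 1: "sq_integral lborel (\<lambda>x. v x - v' x) = 0"
    using sq_integral_zero_iff[OF sobolevD(1)[OF s]] by blast
  have 2: "sq_integral lborel (\<lambda>x. (h x - h' x) \<bullet> b) = 0" for b
  proof -
    have "AE x in lborel. (h x - h' x) \<bullet> b = 0"
      using represents_unique(2)[OF O r r' eq] by eventually_elim simp
    then show ?thesis using sq_integral_zero_iff[OF sobolev_gradient_square_integrable[OF s]] by blast
  qed
  have "sobolev_sq (\<lambda>x. v x - v' x) (\<lambda>x. h x - h' x) = 0"
    unfolding sobolev_sq_def 1 2 by simp
  then have "sq_integral (boundary_measure \<Omega>) (T (\<lambda>x. u x - u' x)) = 0"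
    using C[OF rd] sq_integral_nonneg[of "boundary_measure \<Omega>" "T (\<lambda>x. u x - u' x)"] by simp
  then have "AE x in boundary_measure \<Omega>. T (\<lambda>x. u x - u' x) x = 0"
    using sq_integral_zero_iff[OF trace_square_integrable[OF T represents_H1[OF O rd]]] by blast
  with trace_diff[OF T O u u'] show ?thesis by eventually_elim simp
qed

section \<open>Composition with C^1 functions whose derivative is bounded and Lipschitz, and its
  effect on traces\<close>

locale truncation =
  fixes \<Phi> \<Phi>' :: "real \<Rightarrow> real" and M L :: real
  assumes zero: "\<Phi> 0 = 0" and der: "\<And>t. (\<Phi> has_real_derivative \<Phi>' t) (at t)"
    and bound: "\<And>t. \<bar>\<Phi>' t\<bar> \<le> M" and lipschitz: "\<And>s t. \<bar>\<Phi>' s - \<Phi>' t\<bar> \<le> L * \<bar>s - t\<bar>"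
begin

lemma continuous_\<Phi>: "continuous_on UNIV \<Phi>"
  using der by (meson DERIV_isCont continuous_at_imp_continuous_on)

lemma continuous_\<Phi>': "continuous_on UNIV \<Phi>'"
proof (rule lipschitz_on_continuous_on)
  have "L \<ge> 0" using lipschitz[of 1 0] abs_ge_zero[of "\<Phi>' 1 - \<Phi>' 0"] by simp
  then show "L-lipschitz_on UNIV \<Phi>'" using lipschitz by (intro lipschitz_onI) (simp_all add: dist_real_def)
qed

lemma measurable_\<Phi> [measurable]: "\<Phi> \<in> borel_measurable borel" "\<Phi>' \<in> borel_measurable borel"
  using continuous_\<Phi> continuous_\<Phi>' by (auto intro: borel_measurable_continuous_onI)

lemma \<Phi>_lipschitz: "\<bar>\<Phi> s - \<Phi> t\<bar> \<le> M * \<bar>s - t\<bar>"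
proof -
  have "norm (\<Phi> s - \<Phi> t) \<le> M * norm (s - t)"
    by (rule field_differentiable_bound[of UNIV \<Phi> \<Phi>']) (simp_all add: der bound)
  then show ?thesis by simp
qed

lemma M_nonneg: "M \<ge> 0"
  using bound[of 0] abs_ge_zero[of "\<Phi>' 0"] by linarith

lemma sobolev_truncation:
  "open \<Omega> \<Longrightarrow> sobolev \<Omega> v h \<Longrightarrow> sobolev \<Omega> (\<lambda>x. \<Phi> (v x)) (\<lambda>x. \<Phi>' (v x) *\<^sub>R h x)"
  using sobolev_chain_rule[OF _ _ zero der bound lipschitz] by blast

lemma represents_truncation:
  assumes O: "open \<Omega>" and r: "represents \<Omega> u v h"
  shows "represents \<Omega> (\<lambda>x. \<Phi> (u x)) (\<lambda>x. \<Phi> (v x)) (\<lambda>x. \<Phi>' (v x) *\<^sub>R h x)"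
  unfolding represents_def
proof (intro conjI)
  show "(\<lambda>x. \<Phi> (u x)) \<in> borel_measurable (lebesgue_on \<Omega>)"
    using representsD(1)[OF r] measurable_\<Phi>(1) by (rule measurable_compose)
  show "AE x in lborel. x \<in> \<Omega> \<longrightarrow> \<Phi> (u x) = \<Phi> (v x)"
    using representsD(3)[OF r] by eventually_elim simp
qed (rule sobolev_truncation[OF O representsD(2)[OF r]])

text \<open>The function part follows from the Lipschitz bound for \<Phi>. In the gradient part the
  coefficient \<Phi>'(v_k) varies with \<open>k\<close> and multiplies an unbounded gradient, so
  pointwise convergence and dominated convergence are used; hence the assumption
  \<open>AE_lim\<close>.\<close>

lemma sobolev_truncation_tendsto:
  fixes v :: "'a::euclidean_space \<Rightarrow> real"
  assumes O: "open \<Omega>" and s: "sobolev \<Omega> v h" and sk: "\<And>k. sobolev \<Omega> (vk k) (hk k)"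
    and lim: "(\<lambda>k. sobolev_sq (\<lambda>x. vk k x - v x) (\<lambda>x. hk k x - h x)) \<longlonglongrightarrow> 0"
    and AE_lim: "AE x in lborel. (\<lambda>k. vk k x) \<longlonglongrightarrow> v x"
  shows "(\<lambda>k. sobolev_sq (\<lambda>x. \<Phi> (vk k x) - \<Phi> (v x)) (\<lambda>x. \<Phi>' (vk k x) *\<^sub>R hk k x - \<Phi>' (v x) *\<^sub>R h x)) \<longlonglongrightarrow> 0"
proof -
  note [measurable] = sobolevD(4)[OF s] sobolevD(4)[OF sk] sobolev_gradient_measurable[OF s] sobolev_gradient_measurable[OF sk]
  have le1: "sq_integral lborel (\<lambda>x. vk k x - v x) \<le> sobolev_sq (\<lambda>x. vk k x - v x) (\<lambda>x. hk k x - h x)" for k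
    by (simp add: sobolev_sq_def sum_nonneg)
  have le2: "sq_integral lborel (\<lambda>x. (hk k x - h x) \<bullet> b) \<le> sobolev_sq (\<lambda>x. vk k x - v x) (\<lambda>x. hk k x - h x)"
    if "b \<in> Basis" for k b
  proof -
    have "sq_integral lborel (\<lambda>x. (hk k x - h x) \<bullet> b) \<le> (\<Sum>b\<in>Basis. sq_integral lborel (\<lambda>x. (hk k x - h x) \<bullet> b))"
      using that by (intro member_le_sum[of b Basis "\<lambda>b. sq_integral lborel (\<lambda>x. (hk k x - h x) \<bullet> b)"]) simp_all
    also have "\<dots> \<le> sobolev_sq (\<lambda>x. vk k x - v x) (\<lambda>x. hk k x - h x)"
      by (simp add: sobolev_sq_def)
    finally show ?thesis .
  qed
  have lim1: "(\<lambda>k. sq_integral lborel (\<lambda>x. \<Phi> (vk k x) - \<Phi> (v x))) \<longlonglongrightarrow> 0"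
  proof (rule Lim_null_comparison[OF always_eventually])
    show "(\<lambda>k. M\<^sup>2 * sobolev_sq (\<lambda>x. vk k x - v x) (\<lambda>x. hk k x - h x)) \<longlonglongrightarrow> 0"
      using lim by (rule tendsto_mult_right_zero)
    show "\<forall>k. norm (sq_integral lborel (\<lambda>x. \<Phi> (vk k x) - \<Phi> (v x)))
        \<le> M\<^sup>2 * sobolev_sq (\<lambda>x. vk k x - v x) (\<lambda>x. hk k x - h x)"
    proof
      fix k
      have "sq_integral lborel (\<lambda>x. \<Phi> (vk k x) - \<Phi> (v x)) \<le> sq_integral lborel (\<lambda>x. M * (vk k x - v x))"
      proof (rule sq_integral_mono)
        show "square_integrable lborel (\<lambda>x. M * (vk k x - v x))"
          using sobolevD(1)[OF sk] sobolevD(1)[OF s] by (intro square_integrable_cmult square_integrable_diff)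
        show "AE x in lborel. \<bar>\<Phi> (vk k x) - \<Phi> (v x)\<bar> \<le> \<bar>M * (vk k x - v x)\<bar>"
          using \<Phi>_lipschitz M_nonneg by (intro always_eventually) (simp add: abs_mult)
      qed measurable
      also have "\<dots> \<le> M\<^sup>2 * sobolev_sq (\<lambda>x. vk k x - v x) (\<lambda>x. hk k x - h x)"
        unfolding sq_integral_cmult using le1 by (intro mult_left_mono) auto
      finally show "norm (sq_integral lborel (\<lambda>x. \<Phi> (vk k x) - \<Phi> (v x)))
          \<le> M\<^sup>2 * sobolev_sq (\<lambda>x. vk k x - v x) (\<lambda>x. hk k x - h x)" by simp
    qed
  qed
  have lim2: "(\<lambda>k. sq_integral lborel (\<lambda>x. (\<Phi>' (vk k x) *\<^sub>R hk k x - \<Phi>' (v x) *\<^sub>R h x) \<bullet> b)) \<longlonglongrightarrow> 0"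
    if b: "b \<in> Basis" for b
  proof -
    note sg = sobolev_gradient_square_integrable[OF s, of b] and sgk = sobolev_gradient_square_integrable[OF sk, of _ b]
    have sd: "square_integrable lborel (\<lambda>x. (hk k x - h x) \<bullet> b)" for k
      using square_integrable_diff[OF sgk sg] by (simp add: inner_diff_left)
    have s1: "square_integrable lborel (\<lambda>x. \<Phi>' (vk k x) * ((hk k x - h x) \<bullet> b))" for k
    proof (rule square_integrable_bounded_mult[OF sd])
      show "(\<lambda>x. \<Phi>' (vk k x)) \<in> borel_measurable lborel" by measurable
      show "AE x in lborel. \<bar>\<Phi>' (vk k x)\<bar> \<le> M" by (simp add: bound)
    qed
    have sf: "square_integrable lborel (\<lambda>x. \<Phi>' (w x) * (h x \<bullet> b))" if "w \<in> borel_measurable borel" for w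
    proof (rule square_integrable_bounded_mult[OF sg])
      show "(\<lambda>x. \<Phi>' (w x)) \<in> borel_measurable lborel" using that by simp
      show "AE x in lborel. \<bar>\<Phi>' (w x)\<bar> \<le> M" by (simp add: bound)
    qed
    have s2: "square_integrable lborel (\<lambda>x. \<Phi>' (vk k x) * (h x \<bullet> b) - \<Phi>' (v x) * (h x \<bullet> b))" for k
      by (intro square_integrable_diff sf) measurable
    have lim3: "(\<lambda>k. sq_integral lborel (\<lambda>x. \<Phi>' (vk k x) * (h x \<bullet> b) - \<Phi>' (v x) * (h x \<bullet> b))) \<longlonglongrightarrow> 0"
    proof (rule sq_integral_tendsto_dominated[where g = "\<lambda>x. 2 * M * (h x \<bullet> b)"])
      show "square_integrable lborel (\<lambda>x. 2 * M * (h x \<bullet> b))" using sg by (rule square_integrable_cmult)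
      show "AE x in lborel. (\<lambda>k. \<Phi>' (vk k x) * (h x \<bullet> b)) \<longlonglongrightarrow> \<Phi>' (v x) * (h x \<bullet> b)"
        using AE_lim
      proof eventually_elim
        case (elim x)
        have "isCont \<Phi>' (v x)" using continuous_\<Phi>' by (simp add: continuous_on_eq_continuous_at)
        then show ?case using elim by (intro tendsto_mult tendsto_const) (rule isCont_tendsto_compose)
      qed
      show "AE x in lborel. \<bar>\<Phi>' (vk k x) * (h x \<bullet> b) - \<Phi>' (v x) * (h x \<bullet> b)\<bar> \<le> \<bar>2 * M * (h x \<bullet> b)\<bar>" for k
      proof (intro always_eventually allI)
        fix x
        have "\<bar>\<Phi>' (vk k x) - \<Phi>' (v x)\<bar> \<le> 2 * M" using bound[of "vk k x"] bound[of "v x"] by linarith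
        then have "\<bar>\<Phi>' (vk k x) - \<Phi>' (v x)\<bar> * \<bar>h x \<bullet> b\<bar> \<le> 2 * M * \<bar>h x \<bullet> b\<bar>" by (rule mult_right_mono) simp
        then show "\<bar>\<Phi>' (vk k x) * (h x \<bullet> b) - \<Phi>' (v x) * (h x \<bullet> b)\<bar> \<le> \<bar>2 * M * (h x \<bullet> b)\<bar>"
          using M_nonneg by (simp add: abs_mult flip: left_diff_distrib)
      qed
    qed measurable
    show ?thesis
    proof (rule Lim_null_comparison[OF always_eventually])
      let ?B = "\<lambda>k. 2 * (M\<^sup>2 * sobolev_sq (\<lambda>x. vk k x - v x) (\<lambda>x. hk k x - h x)) +
        2 * sq_integral lborel (\<lambda>x. \<Phi>' (vk k x) * (h x \<bullet> b) - \<Phi>' (v x) * (h x \<bullet> b))"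
      show "?B \<longlonglongrightarrow> 0"
        using tendsto_add[OF tendsto_mult_right_zero[OF tendsto_mult_right_zero[OF lim], of 2 "M\<^sup>2"]
            tendsto_mult_right_zero[OF lim3, of 2]] by simp
      show "\<forall>k. norm (sq_integral lborel (\<lambda>x. (\<Phi>' (vk k x) *\<^sub>R hk k x - \<Phi>' (v x) *\<^sub>R h x) \<bullet> b)) \<le> ?B k"
      proof
        fix k
        \<comment> \<open>The first summand is small because \<Phi>' is bounded and the gradients
          converge; the second has the fixed gradient \<open>h\<close> and is dominated by
          \<open>2 * M * (h x \<bullet> b)\<close> in absolute value.\<close>
        have eq: "(\<lambda>x. (\<Phi>' (vk k x) *\<^sub>R hk k x - \<Phi>' (v x) *\<^sub>R h x) \<bullet> b) =
            (\<lambda>x. \<Phi>' (vk k x) * ((hk k x - h x) \<bullet> b) + (\<Phi>' (vk k x) * (h x \<bullet> b) - \<Phi>' (v x) * (h x \<bullet> b)))"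
          by (rule ext) (simp add: inner_diff_left right_diff_distrib)
        have "sq_integral lborel (\<lambda>x. \<Phi>' (vk k x) * ((hk k x - h x) \<bullet> b)) \<le> sq_integral lborel (\<lambda>x. M * ((hk k x - h x) \<bullet> b))"
        proof (rule sq_integral_mono)
          show "square_integrable lborel (\<lambda>x. M * ((hk k x - h x) \<bullet> b))" using sd by (rule square_integrable_cmult)
          show "AE x in lborel. \<bar>\<Phi>' (vk k x) * ((hk k x - h x) \<bullet> b)\<bar> \<le> \<bar>M * ((hk k x - h x) \<bullet> b)\<bar>"
            using bound M_nonneg by (intro always_eventually allI) (simp add: abs_mult mult_right_mono)
        qed measurable
        also have "\<dots> \<le> M\<^sup>2 * sobolev_sq (\<lambda>x. vk k x - v x) (\<lambda>x. hk k x - h x)"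
          unfolding sq_integral_cmult using le2[OF b] by (intro mult_left_mono) auto
        finally have "sq_integral lborel (\<lambda>x. (\<Phi>' (vk k x) *\<^sub>R hk k x - \<Phi>' (v x) *\<^sub>R h x) \<bullet> b) \<le> ?B k"
          unfolding eq using sq_integral_add_le[OF s1[of k] s2[of k]] by linarith
        then show "norm (sq_integral lborel (\<lambda>x. (\<Phi>' (vk k x) *\<^sub>R hk k x - \<Phi>' (v x) *\<^sub>R h x) \<bullet> b)) \<le> ?B k"
          by simp
      qed
    qed
  qed
  have "(\<lambda>k. sobolev_sq (\<lambda>x. \<Phi> (vk k x) - \<Phi> (v x)) (\<lambda>x. \<Phi>' (vk k x) *\<^sub>R hk k x - \<Phi>' (v x) *\<^sub>R h x))
      \<longlonglongrightarrow> 0 + (\<Sum>b\<in>(Basis :: 'a set). 0)"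
    unfolding sobolev_sq_def using lim1 lim2 by (intro tendsto_add tendsto_sum)
  then show ?thesis by simp
qed

text \<open>For continuous \<open>U\<close> the traces of \<open>U\<close> and \<Phi>(U) are their
  boundary values. Where the trace of \<open>u\<close> is 0, \<open>U\<close> coincides with the
  trace of \<open>U - u\<close>, and |\<Phi>(U)| is at most \<open>M\<close> times its absolute
  value. So the trace of \<Phi>(u) there is bounded by traces of two differences that are small in
  H^1.\<close>

lemma trace_truncation_zero:
  fixes \<Omega> :: "'a::euclidean_space set"
  assumes D: "bounded_lipschitz_domain \<Omega>" and T: "trace_operator \<Omega> T" and u: "u \<in> H1 \<Omega>"
  shows "AE x in boundary_measure \<Omega>. T u x = 0 \<longrightarrow> T (\<lambda>y. \<Phi> (u y)) x = 0"
proof -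
  have O: "open \<Omega>" using D by (simp add: bounded_lipschitz_domain_def)
  let ?B = "boundary_measure \<Omega>"
  obtain v h where r: "represents \<Omega> u v h" using H1_represents[OF O u] by blast
  note s = representsD(2)[OF r]
  obtain C where C: "\<And>u v h. represents \<Omega> u v h \<Longrightarrow> sq_integral ?B (T u) \<le> C * sobolev_sq v h"
    using trace_bound[OF T O] by blast
  have "\<exists>U G. continuous_on UNIV U \<and> sobolev \<Omega> (\<lambda>x. indicator \<Omega> x * U x) G \<and>
     sobolev_sq (\<lambda>x. indicator \<Omega> x * U x - v x) (\<lambda>x. G x - h x) < inverse (real (Suc n))" for n
    using sobolev_approximable[OF D s, unfolded approximable_def, rule_format, of "inverse (real (Suc n))"] by simp
  then obtain U G where U: "\<And>n::nat. continuous_on UNIV (U n)" "\<And>n. sobolev \<Omega> (\<lambda>x. indicator \<Omega> x * U n x) (G n)"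
     "\<And>n. sobolev_sq (\<lambda>x. indicator \<Omega> x * U n x - v x) (\<lambda>x. G n x - h x) < inverse (real (Suc n))"
    by metis
  have nn: "sobolev_sq a b \<ge> 0" for a :: "'a \<Rightarrow> real" and b by (simp add: sobolev_sq_def sum_nonneg)
  have lim: "(\<lambda>n. sobolev_sq (\<lambda>x. indicator \<Omega> x * U n x - v x) (\<lambda>x. G n x - h x)) \<longlonglongrightarrow> 0"
    by (rule Lim_null_comparison[OF always_eventually LIMSEQ_inverse_real_of_nat])
      (use U(3)[THEN less_imp_le] nn in \<open>simp del: of_nat_Suc\<close>)
  have "(\<lambda>n. sq_integral lborel (\<lambda>x. indicator \<Omega> x * U n x - v x)) \<longlonglongrightarrow> 0"
    by (rule Lim_null_comparison[OF always_eventually lim]) (simp add: sobolev_sq_def sum_nonneg)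
  from L2_tendsto_AE_subseq[OF sobolevD(1)[OF U(2)] sobolevD(1)[OF s] this]
  \<comment> \<open>The subsequence is taken for the sake of pointwise convergence, which the
    convergence of the composed gradients relies on.\<close>
  obtain k :: "nat \<Rightarrow> nat" where k: "strict_mono k" "AE x in lborel. (\<lambda>n. indicator \<Omega> x * U (k n) x) \<longlonglongrightarrow> v x"
    by blast
  have limk: "(\<lambda>n. sobolev_sq (\<lambda>x. indicator \<Omega> x * U (k n) x - v x) (\<lambda>x. G (k n) x - h x)) \<longlonglongrightarrow> 0"
    by (rule filterlim_compose[OF lim filterlim_subseq[OF k(1)]])
  have limt: "(\<lambda>n. sobolev_sq (\<lambda>x. \<Phi> (indicator \<Omega> x * U (k n) x) - \<Phi> (v x))
      (\<lambda>x. \<Phi>' (indicator \<Omega> x * U (k n) x) *\<^sub>R G (k n) x - \<Phi>' (v x) *\<^sub>R h x)) \<longlonglongrightarrow> 0"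
  proof (rule sobolev_truncation_tendsto[OF O s])
    show "sobolev \<Omega> (\<lambda>x. indicator \<Omega> x * U (k n) x) (G (k n))" for n by (rule U(2))
  qed (rule limk k(2))+
  have rU: "represents \<Omega> (U n) (\<lambda>x. indicator \<Omega> x * U n x) (G n)" for n
    by (rule represents_continuous[OF U(1) U(2)])
  note rt = represents_truncation[OF O r] and rtU = represents_truncation[OF O rU]
  \<comment> \<open>The trace of \<Phi>(u) restricted to the zero set of the trace of
    \<open>u\<close>; the claim is that this function is 0, and its L^2 norm is what the
    approximation can estimate.\<close>
  define z where "z x = (if T u x = 0 then T (\<lambda>y. \<Phi> (u y)) x else 0)" for x
  note sT\<Phi> = trace_square_integrable[OF T represents_H1[OF O rt]]
  have Tu[measurable]: "T u \<in> borel_measurable ?B" and T\<Phi>[measurable]: "T (\<lambda>y. \<Phi> (u y)) \<in> borel_measurable ?B"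
    by (rule square_integrable_measurable[OF trace_square_integrable[OF T u]])
      (rule square_integrable_measurable[OF sT\<Phi>])
  have zm: "z \<in> borel_measurable ?B" unfolding z_def[abs_def] by measurable
  have "AE x in ?B. (z x)\<^sup>2 \<le> (T (\<lambda>y. \<Phi> (u y)) x)\<^sup>2"
    by (intro always_eventually allI) (simp add: z_def)
  then have sz: "square_integrable ?B z"
    by (rule square_integrable_bound[OF square_integrable_integrable[OF sT\<Phi>] zm])
  let ?E1 = "\<lambda>n. sobolev_sq (\<lambda>x. \<Phi> (indicator \<Omega> x * U (k n) x) - \<Phi> (v x))
      (\<lambda>x. \<Phi>' (indicator \<Omega> x * U (k n) x) *\<^sub>R G (k n) x - \<Phi>' (v x) *\<^sub>R h x)"
  let ?E2 = "\<lambda>n. sobolev_sq (\<lambda>x. indicator \<Omega> x * U (k n) x - v x) (\<lambda>x. G (k n) x - h x)"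
  have bd: "sq_integral ?B z \<le> 2 * (C * ?E1 n) + 2 * (M\<^sup>2 * (C * ?E2 n))" for n
  proof -
    let ?U = "U (k n)"
    note d1 = represents_diff[OF rtU[of "k n"] rt] and d2 = represents_diff[OF rU[of "k n"] r]
    let ?a = "T (\<lambda>x. \<Phi> (?U x) - \<Phi> (u x))" and ?b = "T (\<lambda>x. ?U x - u x)"
    have sa: "square_integrable ?B (\<lambda>x. \<bar>?a x\<bar>)" and sb: "square_integrable ?B (\<lambda>x. M * \<bar>?b x\<bar>)"
      by (rule square_integrable_abs[OF trace_square_integrable[OF T represents_H1[OF O d1]]])
        (rule square_integrable_cmult[OF square_integrable_abs[OF trace_square_integrable[OF T represents_H1[OF O d2]]]])
    have TU: "AE x in ?B. T ?U x = ?U x"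
      by (rule trace_continuous[OF T represents_H1[OF O rU] continuous_on_subset[OF U(1) subset_UNIV]])
    have "continuous_on (closure \<Omega>) (\<lambda>x. \<Phi> (?U x))"
      by (rule continuous_on_compose2[OF continuous_\<Phi> continuous_on_subset[OF U(1) subset_UNIV]]) simp
    then have T\<Phi>U: "AE x in ?B. T (\<lambda>x. \<Phi> (?U x)) x = \<Phi> (?U x)"
      by (rule trace_continuous[OF T represents_H1[OF O rtU]])
    have "AE x in ?B. \<bar>z x\<bar> \<le> \<bar>\<bar>?a x\<bar> + M * \<bar>?b x\<bar>\<bar>"
      using TU T\<Phi>U trace_diff[OF T O represents_H1[OF O rtU] represents_H1[OF O rt], of "k n"]
        trace_diff[OF T O represents_H1[OF O rU] u, of "k n"]
    proof eventually_elim
      case (elim x)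
      show ?case
      proof (cases "T u x = 0")
        case True
        have "\<bar>\<Phi> (?U x)\<bar> \<le> M * \<bar>?U x\<bar>" using \<Phi>_lipschitz[of "?U x" 0] by (simp add: zero)
        moreover have "z x = \<Phi> (?U x) - ?a x" using elim True by (simp only: z_def if_True) simp
        moreover have "?b x = ?U x" using elim True by (simp only:)
        ultimately have "\<bar>z x\<bar> \<le> \<bar>?a x\<bar> + M * \<bar>?b x\<bar>" by simp
        then show ?thesis by linarith
      next
        case False
        then show ?thesis by (simp add: z_def)
      qed
    qed
    then have "sq_integral ?B z \<le> sq_integral ?B (\<lambda>x. \<bar>?a x\<bar> + M * \<bar>?b x\<bar>)"
      by (rule sq_integral_mono[OF square_integrable_add[OF sa sb] zm])
    also have "\<dots> \<le> 2 * sq_integral ?B (\<lambda>x. \<bar>?a x\<bar>) + 2 * sq_integral ?B (\<lambda>x. M * \<bar>?b x\<bar>)"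
      by (rule sq_integral_add_le[OF sa sb])
    also have "\<dots> = 2 * sq_integral ?B ?a + 2 * (M\<^sup>2 * sq_integral ?B ?b)"
      by (simp add: sq_integral_def power_mult_distrib)
    also have "\<dots> \<le> 2 * (C * ?E1 n) + 2 * (M\<^sup>2 * (C * ?E2 n))"
      using C[OF d1] C[OF d2] by (intro add_mono mult_left_mono) auto
    finally show ?thesis .
  qed
  have "(\<lambda>n. 2 * (C * ?E1 n) + 2 * (M\<^sup>2 * (C * ?E2 n))) \<longlonglongrightarrow> 2 * (C * 0) + 2 * (M\<^sup>2 * (C * 0))"
    by (intro tendsto_add tendsto_mult tendsto_const limt limk)
  then have "sq_integral ?B z \<le> 2 * (C * 0) + 2 * (M\<^sup>2 * (C * 0))"
    using bd by (intro LIMSEQ_le_const) auto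
  then have "sq_integral ?B z = 0" using sq_integral_nonneg[of ?B z] by simp
  then have "AE x in ?B. z x = 0" using sq_integral_zero_iff[OF sz] by blast
  then show ?thesis by eventually_elim (simp add: z_def split: if_splits)
qed

end

subsection \<open>Comparison of solutions\<close>

text \<open>
  Replaces the positive part in the classical argument: it is \<open>C\<^sup>1\<close> with bounded Lipschitz derivative, so the
  chain rule is elementary, and it is bounded, so its products with \<open>f\<^sub>i\<close> are integrable without the
  Sobolev embedding.
\<close>

definition saturation :: "real \<Rightarrow> real" where
  "saturation t = (max 0 t)\<^sup>2 / (1 + (max 0 t)\<^sup>2)"

definition saturation_deriv :: "real \<Rightarrow> real" where
  "saturation_deriv t = 2 * max 0 t / (1 + (max 0 t)\<^sup>2)\<^sup>2"

lemma one_plus_square_pos: "1 + x\<^sup>2 > (0::real)"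
  using zero_le_power2[of x] by linarith

lemma saturation_nonneg: "saturation t \<ge> 0"
  and saturation_le_one: "saturation t \<le> 1"
  and saturation_eq_0: "t \<le> 0 \<Longrightarrow> saturation t = 0"
  and saturation_eq_0_iff: "saturation t = 0 \<longleftrightarrow> t \<le> 0"
  using one_plus_square_pos[of "max 0 t"] by (auto simp: saturation_def max_def)

text \<open>For \<open>t \<ge> 0\<close> this is \<open>t \<le> 1 + t^2\<close> multiplied by
  \<open>t\<close> and divided by \<open>1 + t^2\<close>. It is the bound that keeps
  \<open>u1 - w\<close> above the obstacle.\<close>

lemma saturation_le:
  assumes "t \<ge> 0"
  shows "saturation t \<le> t"
proof -
  have "t \<le> 1 + t\<^sup>2" using zero_le_power2[of "t - 1"] assms by (simp add: power2_diff)
  then have "t * t \<le> t * (1 + t\<^sup>2)" using assms by (intro mult_left_mono) auto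
  then show ?thesis
    using assms one_plus_square_pos[of t] by (simp add: saturation_def pos_divide_le_eq power2_eq_square)
qed

lemma saturation_deriv_nonneg: "saturation_deriv t \<ge> 0"
  by (simp add: saturation_deriv_def)

lemma positive_part_square_derivative:
  "((\<lambda>t. (max 0 t)\<^sup>2) has_real_derivative 2 * max 0 t) (at t)"
proof -
  consider "t > 0" | "t = 0" | "t < 0" by linarith
  then show ?thesis
  proof cases
    case 1
    have "((\<lambda>t. t\<^sup>2) has_real_derivative 2 * t) (at t)" by (auto intro!: derivative_eq_intros)
    then have "((\<lambda>t. (max 0 t)\<^sup>2) has_real_derivative 2 * t) (at t)"
    proof (rule has_field_derivative_transform_within_open)
      show "open {0::real<..}" "t \<in> {0<..}" using 1 by auto
    qed simp
    then show ?thesis using 1 by simp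
  next
    case 2
    have "((\<lambda>h::real. max 0 h) \<longlongrightarrow> max 0 0) (at 0)" by (intro tendsto_intros)
    then have lim: "((\<lambda>h::real. max 0 h) \<longlongrightarrow> 0) (at 0)" by simp
    have "((\<lambda>h::real. ((max 0 (0 + h))\<^sup>2 - (max 0 0)\<^sup>2) / h) \<longlongrightarrow> 0) (at 0)"
      by (rule Lim_transform_eventually[OF lim])
        (auto simp: eventually_at max_def power2_eq_square intro!: exI[of _ 1])
    then show ?thesis using 2 by (simp add: DERIV_def)
  next
    case 3
    have "((\<lambda>t. 0) has_real_derivative 0) (at t)" by simp
    then have "((\<lambda>t. (max 0 t)\<^sup>2) has_real_derivative 0) (at t)"
    proof (rule has_field_derivative_transform_within_open)
      show "open {..<0::real}" "t \<in> {..<0}" using 3 by auto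
    qed simp
    then show ?thesis using 3 by simp
  qed
qed

lemma saturation_has_derivative: "(saturation has_real_derivative saturation_deriv t) (at t)"
proof -
  let ?q = "max 0 t"
  have nz: "1 + ?q\<^sup>2 \<noteq> 0" using one_plus_square_pos[of ?q] by simp
  have d: "((\<lambda>t. 1 + (max 0 t)\<^sup>2) has_real_derivative 0 + 2 * ?q) (at t)"
    by (intro DERIV_add DERIV_const positive_part_square_derivative)
  have "((\<lambda>t. (max 0 t)\<^sup>2 / (1 + (max 0 t)\<^sup>2)) has_real_derivative
      ((2 * ?q) * (1 + ?q\<^sup>2) - ?q\<^sup>2 * (0 + 2 * ?q)) / ((1 + ?q\<^sup>2) * (1 + ?q\<^sup>2))) (at t)"
    by (rule DERIV_divide[OF positive_part_square_derivative d nz])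
  moreover have "((2 * ?q) * (1 + ?q\<^sup>2) - ?q\<^sup>2 * (0 + 2 * ?q)) / ((1 + ?q\<^sup>2) * (1 + ?q\<^sup>2)) = saturation_deriv t"
    by (simp add: saturation_deriv_def power2_eq_square algebra_simps)
  ultimately show ?thesis by (simp add: saturation_def[abs_def])
qed

lemma saturation_deriv_le_one: "\<bar>saturation_deriv t\<bar> \<le> 1"
proof -
  define q where "q = max 0 t"
  have "2 * q \<le> 1 + q\<^sup>2" using zero_le_power2[of "q - 1"] by (simp add: power2_diff)
  also have "\<dots> \<le> (1 + q\<^sup>2)\<^sup>2" by (rule self_le_power) auto
  finally have "2 * q / (1 + q\<^sup>2)\<^sup>2 \<le> 1" using one_plus_square_pos[of q] by (simp add: divide_le_eq)
  then show ?thesis using saturation_deriv_nonneg[of t] by (simp add: saturation_deriv_def q_def)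
qed

text \<open>\<open>saturation_deriv\<close> is the composition of the smooth \<open>k\<close> with
  the positive part, which is 1-Lipschitz, so the kink at 0 does no harm and a bound for the
  derivative of \<open>k\<close> suffices.\<close>

lemma saturation_deriv_lipschitz: "\<bar>saturation_deriv s - saturation_deriv t\<bar> \<le> 6 * \<bar>s - t\<bar>"
proof -
  define k where "k q = 2 * q / (1 + q\<^sup>2)\<^sup>2" for q :: real
  define k' where "k' q = (2 * (1 + q\<^sup>2)\<^sup>2 - 2 * q * (2 * (1 + q\<^sup>2) * (2 * q))) / ((1 + q\<^sup>2)\<^sup>2 * (1 + q\<^sup>2)\<^sup>2)" for q :: real
  have kd: "(k has_real_derivative k' q) (at q)" for q
    unfolding k_def[abs_def] k'_def using one_plus_square_pos[of q]
    by (intro DERIV_divide) (auto intro!: derivative_eq_intros)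
  have kb: "\<bar>k' q\<bar> \<le> 6" for q
  proof -
    define y where "y = 1 + q\<^sup>2"
    have y: "y \<ge> 1" "q\<^sup>2 = y - 1" by (auto simp: y_def)
    \<comment> \<open>With \<open>y = 1 + q^2 \<ge> 1\<close>, the numerator has absolute value at
      most \<open>6 * y^2\<close> because \<open>\<bar>8 - 6 * y\<bar> \<le> 6 * y\<close>. The
      denominator is \<open>y^4\<close>, which yields the constant 6.\<close>
    have num: "2 * y\<^sup>2 - 2 * q * (2 * y * (2 * q)) = y * (8 - 6 * y)"
    proof -
      have "2 * y\<^sup>2 - 2 * q * (2 * y * (2 * q)) = 2 * y\<^sup>2 - 8 * y * q\<^sup>2" by (simp add: power2_eq_square)
      also have "\<dots> = y * (8 - 6 * y)" unfolding y(2) by (simp add: power2_eq_square algebra_simps)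
      finally show ?thesis .
    qed
    have "\<bar>y * (8 - 6 * y)\<bar> = y * \<bar>8 - 6 * y\<bar>" using y(1) by (simp add: abs_mult)
    also have "\<dots> \<le> y * (6 * y)" using y(1) by (intro mult_left_mono) auto
    also have "\<dots> = 6 * y\<^sup>2" by (simp add: power2_eq_square)
    also have "\<dots> \<le> 6 * (y\<^sup>2 * y\<^sup>2)"
    proof -
      have "1 \<le> y\<^sup>2" using y(1) by (rule one_le_power)
      then have "y\<^sup>2 * 1 \<le> y\<^sup>2 * y\<^sup>2" by (intro mult_left_mono) auto
      then show ?thesis by simp
    qed
    finally have "\<bar>y * (8 - 6 * y)\<bar> \<le> 6 * (y\<^sup>2 * y\<^sup>2)" .
    moreover have "y\<^sup>2 * y\<^sup>2 > 0" using y(1) by simp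
    moreover have "k' q = y * (8 - 6 * y) / (y\<^sup>2 * y\<^sup>2)"
      unfolding k'_def y_def[symmetric] num ..
    ultimately show ?thesis by (simp add: abs_divide divide_le_eq)
  qed
  have "norm (k (max 0 s) - k (max 0 t)) \<le> 6 * norm (max 0 s - max 0 t)"
    by (rule field_differentiable_bound[of UNIV k k']) (simp_all add: kd kb)
  moreover have "\<bar>max 0 s - max 0 t\<bar> \<le> \<bar>s - t\<bar>" by (auto simp: max_def)
  ultimately have "\<bar>k (max 0 s) - k (max 0 t)\<bar> \<le> 6 * \<bar>s - t\<bar>" by simp
  then show ?thesis by (simp add: k_def saturation_deriv_def)
qed

interpretation saturation: truncation saturation saturation_deriv 1 6
  by unfold_locales
    (rule saturation_eq_0[OF order_refl] saturation_has_derivative saturation_deriv_le_one saturation_deriv_lipschitz)+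

text \<open>On a set of finite measure \<open>1 + \<bar>f x\<bar> powr p\<close> is integrable and
  dominates \<open>\<bar>f x\<bar>\<close>, so a bounded factor keeps the pairing
  meaningful.\<close>

lemma Lp_mult_bounded_integrable:
  fixes f w :: "'a::euclidean_space \<Rightarrow> real"
  assumes O: "open \<Omega>" "bounded \<Omega>" and p: "1 < p" and f: "f \<in> Lp p (lebesgue_on \<Omega>)"
    and w: "w \<in> borel_measurable (lebesgue_on \<Omega>)" "\<And>x. \<bar>w x\<bar> \<le> 1"
  shows "integrable (lebesgue_on \<Omega>) (\<lambda>x. f x * w x)"
proof (rule Bochner_Integration.integrable_bound)
  have fm: "f \<in> borel_measurable (lebesgue_on \<Omega>)" "integrable (lebesgue_on \<Omega>) (\<lambda>x. \<bar>f x\<bar> powr p)"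
    using f by (simp_all add: Lp_def)
  interpret finite_measure "lebesgue_on \<Omega>"
    using O by (intro finite_measure_lebesgue_on lmeasurable_open)
  show "integrable (lebesgue_on \<Omega>) (\<lambda>x. 1 + \<bar>f x\<bar> powr p)" using fm(2) by simp
  show "(\<lambda>x. f x * w x) \<in> borel_measurable (lebesgue_on \<Omega>)" using fm(1) w(1) by (rule borel_measurable_times)
  have "norm (f x * w x) \<le> norm (1 + \<bar>f x\<bar> powr p)" for x
  proof -
    have "\<bar>f x * w x\<bar> \<le> \<bar>f x\<bar>" using w(2)[of x] by (simp add: abs_mult mult_left_le)
    also have "\<bar>f x\<bar> \<le> 1 + \<bar>f x\<bar> powr p"
    proof (cases "\<bar>f x\<bar> \<le> 1")
      case True
      then show ?thesis using powr_ge_zero[of "\<bar>f x\<bar>" p] by linarith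
    next
      case False
      then have "\<bar>f x\<bar> powr 1 \<le> \<bar>f x\<bar> powr p" using p by (intro powr_mono) auto
      then show ?thesis using False by simp
    qed
    finally show ?thesis by simp
  qed
  then show "AE x in lebesgue_on \<Omega>. norm (f x * w x) \<le> norm (1 + \<bar>f x\<bar> powr p)" by simp
qed

text \<open>Translates a statement about boundary points almost everywhere into one about the
  Hausdorff measure of \<open>\<Gamma>\<close>, the form in which the condition on \<sigma> is
  given. Relative openness makes \<open>\<Gamma>\<close> the intersection of a closed and an open
  set, hence Borel.\<close>

lemma boundary_measure_null:
  fixes \<Omega> :: "'a::euclidean_space set"
  assumes op: "openin (top_of_set (frontier \<Omega>)) \<Gamma>" and ae: "AE x in boundary_measure \<Omega>. x \<notin> \<Gamma>"
  shows "emeasure (hausdorff_measure (DIM('a) - 1)) \<Gamma> = 0"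
proof -
  let ?H = "hausdorff_measure (DIM('a) - 1) :: 'a measure"
  have sets: "sets ?H = sets borel"
    by (simp add: hausdorff_measure_def sets.sigma_sets_eq[of borel, simplified])
  have space: "space ?H = UNIV" by (simp add: hausdorff_measure_def)
  have fr: "frontier \<Omega> \<in> sets ?H" unfolding sets by (simp add: borel_closed)
  obtain U where U: "open U" "\<Gamma> = frontier \<Omega> \<inter> U" using op by (auto simp: openin_open)
  then have \<Gamma>: "\<Gamma> \<in> sets ?H" unfolding sets by (simp add: borel_closed borel_open sets.Int)
  have "AE x in ?H. x \<in> frontier \<Omega> \<longrightarrow> x \<notin> \<Gamma>"
    using ae fr unfolding boundary_measure_def by (subst (asm) AE_restrict_space_iff) (simp_all add: space)
  then have "AE x in ?H. x \<notin> \<Gamma>" by eventually_elim (use U(2) in auto)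
  then have "\<Gamma> \<in> null_sets ?H" using AE_iff_null_sets[OF \<Gamma>] by blast
  then show ?thesis by auto
qed

lemma V_space_diff:
  assumes T: "trace_operator \<Omega> T" and O: "open \<Omega>" and u: "u \<in> V_space \<Omega> \<Gamma> T" and v: "v \<in> V_space \<Omega> \<Gamma> T"
  shows "(\<lambda>x. u x - v x) \<in> V_space \<Omega> \<Gamma> T"
proof -
  have H: "u \<in> H1 \<Omega>" "v \<in> H1 \<Omega>" and t: "AE x in boundary_measure \<Omega>. x \<in> \<Gamma> \<longrightarrow> T u x = 0"
    "AE x in boundary_measure \<Omega>. x \<in> \<Gamma> \<longrightarrow> T v x = 0" using u v unfolding V_space_def by blast+
  obtain a b where r: "represents \<Omega> u a b" using H1_represents[OF O H(1)] by blast
  obtain c d where r': "represents \<Omega> v c d" using H1_represents[OF O H(2)] by blast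
  have "AE x in boundary_measure \<Omega>. x \<in> \<Gamma> \<longrightarrow> T (\<lambda>y. u y - v y) x = 0"
    using trace_diff[OF T O H] t by eventually_elim simp
  then show ?thesis
    unfolding V_space_def using represents_H1[OF O represents_diff[OF r r']] by blast
qed

text \<open>Closure under differences is enough, since \<open>- u = (u - u) - u\<close>.\<close>

lemma V_space_uminus:
  assumes T: "trace_operator \<Omega> T" and O: "open \<Omega>" and u: "u \<in> V_space \<Omega> \<Gamma> T"
  shows "(\<lambda>x. - u x) \<in> V_space \<Omega> \<Gamma> T"
  using V_space_diff[OF T O V_space_diff[OF T O u u] u] by simp

lemma V_space_saturation:
  assumes D: "bounded_lipschitz_domain \<Omega>" and T: "trace_operator \<Omega> T" and u: "u \<in> V_space \<Omega> \<Gamma> T"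
  shows "(\<lambda>x. saturation (u x)) \<in> V_space \<Omega> \<Gamma> T"
proof -
  have O: "open \<Omega>" using D by (simp add: bounded_lipschitz_domain_def)
  have H: "u \<in> H1 \<Omega>" and t: "AE x in boundary_measure \<Omega>. x \<in> \<Gamma> \<longrightarrow> T u x = 0"
    using u unfolding V_space_def by blast+
  obtain a b where r: "represents \<Omega> u a b" using H1_represents[OF O H] by blast
  have "AE x in boundary_measure \<Omega>. x \<in> \<Gamma> \<longrightarrow> T (\<lambda>y. saturation (u y)) x = 0"
    using saturation.trace_truncation_zero[OF D T H] t by eventually_elim blast
  then show ?thesis
    unfolding V_space_def using represents_H1[OF O saturation.represents_truncation[OF O r]] by blast
qed

theorem theorem3p9:
  fixes \<Omega> \<Gamma>\<^sub>D \<Gamma>\<^sub>N :: "'a::euclidean_space set"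
    and \<gamma>\<^sub>0 :: "('a \<Rightarrow> real) \<Rightarrow> ('a \<Rightarrow> real)"
    and \<sigma> p :: real
    and f1 f2 \<psi>1 \<psi>2 u1 u2 :: "'a \<Rightarrow> real"
  defines "V \<equiv> V_space \<Omega> \<Gamma>\<^sub>D \<gamma>\<^sub>0"
  assumes "bounded_lipschitz_domain \<Omega>"
    and "\<Gamma>\<^sub>D \<union> \<Gamma>\<^sub>N = frontier \<Omega>" and "\<Gamma>\<^sub>D \<inter> \<Gamma>\<^sub>N = {}"
    and "openin (top_of_set (frontier \<Omega>)) \<Gamma>\<^sub>D"
    and "trace_operator \<Omega> \<gamma>\<^sub>0"
    and "\<sigma> \<ge> 0"
    and "emeasure (hausdorff_measure (DIM('a) - 1)) \<Gamma>\<^sub>D = 0 \<Longrightarrow> \<sigma> > 0"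
    and "1 < p" and "p \<ge> 2 * real DIM('a) / (real DIM('a) + 2)"
    and "f1 \<in> Lp p (lebesgue_on \<Omega>)" and "f2 \<in> Lp p (lebesgue_on \<Omega>)"
    and "\<psi>1 \<in> V" and "\<psi>2 \<in> V"
    and "functional_in_Lp p \<Omega> V (A_op \<Omega> \<sigma> \<psi>1)" and "functional_in_Lp p \<Omega> V (A_op \<Omega> \<sigma> \<psi>2)"
    and "solves_VI \<Omega> \<sigma> (K0 \<Omega> V \<psi>1) f1 u1"
    and "solves_VI \<Omega> \<sigma> (K0 \<Omega> V \<psi>2) f2 u2"
    and "AE x in lebesgue_on \<Omega>. f1 x \<le> f2 x"
    and "AE x in lebesgue_on \<Omega>. \<psi>1 x \<le> \<psi>2 x"
  shows "AE x in lebesgue_on \<Omega>. u1 x \<le> u2 x"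
proof -
  note D = \<open>bounded_lipschitz_domain \<Omega>\<close> and T = \<open>trace_operator \<Omega> \<gamma>\<^sub>0\<close>
  have O: "open \<Omega>" "bounded \<Omega>" "connected \<Omega>" using D unfolding bounded_lipschitz_domain_def by blast+
  have u1V: "u1 \<in> V" and \<psi>u1: "AE x in lebesgue_on \<Omega>. \<psi>1 x \<le> u1 x"
    and VI1: "\<And>v. v \<in> V \<Longrightarrow> AE x in lebesgue_on \<Omega>. \<psi>1 x \<le> v x \<Longrightarrow>
      Lp_functional \<Omega> f1 (\<lambda>x. v x - u1 x) \<le> A_op \<Omega> \<sigma> u1 (\<lambda>x. v x - u1 x)"
    using \<open>solves_VI \<Omega> \<sigma> (K0 \<Omega> V \<psi>1) f1 u1\<close> unfolding solves_VI_def K0_def by blast+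
  have u2V: "u2 \<in> V" and \<psi>u2: "AE x in lebesgue_on \<Omega>. \<psi>2 x \<le> u2 x"
    and VI2: "\<And>v. v \<in> V \<Longrightarrow> AE x in lebesgue_on \<Omega>. \<psi>2 x \<le> v x \<Longrightarrow>
      Lp_functional \<Omega> f2 (\<lambda>x. v x - u2 x) \<le> A_op \<Omega> \<sigma> u2 (\<lambda>x. v x - u2 x)"
    using \<open>solves_VI \<Omega> \<sigma> (K0 \<Omega> V \<psi>2) f2 u2\<close> unfolding solves_VI_def K0_def by blast+
  define w where "w x = saturation (u1 x - u2 x)" for x
  have wV: "w \<in> V"
    unfolding w_def[abs_def] V_def
    by (rule V_space_saturation[OF D T V_space_diff[OF T O(1) u1V[unfolded V_def] u2V[unfolded V_def]]])
  have V1: "(\<lambda>x. u1 x - w x) \<in> V"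
    using V_space_diff[OF T O(1) u1V[unfolded V_def] wV[unfolded V_def]] unfolding V_def .
  \<comment> \<open>The competitor \<open>u2 + w\<close> is written as a difference, the form in
    which closure of \<open>V\<close> is available.\<close>
  have V2: "(\<lambda>x. u2 x - - w x) \<in> V"
    using V_space_diff[OF T O(1) u2V[unfolded V_def] V_space_uminus[OF T O(1) wV[unfolded V_def]]] unfolding V_def .
  have wle: "w x \<le> max 0 (u1 x - u2 x)" for x
    using saturation_eq_0[of "u1 x - u2 x"] saturation_le[of "u1 x - u2 x"] by (simp add: w_def max_def)
  have w0: "0 \<le> w x" and w1: "\<bar>w x\<bar> \<le> 1" for x
    using saturation_nonneg[of "u1 x - u2 x"] saturation_le_one[of "u1 x - u2 x"] by (simp_all add: w_def)
  \<comment> \<open>Where \<open>u1 \<le> u2\<close>, the function \<open>w\<close> is 0. Elsewhere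
    \<open>u1 - w\<close> is at least \<open>u2\<close>, which lies above \<open>\<psi>2\<close> and
    therefore above \<open>\<psi>1\<close>.\<close>
  have "AE x in lebesgue_on \<Omega>. \<psi>1 x \<le> u1 x - w x"
    using \<psi>u1 \<psi>u2 \<open>AE x in lebesgue_on \<Omega>. \<psi>1 x \<le> \<psi>2 x\<close>
  proof eventually_elim
    case (elim x)
    then show ?case using wle[of x] by (simp add: max_def split: if_splits)
  qed
  from VI1[OF V1 this] have I1: "Lp_functional \<Omega> f1 (\<lambda>x. - w x) \<le> A_op \<Omega> \<sigma> u1 (\<lambda>x. - w x)"
    by simp
  have "AE x in lebesgue_on \<Omega>. \<psi>2 x \<le> u2 x - - w x"
    using \<psi>u2 by eventually_elim (use w0 in \<open>simp add: add_increasing2\<close>)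
  from VI2[OF V2 this] have I2: "Lp_functional \<Omega> f2 w \<le> A_op \<Omega> \<sigma> u2 w"
    by simp
  have H1: "u1 \<in> H1 \<Omega>" "u2 \<in> H1 \<Omega>" using u1V u2V unfolding V_def V_space_def by blast+
  obtain v1 h1 where r1: "represents \<Omega> u1 v1 h1" using H1_represents[OF O(1) H1(1)] by blast
  obtain v2 h2 where r2: "represents \<Omega> u2 v2 h2" using H1_represents[OF O(1) H1(2)] by blast
  define d g where "d x = v1 x - v2 x" and "g x = h1 x - h2 x" for x
  have rd: "represents \<Omega> (\<lambda>x. u1 x - u2 x) d g"
    using represents_diff[OF r1 r2] unfolding d_def[abs_def] g_def[abs_def] .
  have rw: "represents \<Omega> w (\<lambda>x. saturation (d x)) (\<lambda>x. saturation_deriv (d x) *\<^sub>R g x)"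
    using saturation.represents_truncation[OF O(1) rd] unfolding w_def[abs_def] .
  have rmw: "represents \<Omega> (\<lambda>x. - w x) (\<lambda>x. - 1 * saturation (d x)) (\<lambda>x. - 1 *\<^sub>R (saturation_deriv (d x) *\<^sub>R g x))"
    using represents_cmult[OF rw, of "- 1"] by simp
  note s1 = representsD(2)[OF r1] and s2 = representsD(2)[OF r2] and sd = representsD(2)[OF rd] and sw = representsD(2)[OF rw]
  have i1: "integrable lborel (\<lambda>x. h1 x \<bullet> (saturation_deriv (d x) *\<^sub>R g x))"
    and i2: "integrable lborel (\<lambda>x. h2 x \<bullet> (saturation_deriv (d x) *\<^sub>R g x))"
    by (rule sobolev_gradient_inner_integrable[OF s1 sw], rule sobolev_gradient_inner_integrable[OF s2 sw])
  have j1: "integrable lborel (\<lambda>x. v1 x * saturation (d x))" and j2: "integrable lborel (\<lambda>x. v2 x * saturation (d x))"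
    by (rule square_integrable_mult_integrable[OF sobolevD(1)[OF s1] sobolevD(1)[OF sw]],
        rule square_integrable_mult_integrable[OF sobolevD(1)[OF s2] sobolevD(1)[OF sw]])
  \<comment> \<open>The integrand of \<open>a(u1 - u2, w)\<close>, in terms of representatives: the
    gradient of \<open>w\<close> is \<open>saturation_deriv (d x) *\<^sub>R g x\<close>.\<close>
  define J where "J x = saturation_deriv (d x) * (g x \<bullet> g x) + \<sigma> * (d x * saturation (d x))" for x
  have Jeq: "J x = (h1 x \<bullet> (saturation_deriv (d x) *\<^sub>R g x) + \<sigma> * (v1 x * saturation (d x))) -
      (h2 x \<bullet> (saturation_deriv (d x) *\<^sub>R g x) + \<sigma> * (v2 x * saturation (d x)))" for x
    by (simp add: J_def g_def d_def inner_diff_left inner_diff_right algebra_simps)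
  have Ji: "integrable lborel J"
    unfolding Jeq[abs_def] using i1 i2 j1 j2
    by (intro Bochner_Integration.integrable_diff Bochner_Integration.integrable_add integrable_mult_right)
  have A1: "A_op \<Omega> \<sigma> u1 (\<lambda>x. - w x) =
      - (LINT x|lborel. h1 x \<bullet> (saturation_deriv (d x) *\<^sub>R g x) + \<sigma> * (v1 x * saturation (d x)))"
    unfolding represents_A_op[OF O(1) r1 rmw] Bochner_Integration.integral_minus[symmetric]
    by (rule Bochner_Integration.integral_cong[OF refl]) simp
  have A2: "A_op \<Omega> \<sigma> u2 w = (LINT x|lborel. h2 x \<bullet> (saturation_deriv (d x) *\<^sub>R g x) + \<sigma> * (v2 x * saturation (d x)))"
    unfolding represents_A_op[OF O(1) r2 rw] by (simp add: mult.assoc)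
  have "(LINT x|lborel. J x) = (LINT x|lborel. h1 x \<bullet> (saturation_deriv (d x) *\<^sub>R g x) + \<sigma> * (v1 x * saturation (d x))) -
      (LINT x|lborel. h2 x \<bullet> (saturation_deriv (d x) *\<^sub>R g x) + \<sigma> * (v2 x * saturation (d x)))"
    unfolding Jeq[abs_def] using i1 i2 j1 j2
    by (intro Bochner_Integration.integral_diff Bochner_Integration.integrable_add integrable_mult_right)
  then have JA: "(LINT x|lborel. J x) = - A_op \<Omega> \<sigma> u1 (\<lambda>x. - w x) - A_op \<Omega> \<sigma> u2 w"
    unfolding A1 A2 by simp
  have wm: "w \<in> borel_measurable (lebesgue_on \<Omega>)" by (rule representsD(1)[OF rw])
  note fw1 = Lp_mult_bounded_integrable[OF O(1,2) \<open>1 < p\<close> \<open>f1 \<in> Lp p (lebesgue_on \<Omega>)\<close> wm w1]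
  note fw2 = Lp_mult_bounded_integrable[OF O(1,2) \<open>1 < p\<close> \<open>f2 \<in> Lp p (lebesgue_on \<Omega>)\<close> wm w1]
  have "AE x in lebesgue_on \<Omega>. f1 x * w x \<le> f2 x * w x"
    using \<open>AE x in lebesgue_on \<Omega>. f1 x \<le> f2 x\<close> by eventually_elim (use w0 in \<open>simp add: mult_right_mono\<close>)
  then have "Lp_functional \<Omega> f1 w \<le> Lp_functional \<Omega> f2 w"
    unfolding Lp_functional_def by (rule integral_mono_AE[OF fw1 fw2])
  moreover have "Lp_functional \<Omega> f1 (\<lambda>x. - w x) = - Lp_functional \<Omega> f1 w"
    by (simp add: Lp_functional_def)
  \<comment> \<open>By \<open>I1\<close> and \<open>I2\<close> the integral of \<open>J\<close> is
    at most the integral of \<open>(f1 - f2) * w\<close>, and this is nonpositive because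
    \<open>w \<ge> 0\<close>.\<close>
  ultimately have Jle: "(LINT x|lborel. J x) \<le> 0"
    using I1 I2 unfolding JA by linarith
  have part1: "0 \<le> saturation_deriv (d x) * (g x \<bullet> g x)" for x
    using saturation_deriv_nonneg[of "d x"] by simp
  have ds: "0 \<le> d x * saturation (d x)" for x
    using saturation_nonneg[of "d x"] saturation_eq_0[of "d x"] by (cases "d x \<le> 0") simp_all
  then have part2: "0 \<le> \<sigma> * (d x * saturation (d x))" for x
    using \<open>\<sigma> \<ge> 0\<close> by simp
  \<comment> \<open>Both summands are nonnegative pointwise, so an integral that is at most 0 makes
    each of them vanish almost everywhere.\<close>
  have Jnn: "0 \<le> J x" for x using part1[of x] part2[of x] by (simp add: J_def)
  have "(LINT x|lborel. J x) \<ge> 0" using Jnn by (intro Bochner_Integration.integral_nonneg)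
  then have "(LINT x|lborel. J x) = 0" using Jle by simp
  then have J0: "AE x in lborel. J x = 0"
    using integral_nonneg_eq_0_iff_AE[OF Ji] Jnn by simp
  have "AE x in lborel. x \<in> \<Omega> \<longrightarrow> saturation (d x) = 0"
  proof (cases "\<sigma> > 0")
    case True
    from J0 show ?thesis
    proof eventually_elim
      case (elim x)
      then have "\<sigma> * (d x * saturation (d x)) = 0" using part1[of x] part2[of x] unfolding J_def by linarith
      then show ?case using True saturation_eq_0[of "d x"] by auto
    qed
  next
    case False
    \<comment> \<open>Where the coefficient is nonzero, \<open>g x\<close> must vanish; in either
      case the product, which is the gradient of \<open>w\<close>, is 0.\<close>
    have grad0: "AE x in lborel. saturation_deriv (d x) *\<^sub>R g x = 0"
      using J0
    proof eventually_elim
      case (elim x)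
      then have "saturation_deriv (d x) * (g x \<bullet> g x) = 0" using part1[of x] part2[of x] unfolding J_def by linarith
      then show ?case by auto
    qed
    from sobolev_zero_gradient_const[OF sw grad0 O(1,3)]
    obtain c where c: "AE x in lborel. x \<in> \<Omega> \<longrightarrow> saturation (d x) = c" by blast
    \<comment> \<open>The constant \<open>c\<close> is continuous, so its trace is known to be
      \<open>c\<close>; since \<open>w\<close> equals \<open>c\<close> almost everywhere in
      \<Omega>, the trace of \<open>w\<close> is \<open>c\<close> as well.\<close>
    have sc: "represents \<Omega> (\<lambda>x. c) (\<lambda>x. indicator \<Omega> x * c) (\<lambda>x. 0)"
      by (rule represents_continuous[OF continuous_on_const sobolev_const[OF O(1,2)]])
    have "AE x in lborel. x \<in> \<Omega> \<longrightarrow> w x = c"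
      using c representsD(3)[OF rw] by eventually_elim simp
    from trace_AE_cong[OF T O(1) represents_H1[OF O(1) rw] represents_H1[OF O(1) sc] this]
      trace_continuous[OF T represents_H1[OF O(1) sc] continuous_on_const]
    have tw: "AE x in boundary_measure \<Omega>. \<gamma>\<^sub>0 w x = c" by eventually_elim simp
    have "AE x in boundary_measure \<Omega>. x \<in> \<Gamma>\<^sub>D \<longrightarrow> \<gamma>\<^sub>0 w x = 0"
      using wV unfolding V_def V_space_def by blast
    with tw have ae: "AE x in boundary_measure \<Omega>. x \<in> \<Gamma>\<^sub>D \<longrightarrow> c = 0" by eventually_elim simp
    have "c = 0"
    proof (rule ccontr)
      assume "c \<noteq> 0"
      \<comment> \<open>A nonzero constant trace would contradict \<open>w \<in> V\<close> at every
        point of \<open>\<Gamma>\<^sub>D\<close> outside a null set. So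
        \<open>\<Gamma>\<^sub>D\<close> would be null, and then \<open>assms(8)\<close> would force
        \<open>\<sigma> > 0\<close>, against the present case.\<close>
      then have "AE x in boundary_measure \<Omega>. x \<notin> \<Gamma>\<^sub>D" using ae by simp
      from boundary_measure_null[OF \<open>openin (top_of_set (frontier \<Omega>)) \<Gamma>\<^sub>D\<close> this]
      show False using False assms(8) by blast
    qed
    then show ?thesis using c by simp
  qed
  then have "AE x in lborel. x \<in> \<Omega> \<longrightarrow> u1 x \<le> u2 x"
    using representsD(3)[OF r1] representsD(3)[OF r2]
    by eventually_elim (simp add: saturation_eq_0_iff d_def)
  then show ?thesis unfolding AE_lebesgue_on_iff[OF O(1)] .
qed

end
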